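(* Let $k$ be a field and let $S$ be a finite Koszul set of $k$-points in $\mathbb{P}^n$ imposing independent conditions on quadrics. Then every subset of $S$ is also Koszul.
   Context: Fix a ground field $k$; points of $\mathbb{P}^n$ are $k$-points. For a finite set $S\subset\mathbb{P}^n$, its homogeneous coordinate ring is $A_S=k[x_0,\dots,x_n]/I_S$, where $I_S$ is the homogeneous ideal generated by the homogeneous polynomials vanishing on $S$ (with the convention $A_\emptyset=k$). A graded $k$-algebra $A=\bigoplus_{m\ge 0}A_m$ with $A_0=k$ is Koszul if $\operatorname{Tor}^A_{i,j}(k,k)=0$ whenever $i\ne j$, where $j$ denotes the internal degree. The set $S$ is called Koszul if $A_S$ is Koszul. A finite set $S\subset\mathbb{P}^n$ imposes independent conditions on quadrics if the evaluation map $H^0(\mathbb{P}^n,\mathcal{O}(2))\to H^0(S,\mathcal{O}(2)|_S)$ is surjective. *)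

theory Defs
  imports
    "HOL-Library.Poly_Mapping"
    "HOL-Algebra.QuotRing"
    "HOL-Algebra.Module"
    "HOL-Algebra.Elementary_Groups"
    "HOL-Algebra.Algebraic_Closure_Type"
begin

section \<open>Graded free resolutions of the residue field, Tor, and Koszul algebras\<close>

text \<open>
  A graded ring is given by a ring \<open>A\<close> together with its family \<open>gr m\<close> of homogeneous components.
  It is meant to satisfy \<open>A = (\<Oplus>m. gr m)\<close> with \<open>gr 0\<close> a field \<open>k\<close>; then \<open>irrel A gr\<close> is the
  ideal of elements of positive degree, and \<open>resmod A gr\<close> is \<open>k\<close>, as a module over \<open>A\<close>.
\<close>

definition irrel :: "('a, 'm) ring_scheme \<Rightarrow> (nat \<Rightarrow> 'a set) \<Rightarrow> 'a set" where
  "irrel A gr = Idl\<^bsub>A\<^esub> (\<Union>m\<in>{0<..}. gr m)"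

definition resmod :: "('a, 'm) ring_scheme \<Rightarrow> (nat \<Rightarrow> 'a set) \<Rightarrow> ('a, 'a set) module" where
  "resmod A gr = ring.extend (A Quot irrel A gr)
     (module.fields (\<lambda>a u. (irrel A gr +>\<^bsub>A\<^esub> a) \<otimes>\<^bsub>A Quot irrel A gr\<^esub> u))"

text \<open>
  The free module with basis \<open>B\<close>. Basis sets are sets of natural numbers, which is
  enough for resolutions over a graded algebra generated by finitely many elements. The
  multiplicative fields of the record play no role.
\<close>

definition free_module :: "('a, 'm) ring_scheme \<Rightarrow> nat set \<Rightarrow> ('a, nat \<Rightarrow> 'a) module" where
  "free_module A B =
    \<lparr> carrier = {x. (\<forall>b. x b \<in> carrier A) \<and> (\<forall>b. b \<notin> B \<longrightarrow> x b = \<zero>\<^bsub>A\<^esub>) \<and> finite {b. x b \<noteq> \<zero>\<^bsub>A\<^esub>}},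
      monoid.mult = undefined,
      monoid.one = undefined,
      ring.zero = (\<lambda>_. \<zero>\<^bsub>A\<^esub>),
      ring.add = (\<lambda>x y b. x b \<oplus>\<^bsub>A\<^esub> y b),
      module.smult = (\<lambda>a x b. a \<otimes>\<^bsub>A\<^esub> x b) \<rparr>"

text \<open>Degree-\<open>j\<close> part of the graded free module whose basis element \<open>b\<close> has degree \<open>e b\<close>.\<close>

definition free_part ::
  "('a, 'm) ring_scheme \<Rightarrow> (nat \<Rightarrow> 'a set) \<Rightarrow> nat set \<Rightarrow> (nat \<Rightarrow> nat) \<Rightarrow> nat \<Rightarrow> (nat \<Rightarrow> 'a) set" where
  "free_part A gr B e j =
    {x \<in> carrier (free_module A B).
       \<forall>b\<in>B. if e b \<le> j then x b \<in> gr (j - e b) else x b = \<zero>\<^bsub>A\<^esub>}"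

definition module_hom ::
  "('a, 'm) ring_scheme \<Rightarrow> ('a, 'b) module \<Rightarrow> ('a, 'c) module \<Rightarrow> ('b \<Rightarrow> 'c) set" where
  "module_hom A M N =
    {h \<in> hom (add_monoid M) (add_monoid N).
       \<forall>a\<in>carrier A. \<forall>x\<in>carrier M. h (a \<odot>\<^bsub>M\<^esub> x) = a \<odot>\<^bsub>N\<^esub> h x}"

text \<open>
  The data of an augmented complex \<open>\<dots> \<rightarrow> F\<^sub>1 \<rightarrow> F\<^sub>0 \<rightarrow> k\<close>: \<open>F\<^sub>i\<close> is free on \<open>basis i\<close>, the basis element
  \<open>b\<close> of \<open>F\<^sub>i\<close> has internal degree \<open>bdeg i b\<close>, and \<open>bdry i\<close> is the map from \<open>F\<close> at \<open>i + 1\<close> to \<open>F\<close> at \<open>i\<close>.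
  Degrees are natural numbers: \<open>A\<close> and \<open>k\<close> live in degrees \<open>\<ge> 0\<close>, so \<open>k\<close> can be resolved in degrees \<open>\<ge> 0\<close>.
\<close>

record 'a graded_complex =
  basis :: "nat \<Rightarrow> nat set"
  bdeg :: "nat \<Rightarrow> nat \<Rightarrow> nat"
  bdry :: "nat \<Rightarrow> (nat \<Rightarrow> 'a) \<Rightarrow> (nat \<Rightarrow> 'a)"
  aug :: "(nat \<Rightarrow> 'a) \<Rightarrow> 'a set"

abbreviation term_mod :: "('a, 'm) ring_scheme \<Rightarrow> 'a graded_complex \<Rightarrow> nat \<Rightarrow> ('a, nat \<Rightarrow> 'a) module"
  where "term_mod A F i \<equiv> free_module A (basis F i)"

abbreviation term_part ::
  "('a, 'm) ring_scheme \<Rightarrow> (nat \<Rightarrow> 'a set) \<Rightarrow> 'a graded_complex \<Rightarrow> nat \<Rightarrow> nat \<Rightarrow> (nat \<Rightarrow> 'a) set"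
  where "term_part A gr F i j \<equiv> free_part A gr (basis F i) (bdeg F i) j"

definition graded_free_resolution ::
  "('a, 'm) ring_scheme \<Rightarrow> (nat \<Rightarrow> 'a set) \<Rightarrow> 'a graded_complex \<Rightarrow> bool" where
  "graded_free_resolution A gr F \<longleftrightarrow>
     aug F \<in> module_hom A (term_mod A F 0) (resmod A gr) \<and>
     (\<forall>i. bdry F i \<in> module_hom A (term_mod A F (Suc i)) (term_mod A F i)) \<and>
     \<comment> \<open>all maps have degree \<open>0\<close>, with \<open>k\<close> placed in degree \<open>0\<close>\<close>
     (\<forall>j>0. \<forall>x\<in>term_part A gr F 0 j. aug F x = \<zero>\<^bsub>resmod A gr\<^esub>) \<and>
     (\<forall>i j. bdry F i ` term_part A gr F (Suc i) j \<subseteq> term_part A gr F i j) \<and>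
     \<comment> \<open>exactness\<close>
     aug F ` carrier (term_mod A F 0) = carrier (resmod A gr) \<and>
     bdry F 0 ` carrier (term_mod A F 1) = a_kernel (term_mod A F 0) (resmod A gr) (aug F) \<and>
     (\<forall>i. bdry F (Suc i) ` carrier (term_mod A F (Suc (Suc i)))
          = a_kernel (term_mod A F (Suc i)) (term_mod A F i) (bdry F i))"

text \<open>
  The module \<open>k \<otimes> F\<^sub>i\<close>, tensored over \<open>A\<close>, is \<open>F\<^sub>i\<close> modulo the submodule \<open>A\<^sub>+ F\<^sub>i\<close> of vectors with all
  coordinates in \<open>A\<^sub>+\<close>. Hence \<open>Tor\<^sub>i\<^sub>,\<^sub>j(k, k)\<close>, the homology at position \<open>i\<close> and internal degree \<open>j\<close> of
  \<open>k \<otimes> F\<close>, is written below as a quotient of subgroups of the degree-\<open>j\<close> part of \<open>F\<^sub>i\<close>; both the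
  cycles and the boundaries contain the degree-\<open>j\<close> part of \<open>A\<^sub>+ F\<^sub>i\<close>.
\<close>

definition irrel_part :: "('a, 'm) ring_scheme \<Rightarrow> (nat \<Rightarrow> 'a set) \<Rightarrow> nat set \<Rightarrow> (nat \<Rightarrow> 'a) set" where
  "irrel_part A gr B = {x \<in> carrier (free_module A B). \<forall>b. x b \<in> irrel A gr}"

definition tor_cycles ::
  "('a, 'm) ring_scheme \<Rightarrow> (nat \<Rightarrow> 'a set) \<Rightarrow> 'a graded_complex \<Rightarrow> nat \<Rightarrow> nat \<Rightarrow> (nat \<Rightarrow> 'a) set" where
  "tor_cycles A gr F i j =
    {x \<in> term_part A gr F i j.
       case i of 0 \<Rightarrow> True | Suc l \<Rightarrow> bdry F l x \<in> irrel_part A gr (basis F l)}"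

definition tor_boundaries ::
  "('a, 'm) ring_scheme \<Rightarrow> (nat \<Rightarrow> 'a set) \<Rightarrow> 'a graded_complex \<Rightarrow> nat \<Rightarrow> nat \<Rightarrow> (nat \<Rightarrow> 'a) set" where
  "tor_boundaries A gr F i j =
    {bdry F i y \<oplus>\<^bsub>term_mod A F i\<^esub> z | y z.
       y \<in> term_part A gr F (Suc i) j \<and> z \<in> term_part A gr F i j \<inter> irrel_part A gr (basis F i)}"

definition tor ::
  "('a, 'm) ring_scheme \<Rightarrow> (nat \<Rightarrow> 'a set) \<Rightarrow> 'a graded_complex \<Rightarrow> nat \<Rightarrow> nat \<Rightarrow> (nat \<Rightarrow> 'a) set monoid" where
  "tor A gr F i j =
    (add_monoid (term_mod A F i)\<lparr>carrier := tor_cycles A gr F i j\<rparr>) Mod tor_boundaries A gr F i j"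

text \<open>
  Up to isomorphism \<open>tor A gr F i j\<close> does not depend on the graded free resolution \<open>F\<close> of \<open>k\<close>,
  so \<open>Tor\<close> may be computed from any one.
\<close>

definition koszul :: "('a, 'm) ring_scheme \<Rightarrow> (nat \<Rightarrow> 'a set) \<Rightarrow> bool" where
  "koszul A gr \<longleftrightarrow>
     (\<exists>F. graded_free_resolution A gr F \<and> (\<forall>i j. i \<noteq> j \<longrightarrow> trivial_group (tor A gr F i j)))"

section \<open>Projective space and homogeneous coordinate rings\<close>

text \<open>
  Homogeneous coordinates are indexed by a finite type \<open>'n\<close>: the type \<open>('k, 'n) proj_space\<close> is the
  set of \<open>k\<close>-points of projective space of dimension \<open>CARD('n) - 1\<close>.
\<close>

definition proj_rel :: "('n \<Rightarrow> 'k::field) \<Rightarrow> ('n \<Rightarrow> 'k) \<Rightarrow> bool" where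
  "proj_rel u v \<longleftrightarrow> u \<noteq> (\<lambda>_. 0) \<and> v \<noteq> (\<lambda>_. 0) \<and> (\<exists>c. c \<noteq> 0 \<and> v = (\<lambda>i. c * u i))"

lemma part_equivp_proj_rel: "part_equivp (proj_rel :: ('n \<Rightarrow> 'k::field) \<Rightarrow> _)"
proof (rule part_equivpI)
  have "proj_rel (\<lambda>_::'n. 1::'k) (\<lambda>_. 1)"
    unfolding proj_rel_def by (auto simp: fun_eq_iff intro!: exI[of _ 1])
  then show "\<exists>x::'n \<Rightarrow> 'k. proj_rel x x" by blast
  show "symp (proj_rel :: ('n \<Rightarrow> 'k) \<Rightarrow> _)"
  proof (rule sympI)
    fix u v :: "'n \<Rightarrow> 'k" assume "proj_rel u v"
    then obtain c where "u \<noteq> (\<lambda>_. 0)" "v \<noteq> (\<lambda>_. 0)" "c \<noteq> 0" "v = (\<lambda>i. c * u i)"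
      unfolding proj_rel_def by blast
    then show "proj_rel v u"
      unfolding proj_rel_def by (auto intro!: exI[of _ "inverse c"])
  qed
  show "transp (proj_rel :: ('n \<Rightarrow> 'k) \<Rightarrow> _)"
  proof (rule transpI)
    fix u v w :: "'n \<Rightarrow> 'k" assume "proj_rel u v" "proj_rel v w"
    then obtain c d where "u \<noteq> (\<lambda>_. 0)" "w \<noteq> (\<lambda>_. 0)" "c \<noteq> 0" "d \<noteq> 0"
      "v = (\<lambda>i. c * u i)" "w = (\<lambda>i. d * v i)"
      unfolding proj_rel_def by blast
    then show "proj_rel u w"
      unfolding proj_rel_def by (auto intro!: exI[of _ "d * c"])
  qed
qed

quotient_type (overloaded) ('k, 'n) proj_space = "'n \<Rightarrow> 'k::field" / partial: proj_rel
  by (rule part_equivp_proj_rel)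

text \<open>The homogeneous coordinate vectors of the points of \<open>S\<close>.\<close>

definition cone :: "('k::field, 'n) proj_space set \<Rightarrow> ('n \<Rightarrow> 'k) set" where
  "cone S = {v. v \<noteq> (\<lambda>_. 0) \<and> abs_proj_space v \<in> S}"

type_synonym ('k, 'n) mpolynomial = "('n \<Rightarrow>\<^sub>0 nat) \<Rightarrow>\<^sub>0 'k"

definition eval_poly :: "('k::field, 'n::finite) mpolynomial \<Rightarrow> ('n \<Rightarrow> 'k) \<Rightarrow> 'k" where
  "eval_poly f v =
    (\<Sum>t\<in>Poly_Mapping.keys f.
       Poly_Mapping.lookup f t * (\<Prod>i\<in>UNIV. v i ^ Poly_Mapping.lookup t i))"

text \<open>Homogeneous polynomials of degree \<open>d\<close>, including \<open>0\<close>.\<close>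

definition forms :: "nat \<Rightarrow> ('k::field, 'n::finite) mpolynomial set" where
  "forms d = {f. \<forall>t\<in>Poly_Mapping.keys f. (\<Sum>i\<in>UNIV. Poly_Mapping.lookup t i) = d}"

abbreviation poly_ring :: "('k::field, 'n::finite) mpolynomial ring" where
  "poly_ring \<equiv> ring_of_type_algebra"

text \<open>
  Every polynomial vanishes on the empty set, which would give the zero ring; the convention that the
  coordinate ring of the empty set is \<open>k\<close> amounts to taking the irrelevant ideal instead.
\<close>

definition vanishing_ideal ::
  "('k::field, 'n::finite) proj_space set \<Rightarrow> ('k, 'n) mpolynomial set" where
  "vanishing_ideal S =
    (if S = {} then irrel poly_ring forms
     else Idl\<^bsub>poly_ring\<^esub> {f. (\<exists>d. f \<in> forms d) \<and> (\<forall>v\<in>cone S. eval_poly f v = 0)})"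

definition coord_ring ::
  "('k::field, 'n::finite) proj_space set \<Rightarrow> ('k, 'n) mpolynomial set ring" where
  "coord_ring S = poly_ring Quot vanishing_ideal S"

definition coord_grading ::
  "('k::field, 'n::finite) proj_space set \<Rightarrow> nat \<Rightarrow> ('k, 'n) mpolynomial set set" where
  "coord_grading S d = (\<lambda>f. vanishing_ideal S +>\<^bsub>poly_ring\<^esub> f) ` forms d"

definition koszul_set :: "('k::field, 'n::finite) proj_space set \<Rightarrow> bool" where
  "koszul_set S \<longleftrightarrow> koszul (coord_ring S) (coord_grading S)"

text \<open>
  The fibre of \<open>\<O>(d)\<close> at a point is the line of functions \<open>\<phi>\<close> on its coordinate vectors with
  \<open>\<phi> (c v) = c\<^sup>d \<phi> v\<close>. For finite \<open>S\<close>, a section of \<open>\<O>(d)\<close> on \<open>S\<close> is one element of the fibre at each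
  point of \<open>S\<close>. Global sections of \<open>\<O>(d)\<close> on projective space are \<open>forms d\<close>.
\<close>

definition twist_sections ::
  "nat \<Rightarrow> ('k::field, 'n) proj_space set \<Rightarrow> (('n \<Rightarrow> 'k) \<Rightarrow> 'k) set" where
  "twist_sections d S =
    {\<phi> \<in> extensional (cone S). \<forall>v\<in>cone S. \<forall>c. c \<noteq> 0 \<longrightarrow> \<phi> (\<lambda>i. c * v i) = c ^ d * \<phi> v}"

definition evaluation_map ::
  "('k::field, 'n::finite) proj_space set \<Rightarrow> ('k, 'n) mpolynomial \<Rightarrow> ('n \<Rightarrow> 'k) \<Rightarrow> 'k" where
  "evaluation_map S f = restrict (eval_poly f) (cone S)"

definition independent_conditions_on_quadrics ::
  "('k::field, 'n::finite) proj_space set \<Rightarrow> bool" where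
  "independent_conditions_on_quadrics S \<longleftrightarrow> evaluation_map S ` forms 2 = twist_sections 2 S"

end

theory Submission
  imports Defs "HOL-Library.Function_Algebras"
begin

text \<open>
  It suffices to remove a single point \<open>p\<close> from \<open>S = T \<union> {p}\<close>. Let \<open>R\<close> be the polynomial ring, and let
  \<open>A = R/I\<close> and \<open>R/I'\<close> be the coordinate rings of \<open>S\<close> and of \<open>T\<close>. Let \<open>h\<close> be a form of least positive
  degree \<open>d\<close> that vanishes on \<open>T\<close> but not at \<open>p\<close>. Independent conditions on quadrics provide a quadric of
  this kind, so \<open>d \<le> 2\<close>. A form in \<open>I'\<close> either vanishes at \<open>p\<close>, or has degree at least \<open>d\<close> and agrees
  on \<open>S\<close> with a multiple of \<open>h\<close>; and \<open>h f\<close> vanishes on \<open>S\<close> exactly when \<open>f\<close> lies in the ideal \<open>P\<close> of forms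
  vanishing at \<open>p\<close>. Hence \<open>I' = I + h R\<close>, and \<open>I'/I\<close> is a copy of the point module \<open>R/P\<close>, shifted by \<open>d\<close>.

  The rest bounds degrees in \<open>Tor\<close> over the Koszul algebra \<open>A\<close>, where \<open>Tor\<^sub>i(M)\<close> stands for
  \<open>Tor\<^sub>i(M, k)\<close> and \<open>Tor\<^sub>i(k)\<close> lives in degree \<open>i\<close>.

  \<^item> If \<open>l\<close> is a linear form with \<open>l(p) \<noteq> 0\<close>, then multiplication by \<open>l\<close> is injective on \<open>R/P\<close> with cokernel \<open>k\<close>.
    It is zero on \<open>Tor\<close>, because \<open>l\<close> kills \<open>k\<close>. So the long exact sequence makes the part of \<open>Tor\<^sub>i(R/P)\<close> of degree
    \<open>j\<close> a quotient of the part of \<open>Tor\<close> of \<open>k\<close> in homological degree \<open>i + 1\<close> and internal degree \<open>j + 1\<close>,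
    which is zero for \<open>j > i\<close> (\<open>tor_zero_point_module\<close>).
  \<^item> From \<open>0 \<rightarrow> I'/I \<rightarrow> A \<rightarrow> R/I' \<rightarrow> 0\<close> and \<open>d \<le> 2\<close>, the degree \<open>j\<close> part of \<open>Tor\<^sub>i(R/I')\<close> is zero for \<open>j > i + 1\<close>
    (\<open>tor_zero_quotient_by_form\<close>).
  \<^item> Now resolve \<open>k\<close> minimally over \<open>R/I'\<close>, and let \<open>K\<^sub>i\<close> be the \<open>i\<close>-th syzygy module. By induction on \<open>i\<close>, the part
    of \<open>Tor\<^sub>q(K\<^sub>i)\<close> of degree \<open>j\<close> is zero for \<open>j > q + i\<close>: if \<open>K\<^sub>i\<close> is generated in degree \<open>i\<close>, then the next
    syzygy module is the kernel of a map onto \<open>K\<^sub>i\<close> from a free module with generators of degree \<open>i\<close>, and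
    the two bounds combine in the long exact sequence. For \<open>q = 0\<close> the claim says that \<open>K\<^sub>i\<close> is generated in
    degrees at most \<open>i\<close>; minimality excludes lower degrees. So the resolution is linear
    (\<open>syzygy_step\<close>, \<open>linear_resolution_exists\<close>), which is the Koszul property.

  In the formalization no quotient is formed in these arguments. An \<open>A\<close>-module is a subquotient \<open>U/V\<close> of a
  module over the type \<open>R\<close>, the given resolution of \<open>k\<close> over \<open>A\<close> becomes a family of matrices over \<open>R\<close> that is a
  complex modulo \<open>I\<close>, and \<open>Tor\<close> enters through the statement that a graded piece of it is zero. The theorems
  \<open>koszul_imp_residue_resolution\<close> and \<open>linear_resolution_imp_koszul\<close> translate between such matrices
  and resolutions over the quotient ring.
\<close>

section \<open>Graded groups and matrices acting on vectors\<close>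

text \<open>
  A graded group is the family of its homogeneous pieces, all inside one ambient group, because
  the homological arguments work one degree at a time.
\<close>

definition graded_group :: "(nat \<Rightarrow> 'm::ab_group_add set) \<Rightarrow> bool" where
  "graded_group U \<longleftrightarrow> (\<forall>j. 0 \<in> U j \<and> (\<forall>x\<in>U j. \<forall>y\<in>U j. x - y \<in> U j))"

lemma graded_group_0: "graded_group U \<Longrightarrow> 0 \<in> U j"
  and graded_group_diff: "graded_group U \<Longrightarrow> x \<in> U j \<Longrightarrow> y \<in> U j \<Longrightarrow> x - y \<in> U j"
  by (auto simp: graded_group_def)

lemma graded_group_minus: "graded_group U \<Longrightarrow> x \<in> U j \<Longrightarrow> - x \<in> U j"
  using graded_group_diff[of U 0 j x] graded_group_0[of U j] by simp

lemma graded_group_add: "graded_group U \<Longrightarrow> x \<in> U j \<Longrightarrow> y \<in> U j \<Longrightarrow> x + y \<in> U j"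
  using graded_group_diff[of U x j "- y"] graded_group_minus[of U y j] by simp

lemma graded_group_sum: "graded_group U \<Longrightarrow> (\<And>b. b \<in> N \<Longrightarrow> f b \<in> U j) \<Longrightarrow> sum f N \<in> U j"
  by (induction N rule: infinite_finite_induct) (auto simp: graded_group_0 graded_group_add)

text \<open>
  The graded group \<open>U\<close> with degrees raised by \<open>c\<close>, usually written \<open>U(-c)\<close>.
\<close>

definition shift :: "nat \<Rightarrow> (nat \<Rightarrow> 'm::ab_group_add set) \<Rightarrow> nat \<Rightarrow> 'm set" where
  "shift c U j = (if c \<le> j then U (j - c) else {0})"

lemma graded_group_shift: "graded_group U \<Longrightarrow> graded_group (shift c U)"
  by (auto simp: graded_group_def shift_def)

lemma shift_mono: "(\<And>q. U q \<subseteq> W q) \<Longrightarrow> shift c U j \<subseteq> shift c W j"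
  by (auto simp: shift_def)

lemma shift_0 [simp]: "shift 0 U = U"
  by (auto simp: shift_def fun_eq_iff)

text \<open>
  The direct sum of the groups \<open>U(-e b)\<close> over \<open>b \<in> B\<close>. With \<open>U\<close> the ring itself this is the graded free module
  with a generator of degree \<open>e b\<close> for each \<open>b\<close>; in general it is that free module tensored with \<open>U\<close>.
\<close>

definition dsum :: "nat set \<Rightarrow> (nat \<Rightarrow> nat) \<Rightarrow> (nat \<Rightarrow> 'm::ab_group_add set) \<Rightarrow> nat \<Rightarrow> (nat \<Rightarrow> 'm) set" where
  "dsum B e U j = {x. finite {b. x b \<noteq> 0} \<and> (\<forall>b. b \<notin> B \<longrightarrow> x b = 0) \<and> (\<forall>b\<in>B. x b \<in> shift (e b) U j)}"

lemma dsumD: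
  assumes "x \<in> dsum B e U j"
  shows dsum_finite: "finite {b. x b \<noteq> 0}"
    and dsum_zero: "b \<notin> B \<Longrightarrow> x b = 0"
    and dsum_in: "b \<in> B \<Longrightarrow> x b \<in> shift (e b) U j"
  using assms by (auto simp: dsum_def)

lemma dsum_in': "x \<in> dsum B e U j \<Longrightarrow> x b \<noteq> 0 \<Longrightarrow> b \<in> B \<and> e b \<le> j \<and> x b \<in> U (j - e b)"
  by (auto simp: dsum_def shift_def split: if_splits)

lemma graded_group_dsum:
  assumes "graded_group U" shows "graded_group (dsum B e U)"
  unfolding graded_group_def
proof (intro allI conjI ballI)
  fix j
  have sh: "graded_group (shift c U)" for c
    using assms by (rule graded_group_shift)
  show "0 \<in> dsum B e U j"
    using sh by (auto simp: dsum_def graded_group_0)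
  fix x y assume x: "x \<in> dsum B e U j" and y: "y \<in> dsum B e U j"
  have "{b. (x - y) b \<noteq> 0} \<subseteq> {b. x b \<noteq> 0} \<union> {b. y b \<noteq> 0}" by auto
  then have "finite {b. (x - y) b \<noteq> 0}"
    using dsum_finite[OF x] dsum_finite[OF y] finite_subset by blast
  then show "x - y \<in> dsum B e U j"
    using x y by (auto simp: dsum_def intro!: graded_group_diff[OF sh])
qed

lemma dsum_mono: "(\<And>q. U q \<subseteq> W q) \<Longrightarrow> dsum B e U j \<subseteq> dsum B e W j"
  using shift_mono[of U W] unfolding dsum_def by blast

lemma dsum_shift: "dsum B e (shift c U) (j + c) = dsum B e U j"
proof -
  have "shift (e b) (shift c U) (j + c) = shift (e b) U j" for b
    by (auto simp: shift_def)
  then show ?thesis by (simp add: dsum_def)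
qed

lemma dsum_map:
  assumes x: "x \<in> dsum B e U j" and f0: "f 0 = 0" and f: "\<And>q u. u \<in> U q \<Longrightarrow> f u \<in> W (q + d)"
    and W: "graded_group W"
  shows "(\<lambda>b. f (x b)) \<in> dsum B e W (j + d)"
proof -
  have "finite {b. f (x b) \<noteq> 0}" by (rule finite_subset[OF _ dsum_finite[OF x]]) (use f0 in auto)
  moreover have "f (x b) \<in> shift (e b) W (j + d)" if "b \<in> B" for b
  proof (cases "x b = 0")
    case True
    then show ?thesis using f0 graded_group_0[OF graded_group_shift[OF W]] by simp
  next
    case False
    then show ?thesis using dsum_in'[OF x False] f[of "x b" "j - e b"] by (simp add: shift_def)
  qed
  ultimately show ?thesis using dsum_zero[OF x] f0 by (auto simp: dsum_def)
qed

lemma dsum_pull: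
  assumes x: "x \<in> dsum B e U j" and fx: "(\<lambda>b. f (x b)) \<in> dsum B e W (j + d)"
    and f: "\<And>q u. u \<in> U q \<Longrightarrow> f u \<in> W (q + d) \<Longrightarrow> u \<in> V q" and V: "graded_group V"
  shows "x \<in> dsum B e V j"
proof -
  have "x b \<in> shift (e b) V j" if "b \<in> B" for b
  proof (cases "x b = 0")
    case True
    then show ?thesis using graded_group_0[OF graded_group_shift[OF V]] by simp
  next
    case False
    then show ?thesis
      using dsum_in'[OF x False] dsum_in[OF fx that] f[of "x b" "j - e b"] by (simp add: shift_def)
  qed
  then show ?thesis using x by (auto simp: dsum_def)
qed

text \<open>
  A decomposition that is possible for each homogeneous element is possible coordinatewise. Zero
  coordinates are lifted to zero, which keeps the support finite.
\<close>

lemma dsum_lift: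
  assumes x: "x \<in> dsum B e W j"
    and lift: "\<And>q w. w \<in> W q \<Longrightarrow> \<exists>u\<in>U q. w - f u \<in> V q"
    and "f 0 = 0" "graded_group V" "graded_group U"
  obtains y where "y \<in> dsum B e U j" "x - (\<lambda>b. f (y b)) \<in> dsum B e V j"
proof -
  have "\<exists>u. (x b = 0 \<longrightarrow> u = 0) \<and> (x b \<noteq> 0 \<longrightarrow> u \<in> U (j - e b) \<and> x b - f u \<in> V (j - e b))" for b
    using lift[of "x b" "j - e b"] dsum_in'[OF x, of b] by (cases "x b = 0") auto
  then obtain y where y: "\<And>b. x b = 0 \<Longrightarrow> y b = 0"
    "\<And>b. x b \<noteq> 0 \<Longrightarrow> y b \<in> U (j - e b) \<and> x b - f (y b) \<in> V (j - e b)"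
    by metis
  have f1: "finite {b. y b \<noteq> 0}"
    by (rule finite_subset[OF _ dsum_finite[OF x]]) (use y in auto)
  have f2: "finite {b. (x - (\<lambda>b. f (y b))) b \<noteq> 0}"
    by (rule finite_subset[OF _ dsum_finite[OF x]]) (use y \<open>f 0 = 0\<close> in auto)
  have "y b \<in> shift (e b) U j" "(x - (\<lambda>b. f (y b))) b \<in> shift (e b) V j" for b
    using y(1)[of b] y(2)[of b] dsum_in'[OF x, of b] assms(3)
      graded_group_0[OF graded_group_shift[OF assms(4)]] graded_group_0[OF graded_group_shift[OF assms(5)]]
    by (cases "x b = 0"; force simp: shift_def)+
  then show ?thesis
    using that[of y] f1 f2 y(1) dsum_zero[OF x] \<open>f 0 = 0\<close> unfolding dsum_def by simp
qed

text \<open>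
  The combination of the rows \<open>N b\<close> with coefficients \<open>x b\<close>. This is the map of free modules with matrix \<open>N\<close>,
  tensored with the module to which the entries of \<open>x\<close> belong; \<open>s\<close> is the action of scalars on that module.
\<close>

definition lincomb :: "('r \<Rightarrow> 'm \<Rightarrow> 'm) \<Rightarrow> (nat \<Rightarrow> nat \<Rightarrow> 'r) \<Rightarrow> (nat \<Rightarrow> 'm::ab_group_add) \<Rightarrow> nat \<Rightarrow> 'm" where
  "lincomb s N x c = (\<Sum>b | x b \<noteq> 0. s (N b c) (x b))"

lemma module_mult: "Modules.module ((*) :: 'r::comm_ring_1 \<Rightarrow> 'r \<Rightarrow> 'r)"
  by unfold_locales (auto simp: algebra_simps)

lemma module_vec: "Modules.module (\<lambda>(a::'r::comm_ring_1) (x::nat \<Rightarrow> 'r) i. a * x i)"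
  by unfold_locales (auto simp: algebra_simps fun_eq_iff)

context
  fixes s :: "'r::comm_ring_1 \<Rightarrow> 'm::ab_group_add \<Rightarrow> 'm"
  assumes s: "Modules.module s"
begin

interpretation s: Modules.module s by (rule s)

lemma lincomb_superset: "finite K \<Longrightarrow> {b. x b \<noteq> 0} \<subseteq> K \<Longrightarrow> lincomb s N x c = (\<Sum>b\<in>K. s (N b c) (x b))"
  unfolding lincomb_def by (rule sum.mono_neutral_left) auto

lemma lincomb_0 [simp]: "lincomb s N 0 = 0" "lincomb s N (\<lambda>_. 0) = 0"
  by (auto simp: lincomb_def fun_eq_iff)

lemma lincomb_diff:
  assumes "finite {b. x b \<noteq> 0}" "finite {b. y b \<noteq> 0}"
  shows "lincomb s N (x - y) = lincomb s N x - lincomb s N y"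
proof
  fix c
  let ?K = "{b. x b \<noteq> 0} \<union> {b. y b \<noteq> 0}"
  have fin: "finite ?K" using assms by simp
  have "lincomb s N (x - y) c = (\<Sum>b\<in>?K. s (N b c) (x b - y b))"
    by (subst lincomb_superset[of ?K]) (use fin in auto)
  also have "\<dots> = lincomb s N x c - lincomb s N y c"
    by (subst (1 2) lincomb_superset[of ?K])
      (use fin in \<open>auto simp: sum_subtractf s.scale_right_diff_distrib\<close>)
  finally show "lincomb s N (x - y) c = (lincomb s N x - lincomb s N y) c" by simp
qed

lemma lincomb_add:
  assumes "finite {b. x b \<noteq> 0}" "finite {b. y b \<noteq> 0}"
  shows "lincomb s N (x + y) = lincomb s N x + lincomb s N y"
proof -
  have "finite {b. (x + y) b \<noteq> 0}"
    by (rule finite_subset[of _ "{b. x b \<noteq> 0} \<union> {b. y b \<noteq> 0}"]) (use assms in auto)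
  from lincomb_diff[OF this assms(2), of N] show ?thesis by (metis add_diff_cancel_right' diff_add_cancel)
qed

lemma lincomb_diff_rows: "lincomb s (\<lambda>b. M b - N b) x = lincomb s M x - lincomb s N x"
  by (auto simp: lincomb_def fun_eq_iff s.scale_left_diff_distrib sum_subtractf)

lemma lincomb_unit_rows:
  assumes "finite {b. x b \<noteq> 0}"
  shows "lincomb s (\<lambda>b c. if c = b then l else 0) x = (\<lambda>c. s l (x c))"
proof
  fix c
  have "lincomb s (\<lambda>b c. if c = b then l else 0) x c = (\<Sum>b\<in>insert c {b. x b \<noteq> 0}. if c = b then s l (x b) else 0)"
    by (subst lincomb_superset[of "insert c {b. x b \<noteq> 0}"])
      (use assms in \<open>auto simp: if_distrib[of "\<lambda>r. s r _"] cong: if_cong simp del: sum.insert intro!: sum.cong\<close>)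
  then show "lincomb s (\<lambda>b c. if c = b then l else 0) x c = s l (x c)"
    using assms by simp
qed

lemma lincomb_scale:
  assumes fin: "finite {b. x b \<noteq> 0}"
  shows "lincomb s N (\<lambda>b. s a (x b)) = (\<lambda>c. s a (lincomb s N x c))"
proof
  fix c
  have "lincomb s N (\<lambda>b. s a (x b)) c = (\<Sum>b | x b \<noteq> 0. s (N b c) (s a (x b)))"
    by (rule lincomb_superset) (use fin in auto)
  also have "\<dots> = (\<Sum>b | x b \<noteq> 0. s a (s (N b c) (x b)))"
    by (rule sum.cong) (auto simp: mult.commute)
  also have "\<dots> = s a (lincomb s N x c)" by (simp add: lincomb_def s.scale_sum_right)
  finally show "lincomb s N (\<lambda>b. s a (x b)) c = s a (lincomb s N x c)" .
qed

lemma lincomb_scale_ring: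
  assumes fin: "finite {b. y b \<noteq> 0}"
  shows "lincomb s N (\<lambda>b. s (y b) u) = (\<lambda>c. s (lincomb (*) N y c) u)"
proof
  fix c
  have "lincomb s N (\<lambda>b. s (y b) u) c = (\<Sum>b | y b \<noteq> 0. s (N b c) (s (y b) u))"
    by (rule lincomb_superset) (use fin in auto)
  also have "\<dots> = s (lincomb (*) N y c) u" by (simp add: lincomb_def s.scale_sum_left)
  finally show "lincomb s N (\<lambda>b. s (y b) u) c = s (lincomb (*) N y c) u" .
qed

text \<open>
  Composition of maps is multiplication of matrices: the rows of the product are the images of the rows of \<open>M\<close>.
\<close>

lemma lincomb_lincomb:
  assumes fin: "finite {b. x b \<noteq> 0}" and rows: "\<And>b. x b \<noteq> 0 \<Longrightarrow> finite {c. M b c \<noteq> 0}"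
  shows "lincomb s N (lincomb s M x) = lincomb s (\<lambda>b. lincomb (*) N (M b)) x"
proof
  fix c
  let ?X = "{b. x b \<noteq> 0}"
  let ?K = "\<Union>b\<in>?X. {c. M b c \<noteq> 0}"
  have K: "finite ?K" using assms by blast
  have sub: "{a. lincomb s M x a \<noteq> 0} \<subseteq> ?K"
  proof
    fix a assume "a \<in> {a. lincomb s M x a \<noteq> 0}"
    then have "lincomb s M x a \<noteq> 0" by simp
    then obtain b where "x b \<noteq> 0" "s (M b a) (x b) \<noteq> 0"
      unfolding lincomb_def by (auto elim: sum.not_neutral_contains_not_neutral)
    then show "a \<in> ?K" by auto
  qed
  have "lincomb s N (lincomb s M x) c = (\<Sum>a\<in>?K. s (N a c) (lincomb s M x a))"
    by (rule lincomb_superset[OF K sub])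
  also have "\<dots> = (\<Sum>a\<in>?K. \<Sum>b\<in>?X. s (N a c * M b a) (x b))"
    by (simp add: lincomb_def s.scale_sum_right)
  also have "\<dots> = (\<Sum>b\<in>?X. \<Sum>a\<in>?K. s (N a c * M b a) (x b))"
    by (rule sum.swap)
  also have "\<dots> = (\<Sum>b\<in>?X. s (lincomb (*) N (M b) c) (x b))"
  proof (rule sum.cong[OF refl])
    fix b assume b: "b \<in> ?X"
    have "lincomb (*) N (M b) c = (\<Sum>a | M b a \<noteq> 0. N a c * M b a)" by (simp add: lincomb_def)
    also have "\<dots> = (\<Sum>a\<in>?K. N a c * M b a)"
      by (rule sum.mono_neutral_left) (use K b in auto)
    finally show "(\<Sum>a\<in>?K. s (N a c * M b a) (x b)) = s (lincomb (*) N (M b) c) (x b)"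
      by (simp add: s.scale_sum_left)
  qed
  finally show "lincomb s N (lincomb s M x) c = lincomb s (\<lambda>b. lincomb (*) N (M b)) x c"
    by (simp add: lincomb_def)
qed

text \<open>
  The degrees of matrix entries are kept in a family \<open>H\<close> so that the lemma applies both to arbitrary forms
  and to matrices with entries in an ideal, whose action lands in a smaller module.
\<close>

lemma lincomb_dsum:
  assumes W: "graded_group W"
    and mult: "\<And>p q a u. a \<in> H p \<Longrightarrow> u \<in> U q \<Longrightarrow> s a u \<in> W (p + q)"
    and x: "x \<in> dsum B e U j"
    and rows: "\<And>b. b \<in> B \<Longrightarrow> N b \<in> dsum B' e' H (e b + t)"
  shows "lincomb s N x \<in> dsum B' e' W (j + t)"
proof -
  let ?H = "{b. x b \<noteq> 0}"
  have zero: "lincomb s N x c = 0" if "\<And>b. x b \<noteq> 0 \<Longrightarrow> N b c = 0" for c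
    unfolding lincomb_def using that by (auto intro!: sum.neutral)
  have "{c. lincomb s N x c \<noteq> 0} \<subseteq> (\<Union>b\<in>?H. {c. N b c \<noteq> 0})"
    using zero by blast
  moreover have "finite (\<Union>b\<in>?H. {c. N b c \<noteq> 0})"
    using dsum_finite[OF x] dsum_finite[OF rows] dsum_in'[OF x] by blast
  ultimately have fin: "finite {c. lincomb s N x c \<noteq> 0}" using finite_subset by blast
  have out: "lincomb s N x c = 0" if "c \<notin> B'" for c
    by (rule zero) (use that dsum_zero[OF rows] dsum_in'[OF x] in blast)
  have "lincomb s N x c \<in> shift (e' c) W (j + t)" if "c \<in> B'" for c
    unfolding lincomb_def
  proof (rule graded_group_sum[OF graded_group_shift[OF W]])
    fix b assume "b \<in> ?H"
    then have b: "b \<in> B" "e b \<le> j" "x b \<in> U (j - e b)" using dsum_in'[OF x, of b] by auto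
    show "s (N b c) (x b) \<in> shift (e' c) W (j + t)"
    proof (cases "N b c = 0")
      case True
      then show ?thesis using graded_group_0[OF graded_group_shift[OF W]] by simp
    next
      case False
      from dsum_in'[OF rows[OF b(1)] False] have n: "e' c \<le> e b + t" "N b c \<in> H (e b + t - e' c)" by auto
      have "s (N b c) (x b) \<in> W ((e b + t - e' c) + (j - e b))" using mult[OF n(2) b(3)] .
      moreover have "(e b + t - e' c) + (j - e b) = j + t - e' c" "e' c \<le> j + t" using n b by auto
      ultimately show ?thesis by (simp add: shift_def)
    qed
  qed
  then show ?thesis using fin out by (auto simp: dsum_def)
qed

end

lemma lincomb_commute:
  assumes f: "Modules.additive f" and lin: "\<And>a u. f (s a u) = s' a (f u)"
    and s': "Modules.module s'" and fin: "finite {b. x b \<noteq> 0}"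
  shows "lincomb s' N (\<lambda>b. f (x b)) = (\<lambda>c. f (lincomb s N x c))"
proof
  fix c
  have f0: "f 0 = 0" by (rule additive.zero[OF f])
  have "lincomb s' N (\<lambda>b. f (x b)) c = (\<Sum>b | x b \<noteq> 0. s' (N b c) (f (x b)))"
    by (rule lincomb_superset[OF s']) (use fin f0 in auto)
  also have "\<dots> = f (lincomb s N x c)"
    by (simp add: lincomb_def additive.sum[OF f] lin)
  finally show "lincomb s' N (\<lambda>b. f (x b)) c = f (lincomb s N x c)" .
qed

section \<open>Vanishing of graded pieces of Tor\<close>

lemma graded_group_cancel: "graded_group U \<Longrightarrow> x \<in> U j \<Longrightarrow> x - y \<in> U j \<Longrightarrow> y \<in> U j"
  using graded_group_diff[of U x j "x - y"] by simp

locale graded_ring =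
  fixes G :: "nat \<Rightarrow> 'r::comm_ring_1 set"
  assumes graded_group_G: "graded_group G"
    and one_in_G: "1 \<in> G 0"
    and mult_in_G: "a \<in> G i \<Longrightarrow> b \<in> G j \<Longrightarrow> a * b \<in> G (i + j)"
begin

definition gmodule :: "('r \<Rightarrow> 'm::ab_group_add \<Rightarrow> 'm) \<Rightarrow> (nat \<Rightarrow> 'm set) \<Rightarrow> bool" where
  "gmodule s U \<longleftrightarrow> Modules.module s \<and> graded_group U \<and> (\<forall>p q. \<forall>a\<in>G p. \<forall>u\<in>U q. s a u \<in> U (p + q))"

text \<open>
  The homogeneous pieces of the irrelevant ideal.
\<close>

definition irr :: "nat \<Rightarrow> 'r set" where
  "irr j = (if j = 0 then {0} else G j)"

lemma gmoduleD:
  assumes "gmodule s U"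
  shows gmodule_module: "Modules.module s" and gmodule_group: "graded_group U"
    and gmodule_mult: "a \<in> G p \<Longrightarrow> u \<in> U q \<Longrightarrow> s a u \<in> U (p + q)"
  using assms by (auto simp: gmodule_def)

lemma gmodule_G: "gmodule (*) G"
  by (simp add: gmodule_def module_mult graded_group_G mult_in_G)

lemma graded_group_irr: "graded_group irr"
  using graded_group_G by (auto simp: graded_group_def irr_def)

lemma irr_sub: "irr j \<subseteq> G j"
  using graded_group_0[OF graded_group_G] by (auto simp: irr_def)

lemma gmodule_irr: "gmodule (*) irr"
  unfolding gmodule_def
  by (auto simp: module_mult graded_group_irr irr_def mult_in_G graded_group_0[OF graded_group_G])

lemma dsum_scale:
  assumes U: "gmodule s U" and a: "a \<in> G p" and x: "x \<in> dsum B e U j"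
  shows "(\<lambda>b. s a (x b)) \<in> dsum B e U (p + j)"
proof -
  interpret s: Modules.module s using U by (rule gmodule_module)
  have "(\<lambda>b. s a (x b)) \<in> dsum B e U (j + p)"
    by (rule dsum_map[OF x]) (use gmodule_mult[OF U a] gmodule_group[OF U] in \<open>auto simp: add.commute\<close>)
  then show ?thesis by (simp add: add.commute)
qed

lemma gmodule_dsum:
  assumes "gmodule (*) U" shows "gmodule (\<lambda>a x i. a * x i) (dsum B e U)"
  unfolding gmodule_def using module_vec graded_group_dsum[OF gmodule_group[OF assms]] dsum_scale[OF assms] by auto

end

text \<open>
  A graded free resolution of \<open>k\<close> over \<open>G/I\<close>, lifted to \<open>G\<close>: the basis of the \<open>i\<close>-th free module is \<open>B i\<close> with degrees
  \<open>e i\<close>, the differential into it has the matrix \<open>D i\<close>, and \<open>\<alpha>\<close> lists the values of the augmentation on \<open>B 0\<close>.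
  Being a complex and exactness hold modulo \<open>I\<close>. Bases may be infinite, which is why vectors
  are required to have finite support.
\<close>

locale residue_resolution = graded_ring G for G :: "nat \<Rightarrow> 'r::comm_ring_1 set" +
  fixes I :: "nat \<Rightarrow> 'r set" and B :: "nat \<Rightarrow> nat set" and e :: "nat \<Rightarrow> nat \<Rightarrow> nat"
    and D :: "nat \<Rightarrow> nat \<Rightarrow> nat \<Rightarrow> 'r" and \<alpha> :: "nat \<Rightarrow> 'r"
  assumes I: "gmodule (*) I" and I_sub: "I j \<subseteq> G j"
    and D: "b \<in> B (Suc i) \<Longrightarrow> D i b \<in> dsum (B i) (e i) G (e (Suc i) b)"
    and DD: "b \<in> B (Suc (Suc i)) \<Longrightarrow>
      lincomb (*) (D i) (D (Suc i) b) \<in> dsum (B i) (e i) I (e (Suc (Suc i)) b)"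
    and exact_0: "0 < j \<Longrightarrow> x \<in> dsum (B 0) (e 0) G j \<Longrightarrow>
      \<exists>y\<in>dsum (B 1) (e 1) G j. x - lincomb (*) (D 0) y \<in> dsum (B 0) (e 0) I j"
    and exact_Suc: "x \<in> dsum (B (Suc i)) (e (Suc i)) G j \<Longrightarrow>
      lincomb (*) (D i) x \<in> dsum (B i) (e i) I j \<Longrightarrow>
      \<exists>y\<in>dsum (B (Suc (Suc i))) (e (Suc (Suc i))) G j.
        x - lincomb (*) (D (Suc i)) y \<in> dsum (B (Suc i)) (e (Suc i)) I j"
    and aug_in: "b \<in> B 0 \<Longrightarrow> \<alpha> b \<in> G 0" and aug_deg: "b \<in> B 0 \<Longrightarrow> e 0 b \<noteq> 0 \<Longrightarrow> \<alpha> b = 0"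
    and aug_D: "b \<in> B 1 \<Longrightarrow> lincomb (*) (\<lambda>c _. \<alpha> c) (D 0 b) 0 \<in> irr (e 1 b)"
    and aug_onto: "\<exists>u\<in>dsum (B 0) (e 0) G 0. lincomb (*) (\<lambda>c _. \<alpha> c) u 0 = 1"
begin

abbreviation "tens i U j \<equiv> dsum (B i) (e i) U j"

definition cycle :: "('r \<Rightarrow> 'm::ab_group_add \<Rightarrow> 'm) \<Rightarrow> (nat \<Rightarrow> 'm set) \<Rightarrow> nat \<Rightarrow> nat \<Rightarrow> (nat \<Rightarrow> 'm) \<Rightarrow> bool" where
  "cycle s V i j x \<longleftrightarrow> (\<forall>l. i = Suc l \<longrightarrow> lincomb s (D l) x \<in> tens l V j)"

text \<open>
  \<open>Tor\<^sub>i(U/V, k)\<close> is zero in degree \<open>j\<close>. The homology is that of the resolution tensored with \<open>U/V\<close>, whose elements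
  are represented by vectors over \<open>U\<close> up to vectors over \<open>V\<close>. For \<open>i = 0\<close> every element is a cycle.
\<close>

definition tor_zero :: "('r \<Rightarrow> 'm::ab_group_add \<Rightarrow> 'm) \<Rightarrow> (nat \<Rightarrow> 'm set) \<Rightarrow> (nat \<Rightarrow> 'm set) \<Rightarrow> nat \<Rightarrow> nat \<Rightarrow> bool" where
  "tor_zero s U V i j \<longleftrightarrow> (\<forall>x\<in>tens i U j. cycle s V i j x \<longrightarrow> (\<exists>y\<in>tens (Suc i) U j. x - lincomb s (D i) y \<in> tens i V j))"

lemma tor_zeroE:
  assumes "tor_zero s U V i j" "x \<in> tens i U j" "cycle s V i j x"
  obtains y where "y \<in> tens (Suc i) U j" "x - lincomb s (D i) y \<in> tens i V j"
  using assms by (auto simp: tor_zero_def)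

text \<open>
  \<open>U/V\<close> is a graded module over \<open>G/I\<close>: it is a module over \<open>G\<close> that is killed by \<open>I\<close>.
\<close>

definition subquot :: "('r \<Rightarrow> 'm::ab_group_add \<Rightarrow> 'm) \<Rightarrow> (nat \<Rightarrow> 'm set) \<Rightarrow> (nat \<Rightarrow> 'm set) \<Rightarrow> bool" where
  "subquot s U V \<longleftrightarrow> gmodule s U \<and> gmodule s V \<and> (\<forall>j. V j \<subseteq> U j) \<and> (\<forall>p q. \<forall>a\<in>I p. \<forall>u\<in>U q. s a u \<in> V (p + q))"

lemma subquotD:
  assumes "subquot s U V"
  shows "Modules.module s" "gmodule s U" "gmodule s V" "V j \<subseteq> U j" "a \<in> I p \<Longrightarrow> u \<in> U q \<Longrightarrow> s a u \<in> V (p + q)"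
  using assms by (auto simp: subquot_def gmodule_module)

lemma d_in:
  assumes "gmodule s U" "x \<in> tens (Suc i) U j" shows "lincomb s (D i) x \<in> tens i U j"
proof -
  have "lincomb s (D i) x \<in> tens i U (j + 0)"
    by (rule lincomb_dsum[where H = G, OF gmodule_module[OF assms(1)] gmodule_group[OF assms(1)] _ assms(2)])
      (use gmodule_mult[OF assms(1)] D in auto)
  then show ?thesis by simp
qed

lemma d_diff: "Modules.module s \<Longrightarrow> x \<in> tens i U j \<Longrightarrow> y \<in> tens i U' j' \<Longrightarrow> lincomb s N (x - y) = lincomb s N x - lincomb s N y"
  by (rule lincomb_diff) (auto intro: dsum_finite)

lemma d_d:
  assumes q: "subquot s U V" and x: "x \<in> tens (Suc (Suc i)) U j"
  shows "lincomb s (D i) (lincomb s (D (Suc i)) x) \<in> tens i V j"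
proof -
  note s = subquotD(1)[OF q]
  have "lincomb s (\<lambda>b. lincomb (*) (D i) (D (Suc i) b)) x \<in> tens i V (j + 0)"
    by (rule lincomb_dsum[where H = I, OF s gmodule_group[OF subquotD(3)[OF q]] _ x])
      (use subquotD(5)[OF q] DD in auto)
  moreover have "lincomb s (D i) (lincomb s (D (Suc i)) x) = lincomb s (\<lambda>b. lincomb (*) (D i) (D (Suc i) b)) x"
    by (rule lincomb_lincomb[OF s dsum_finite[OF x]]) (use dsum_in'[OF x] dsum_finite[OF D] in blast)
  ultimately show ?thesis by simp
qed

lemma tens_mono: "(\<And>q. U q \<subseteq> W q) \<Longrightarrow> x \<in> tens i U j \<Longrightarrow> x \<in> tens i W j"
  using dsum_mono[of U W] by blast

text \<open>
  A segment of the long exact sequence of \<open>0 \<rightarrow> W/V \<rightarrow> U/V \<rightarrow> U/W \<rightarrow> 0\<close>.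
\<close>

lemma tor_zero_sub:
  assumes q: "subquot s U V" and W: "gmodule s W" and VW: "\<And>j. V j \<subseteq> W j" and WU: "\<And>j. W j \<subseteq> U j"
    and v1: "tor_zero s U V i j" and v2: "tor_zero s U W (Suc i) j"
  shows "tor_zero s W V i j"
  unfolding tor_zero_def
proof (intro ballI impI)
  fix x assume x: "x \<in> tens i W j" and cx: "cycle s V i j x"
  note s = subquotD(1)[OF q] and U = subquotD(2)[OF q] and V = subquotD(3)[OF q]
  note TW = graded_group_dsum[OF gmodule_group[OF W]] and TV = graded_group_dsum[OF gmodule_group[OF V]]
    and TU = graded_group_dsum[OF gmodule_group[OF U]]
  obtain y where y: "y \<in> tens (Suc i) U j" "x - lincomb s (D i) y \<in> tens i V j"
    using tor_zeroE[OF v1 tens_mono[OF WU x] cx] .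
  have "lincomb s (D i) y \<in> tens i W j"
    by (rule graded_group_cancel[OF TW x tens_mono[OF VW y(2)]])
  then have "cycle s W (Suc i) j y" by (simp add: cycle_def)
  from tor_zeroE[OF v2 y(1) this] obtain z where z: "z \<in> tens (Suc (Suc i)) U j" "y - lincomb s (D (Suc i)) z \<in> tens (Suc i) W j" .
  let ?w = "y - lincomb s (D (Suc i)) z"
  have "lincomb s (D i) ?w = lincomb s (D i) y - lincomb s (D i) (lincomb s (D (Suc i)) z)"
    by (rule d_diff[OF s y(1) d_in[OF U z(1)]])
  then have "x - lincomb s (D i) ?w = (x - lincomb s (D i) y) + lincomb s (D i) (lincomb s (D (Suc i)) z)" by simp
  also have "\<dots> \<in> tens i V j" using graded_group_add[OF TV y(2) d_d[OF q z(1)]] .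
  finally show "\<exists>y\<in>tens (Suc i) W j. x - lincomb s (D i) y \<in> tens i V j" using z(2) by blast
qed

text \<open>
  The map \<open>f\<close> induces an isomorphism from \<open>U'/V'\<close> to \<open>U/V\<close>, so their \<open>Tor\<close> groups agree.
\<close>

lemma tor_zero_iso:
  assumes U: "gmodule s U" and V: "gmodule s V" and U': "gmodule s' U'" and V': "graded_group V'"
    and f: "Modules.additive f" and lin: "\<And>a u. f (s' a u) = s a (f u)"
    and fU: "\<And>j u. u \<in> U' j \<Longrightarrow> f u \<in> U j"
    and onto: "\<And>j u. u \<in> U j \<Longrightarrow> \<exists>u'\<in>U' j. u - f u' \<in> V j"
    and ker: "\<And>j u. u \<in> U' j \<Longrightarrow> f u \<in> V j \<longleftrightarrow> u \<in> V' j"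
    and VU': "\<And>j. V' j \<subseteq> U' j"
    and v: "tor_zero s U V i j"
  shows "tor_zero s' U' V' i j"
  unfolding tor_zero_def
proof (intro ballI impI)
  fix x assume x: "x \<in> tens i U' j" and cx: "cycle s' V' i j x"
  note s = gmodule_module[OF U] and s' = gmodule_module[OF U']
  note TV = graded_group_dsum[OF gmodule_group[OF V]] and TU' = graded_group_dsum[OF gmodule_group[OF U']]
  have f0: "f 0 = 0" by (rule additive.zero[OF f])
  have push: "(\<lambda>b. f (w b)) \<in> tens k U j" if "w \<in> tens k U' j" for w k
    using dsum_map[OF that, of f U 0] f0 fU gmodule_group[OF U] by simp
  have pushV: "(\<lambda>b. f (w b)) \<in> tens k V j" if "w \<in> tens k V' j" for w k
    using dsum_map[OF that, of f V 0] f0 ker VU' gmodule_group[OF V] by (simp add: subset_iff)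
  have pull: "w \<in> tens k V' j" if "w \<in> tens k U' j" "(\<lambda>b. f (w b)) \<in> tens k V j" for w k
    using dsum_pull[OF that(1), of f V 0 V'] that(2) ker V' by simp
  have comm: "lincomb s N (\<lambda>b. f (w b)) = (\<lambda>c. f (lincomb s' N w c))" if "w \<in> tens k U' j" for w k N
    by (rule lincomb_commute[OF f _ s dsum_finite[OF that]]) (rule lin)
  have "cycle s V i j (\<lambda>b. f (x b))"
    using cx pushV comm[OF x] by (simp add: cycle_def)
  from tor_zeroE[OF v push[OF x] this] obtain y where
    y: "y \<in> tens (Suc i) U j" "(\<lambda>b. f (x b)) - lincomb s (D i) y \<in> tens i V j" .
  obtain y' where y': "y' \<in> tens (Suc i) U' j" "y - (\<lambda>b. f (y' b)) \<in> tens (Suc i) V j"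
    by (rule dsum_lift[where f = f and U = U', OF y(1) onto f0 gmodule_group[OF V] gmodule_group[OF U']])
  have "(\<lambda>b. f ((x - lincomb s' (D i) y') b)) = (\<lambda>b. f (x b)) - lincomb s (D i) (\<lambda>b. f (y' b))"
    unfolding comm[OF y'(1)] by (auto simp: additive.diff[OF f])
  also have "\<dots> = ((\<lambda>b. f (x b)) - lincomb s (D i) y) + lincomb s (D i) (y - (\<lambda>b. f (y' b)))"
    using d_diff[OF s y(1) push[OF y'(1)], where N = "D i"] by simp
  also have "\<dots> \<in> tens i V j"
    by (rule graded_group_add[OF TV y(2) d_in[OF V y'(2)]])
  finally have "x - lincomb s' (D i) y' \<in> tens i V' j"
    by (intro pull graded_group_diff[OF TU'] x d_in[OF U'] y'(1))
  then show "\<exists>y\<in>tens (Suc i) U' j. x - lincomb s' (D i) y \<in> tens i V' j" using y'(1) by blast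
qed

text \<open>
  The group \<open>Tor\<^sub>0(U/V, k)\<close> is the quotient of \<open>U/V\<close> by the products of elements of positive degree with elements
  of \<open>U\<close>. So if it is zero in degree \<open>j\<close>, then any \<open>W\<close> that contains \<open>V\<close> and these products in degree \<open>j\<close> contains
  all of \<open>U\<close> in that degree. The augmentation serves as a retraction from the resolution tensored with \<open>U/V\<close>.
\<close>

lemma generated_by_lower_degrees:
  assumes q: "subquot s U V" and v: "tor_zero s U V 0 j" and m: "m \<in> U j"
    and W: "graded_group W" and VW: "V j \<subseteq> W j"
    and gen: "\<And>p a u. 0 < p \<Longrightarrow> p \<le> j \<Longrightarrow> a \<in> G p \<Longrightarrow> u \<in> U (j - p) \<Longrightarrow> s a u \<in> W j"
  shows "m \<in> W j"
proof -
  note s = subquotD(1)[OF q] and U = subquotD(2)[OF q] and V = subquotD(3)[OF q]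
  interpret s: Modules.module s by (rule s)
  let ?A = "\<lambda>c _::nat. \<alpha> c"
  obtain u where u: "u \<in> tens 0 G 0" "lincomb (*) ?A u 0 = 1" using aug_onto by blast
  \<comment> \<open>The vector \<open>u\<close> has augmentation \<open>1\<close>, so \<open>?x\<close> represents \<open>m\<close> in degree zero of the complex.\<close>
  let ?x = "\<lambda>b. s (u b) m"
  have x: "?x \<in> tens 0 U j"
  proof -
    have "finite {b. s (u b) m \<noteq> 0}"
      by (rule finite_subset[OF _ dsum_finite[OF u(1)]]) auto
    moreover have "s (u b) m \<in> shift (e 0 b) U j" if "b \<in> B 0" for b
      using dsum_in[OF u(1) that] gmodule_mult[OF U _ m, of "u b" 0] s.scale_zero_left
        graded_group_0[OF gmodule_group[OF U]]
      by (auto simp: shift_def split: if_splits)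
    ultimately show ?thesis using dsum_zero[OF u(1)] by (auto simp: dsum_def)
  qed
  have "cycle s V 0 j ?x" by (simp add: cycle_def)
  from tor_zeroE[OF v x this] obtain y where y: "y \<in> tens (Suc 0) U j" "?x - lincomb s (D 0) y \<in> tens 0 V j" .
  have mx: "lincomb s ?A ?x 0 = m"
    using lincomb_scale_ring[OF s dsum_finite[OF u(1)], of ?A m] u(2) by simp
  have split: "lincomb s ?A ?x = lincomb s ?A (?x - lincomb s (D 0) y) + lincomb s ?A (lincomb s (D 0) y)"
    using d_diff[OF s x d_in[OF U], where N = ?A] y(1) by simp
  have w1: "lincomb s ?A (?x - lincomb s (D 0) y) 0 \<in> W j"
  proof -
    have "lincomb s ?A (?x - lincomb s (D 0) y) 0 \<in> V j"
      unfolding lincomb_def[of s ?A]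
    proof (rule graded_group_sum[OF gmodule_group[OF V]])
      fix b assume "b \<in> {b. (?x - lincomb s (D 0) y) b \<noteq> 0}"
      then have "(?x - lincomb s (D 0) y) b \<noteq> 0" by (rule CollectD)
      then have b: "b \<in> B 0" "e 0 b \<le> j" "(?x - lincomb s (D 0) y) b \<in> V (j - e 0 b)"
        using dsum_in'[OF y(2), of b] by (simp_all only: simp_thms)
      show "s (\<alpha> b) ((?x - lincomb s (D 0) y) b) \<in> V j"
      proof (cases "e 0 b = 0")
        case True
        then show ?thesis using gmodule_mult[OF V aug_in[OF b(1)] b(3)] by (simp only: add_0 diff_zero)
      next
        case False
        then show ?thesis
          unfolding aug_deg[OF b(1) False] s.scale_zero_left by (intro graded_group_0 gmodule_group[OF V])
      qed
    qed
    then show ?thesis using VW by blast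
  qed
  have w2: "lincomb s ?A (lincomb s (D 0) y) 0 \<in> W j"
  proof -
    have fin: "\<And>b. y b \<noteq> 0 \<Longrightarrow> finite {c. D 0 b c \<noteq> 0}"
      using dsum_in'[OF y(1)] dsum_finite[OF D[of _ 0]] by simp
    have "lincomb s ?A (lincomb s (D 0) y) 0 = lincomb s (\<lambda>b. lincomb (*) ?A (D 0 b)) y 0"
      using lincomb_lincomb[OF s dsum_finite[OF y(1)] fin] by simp
    also have "\<dots> \<in> W j"
      unfolding lincomb_def[of s]
    proof (rule graded_group_sum[OF W])
      fix b assume "b \<in> {b. y b \<noteq> 0}"
      then have b: "b \<in> B 1" "e 1 b \<le> j" "y b \<in> U (j - e 1 b)"
        using dsum_in'[OF y(1), of b] by simp_all
      show "s (lincomb (*) ?A (D 0 b) 0) (y b) \<in> W j"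
      proof (cases "e 1 b = 0")
        case True
        then have "lincomb (*) ?A (D 0 b) 0 = 0" using aug_D[OF b(1)] by (simp add: irr_def)
        then show ?thesis using graded_group_0[OF W] by (simp only: s.scale_zero_left)
      next
        case False
        then show ?thesis using aug_D[OF b(1)] gen[OF _ b(2) _ b(3)] by (simp add: irr_def)
      qed
    qed
    finally show ?thesis .
  qed
  have "lincomb s ?A (?x - lincomb s (D 0) y) 0 + lincomb s ?A (lincomb s (D 0) y) 0 = lincomb s ?A ?x 0"
    by (subst split) (rule plus_fun_apply[symmetric])
  then show ?thesis using graded_group_add[OF W w1 w2] by (simp only: mx)
qed

end

context residue_resolution
begin

section \<open>Point modules and the quotient by a form\<close>

lemma subquot_ideal:
  assumes V: "gmodule (*) V" and "\<And>j. I j \<subseteq> V j" and "\<And>j. V j \<subseteq> G j"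
  shows "subquot (*) G V"
  unfolding subquot_def
proof (intro conjI allI ballI)
  fix p q a u assume "a \<in> I p" "u \<in> G q"
  then have "u * a \<in> V (q + p)" using gmodule_mult[OF V] assms(2) by blast
  then show "a * u \<in> V (p + q)" by (simp add: ac_simps)
qed (use assms gmodule_G in auto)

text \<open>
  The rows of the diagonal matrix with all diagonal entries \<open>l\<close>.
\<close>

definition unit :: "'r \<Rightarrow> nat \<Rightarrow> nat \<Rightarrow> 'r" where
  "unit l b c = (if c = b then l else 0)"

lemma unit_in: "l \<in> G 1 \<Longrightarrow> b \<in> B i \<Longrightarrow> unit l b \<in> tens i G (e i b + 1)"
  using graded_group_0[OF graded_group_G] by (auto simp: dsum_def unit_def shift_def)

lemma lincomb_unit: "lincomb (*) N (unit l b) = (\<lambda>c. l * N b c)"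
proof
  fix c
  have "lincomb (*) N (unit l b) c = (\<Sum>a\<in>{b}. N a c * unit l b a)"
    by (rule lincomb_superset[OF module_mult]) (auto simp: unit_def)
  then show "lincomb (*) N (unit l b) c = l * N b c" by (simp add: unit_def)
qed

lemma lincomb_unit_rows_tens: "Modules.module s \<Longrightarrow> x \<in> tens i U j \<Longrightarrow> lincomb s (unit l) x = (\<lambda>c. s l (x c))"
  unfolding unit_def by (rule lincomb_unit_rows) (auto intro: dsum_finite)

text \<open>
  The obstruction to the next step of a null homotopy \<open>S\<close> of multiplication by \<open>l\<close> is a cycle. Here \<open>C\<close> stands for the
  composite of the differential with the part of the homotopy one step below.
\<close>

lemma homotopy_step:
  assumes l: "l \<in> G 1" and b: "b \<in> B (Suc i)"
    and S: "\<And>c. c \<in> B i \<Longrightarrow> S c \<in> tens (Suc i) G (e i c + 1)"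
    and res: "\<And>c. c \<in> B i \<Longrightarrow> unit l c - C c - lincomb (*) (D i) (S c) \<in> tens i I (e i c + 1)"
    and C: "lincomb (*) C (D i b) \<in> tens i I (e (Suc i) b + 1)"
  shows "lincomb (*) (D i) (unit l b - lincomb (*) S (D i b)) \<in> tens i I (e (Suc i) b + 1)"
proof -
  note m = module_mult
  have Db: "D i b \<in> tens i G (e (Suc i) b)" by (rule D[OF b])
  have SD: "lincomb (*) S (D i b) \<in> tens (Suc i) G (e (Suc i) b + 1)"
    by (rule lincomb_dsum[OF m graded_group_G mult_in_G Db S])
  have "lincomb (*) (D i) (unit l b - lincomb (*) S (D i b))
      = lincomb (*) (D i) (unit l b) - lincomb (*) (D i) (lincomb (*) S (D i b))"
    by (rule d_diff[OF m unit_in[OF l b] SD])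
  also have "lincomb (*) (D i) (lincomb (*) S (D i b)) = lincomb (*) (\<lambda>c. lincomb (*) (D i) (S c)) (D i b)"
    by (rule lincomb_lincomb[OF m dsum_finite[OF Db]]) (use S dsum_in'[OF Db] dsum_finite in blast)
  also have "lincomb (*) (D i) (unit l b) = lincomb (*) (unit l) (D i b)"
    unfolding lincomb_unit lincomb_unit_rows_tens[OF m Db] ..
  also have "lincomb (*) (unit l) (D i b) - lincomb (*) (\<lambda>c. lincomb (*) (D i) (S c)) (D i b)
      = lincomb (*) (\<lambda>c. unit l c - C c - lincomb (*) (D i) (S c)) (D i b) + lincomb (*) C (D i b)"
    by (simp add: lincomb_diff_rows[OF m])
  also have "\<dots> \<in> tens i I (e (Suc i) b + 1)"
    by (rule graded_group_add[OF graded_group_dsum[OF gmodule_group[OF I]] lincomb_dsum[OF m gmodule_group[OF I] _ Db res] C])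
      (use gmodule_mult[OF I] in \<open>metis mult.commute add.commute\<close>)
  finally show ?thesis .
qed

text \<open>
  Multiplication by a linear form is zero on \<open>k\<close>, so it is null homotopic on a free resolution of \<open>k\<close>. The homotopy
  is built degree by degree; it is defined on basis elements and raises internal degree by one.
\<close>

lemma homotopy:
  assumes l: "l \<in> G 1"
  obtains S where "\<And>i b. b \<in> B i \<Longrightarrow> S i b \<in> tens (Suc i) G (e i b + 1)"
    and "\<And>b. b \<in> B 0 \<Longrightarrow> unit l b - lincomb (*) (D 0) (S 0 b) \<in> tens 0 I (e 0 b + 1)"
    and "\<And>i b. b \<in> B (Suc i) \<Longrightarrow>
      unit l b - lincomb (*) (S i) (D i b) - lincomb (*) (D (Suc i)) (S (Suc i) b) \<in> tens (Suc i) I (e (Suc i) b + 1)"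
proof -
  note m = module_mult
  define ok where "ok i S \<longleftrightarrow> (\<forall>b\<in>B i. S b \<in> tens (Suc i) G (e i b + 1)) \<and>
    (\<forall>b\<in>B (Suc i). lincomb (*) (D i) (unit l b - lincomb (*) S (D i b)) \<in> tens i I (e (Suc i) b + 1)) \<and>
    (i = 0 \<longrightarrow> (\<forall>b\<in>B 0. unit l b - lincomb (*) (D 0) (S b) \<in> tens 0 I (e 0 b + 1)))" for i S
  define next_ok where "next_ok i S S' \<longleftrightarrow> (\<forall>b\<in>B (Suc i).
    unit l b - lincomb (*) S (D i b) - lincomb (*) (D (Suc i)) (S' b) \<in> tens (Suc i) I (e (Suc i) b + 1))" for i S S'
  have "\<exists>S. ok 0 S"
  proof -
    have "\<exists>y\<in>tens (Suc 0) G (e 0 b + 1). unit l b - lincomb (*) (D 0) y \<in> tens 0 I (e 0 b + 1)" if "b \<in> B 0" for b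
      using exact_0[OF _ unit_in[OF l that]] by simp
    then obtain S where S: "\<And>b. b \<in> B 0 \<Longrightarrow> S b \<in> tens (Suc 0) G (e 0 b + 1)"
      "\<And>b. b \<in> B 0 \<Longrightarrow> unit l b - lincomb (*) (D 0) (S b) \<in> tens 0 I (e 0 b + 1)" by metis
    have "lincomb (*) (D 0) (unit l b - lincomb (*) S (D 0 b)) \<in> tens 0 I (e (Suc 0) b + 1)" if b: "b \<in> B (Suc 0)" for b
    proof (rule homotopy_step[OF l b S(1), where C = "\<lambda>_. 0"])
      have "lincomb (*) (\<lambda>_. 0) (D 0 b) = (0 :: nat \<Rightarrow> 'r)" by (auto simp: lincomb_def)
      then show "lincomb (*) (\<lambda>_. 0) (D 0 b) \<in> tens 0 I (e (Suc 0) b + 1)"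
        using graded_group_0[OF graded_group_dsum[OF gmodule_group[OF I]]] by simp
    qed (use S(2) in simp_all)
    then have "ok 0 S" using S by (simp add: ok_def)
    then show ?thesis by blast
  qed
  moreover have "\<exists>S'. ok (Suc i) S' \<and> next_ok i S S'" if "ok i S" for i S
  proof -
    have S: "\<And>b. b \<in> B i \<Longrightarrow> S b \<in> tens (Suc i) G (e i b + 1)"
      and cyc: "\<And>b. b \<in> B (Suc i) \<Longrightarrow> lincomb (*) (D i) (unit l b - lincomb (*) S (D i b)) \<in> tens i I (e (Suc i) b + 1)"
      using that by (auto simp: ok_def)
    have "\<exists>y\<in>tens (Suc (Suc i)) G (e (Suc i) b + 1).
        unit l b - lincomb (*) S (D i b) - lincomb (*) (D (Suc i)) y \<in> tens (Suc i) I (e (Suc i) b + 1)"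
      if b: "b \<in> B (Suc i)" for b
      by (rule exact_Suc[OF graded_group_diff[OF graded_group_dsum[OF graded_group_G] unit_in[OF l b]
        lincomb_dsum[OF m graded_group_G mult_in_G D[OF b] S]] cyc[OF b]])
    then obtain S' where S': "\<And>b. b \<in> B (Suc i) \<Longrightarrow> S' b \<in> tens (Suc (Suc i)) G (e (Suc i) b + 1)"
      "\<And>b. b \<in> B (Suc i) \<Longrightarrow> unit l b - lincomb (*) S (D i b) - lincomb (*) (D (Suc i)) (S' b) \<in> tens (Suc i) I (e (Suc i) b + 1)"
      by metis
    have "lincomb (*) (D (Suc i)) (unit l b - lincomb (*) S' (D (Suc i) b)) \<in> tens (Suc i) I (e (Suc (Suc i)) b + 1)"
      if b: "b \<in> B (Suc (Suc i))" for b
    proof (rule homotopy_step[OF l b S'(1), where C = "\<lambda>c. lincomb (*) S (D i c)"])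
      have Db: "D (Suc i) b \<in> tens (Suc i) G (e (Suc (Suc i)) b)" by (rule D[OF b])
      have "lincomb (*) (\<lambda>c. lincomb (*) S (D i c)) (D (Suc i) b) = lincomb (*) S (lincomb (*) (D i) (D (Suc i) b))"
        by (rule lincomb_lincomb[OF m dsum_finite[OF Db], symmetric]) (use dsum_in'[OF Db] dsum_finite[OF D] in blast)
      also have "\<dots> \<in> tens (Suc i) I (e (Suc (Suc i)) b + 1)"
        by (rule lincomb_dsum[OF m gmodule_group[OF I] _ DD[OF b] S]) (use gmodule_mult[OF I] in auto)
      finally show "lincomb (*) (\<lambda>c. lincomb (*) S (D i c)) (D (Suc i) b) \<in> tens (Suc i) I (e (Suc (Suc i)) b + 1)" .
    qed (use S' in simp_all)
    then show ?thesis using S' by (auto simp: ok_def next_ok_def)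
  qed
  ultimately obtain S where S: "\<And>i. ok i (S i)" "\<And>i. next_ok i (S i) (S (Suc i))"
    using dependent_nat_choice[of ok next_ok] by blast
  show ?thesis
  proof (rule that[of S])
    show "\<And>i b. b \<in> B i \<Longrightarrow> S i b \<in> tens (Suc i) G (e i b + 1)" using S(1) by (auto simp: ok_def)
    show "\<And>b. b \<in> B 0 \<Longrightarrow> unit l b - lincomb (*) (D 0) (S 0 b) \<in> tens 0 I (e 0 b + 1)"
      using S(1)[of 0] by (auto simp: ok_def)
  qed (use S(2) in \<open>auto simp: next_ok_def\<close>)
qed

text \<open>
  Tensoring the null homotopy with \<open>U/V\<close> shows that a linear form acts as zero on \<open>Tor(U/V, k)\<close>.
\<close>

lemma linear_form_null_homotopic:
  assumes q: "subquot s U V" and l: "l \<in> G 1" and z: "z \<in> tens i U j" and cz: "cycle s V i j z"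
  shows "\<exists>y\<in>tens (Suc i) U (j + 1). (\<lambda>b. s l (z b)) - lincomb s (D i) y \<in> tens i V (j + 1)"
proof -
  note s = subquotD(1)[OF q] and U = subquotD(2)[OF q] and V = subquotD(3)[OF q]
  obtain S where S: "\<And>i b. b \<in> B i \<Longrightarrow> S i b \<in> tens (Suc i) G (e i b + 1)"
    and S0: "\<And>b. b \<in> B 0 \<Longrightarrow> unit l b - lincomb (*) (D 0) (S 0 b) \<in> tens 0 I (e 0 b + 1)"
    and SS: "\<And>i b. b \<in> B (Suc i) \<Longrightarrow>
      unit l b - lincomb (*) (S i) (D i b) - lincomb (*) (D (Suc i)) (S (Suc i) b) \<in> tens (Suc i) I (e (Suc i) b + 1)"
    using homotopy[OF l] by metis
  let ?y = "lincomb s (S i) z"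
  have y: "?y \<in> tens (Suc i) U (j + 1)"
    by (rule lincomb_dsum[OF s gmodule_group[OF U] gmodule_mult[OF U] z S])
  have dy: "lincomb s (D i) ?y = lincomb s (\<lambda>b. lincomb (*) (D i) (S i b)) z"
    by (rule lincomb_lincomb[OF s dsum_finite[OF z]]) (use dsum_in'[OF z] dsum_finite[OF S] in blast)
  have lz: "(\<lambda>b. s l (z b)) = lincomb s (unit l) z" by (rule lincomb_unit_rows_tens[OF s z, symmetric])
  have "(\<lambda>b. s l (z b)) - lincomb s (D i) ?y \<in> tens i V (j + 1)"
  proof (cases i)
    case 0
    have "lincomb s (\<lambda>b. unit l b - lincomb (*) (D i) (S i b)) z \<in> tens i V (j + 1)"
      by (rule lincomb_dsum[OF s gmodule_group[OF V] subquotD(5)[OF q] z]) (use S0 0 in auto)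
    then show ?thesis by (simp only: lz dy lincomb_diff_rows[OF s])
  next
    case (Suc k)
    have w: "lincomb s (D k) z \<in> tens k V j" using cz Suc by (simp add: cycle_def)
    have zk: "z \<in> tens (Suc k) U j" using z Suc by simp
    have "lincomb s (\<lambda>b. unit l b - lincomb (*) (S k) (D k b) - lincomb (*) (D i) (S i b)) z \<in> tens i V (j + 1)"
      by (rule lincomb_dsum[OF s gmodule_group[OF V] subquotD(5)[OF q] z]) (use SS Suc in auto)
    then have 1: "lincomb s (unit l) z - lincomb s (\<lambda>b. lincomb (*) (S k) (D k b)) z
        - lincomb s (\<lambda>b. lincomb (*) (D i) (S i b)) z \<in> tens i V (j + 1)"
      by (simp only: lincomb_diff_rows[OF s])
    have "lincomb s (\<lambda>b. lincomb (*) (S k) (D k b)) z = lincomb s (S k) (lincomb s (D k) z)"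
      by (rule lincomb_lincomb[OF s dsum_finite[OF z], symmetric]) (use dsum_in'[OF zk] dsum_finite[OF D] in blast)
    also have "\<dots> \<in> tens i V (j + 1)"
      unfolding Suc by (rule lincomb_dsum[OF s gmodule_group[OF V] gmodule_mult[OF V] w S])
    finally have 2: "lincomb s (\<lambda>b. lincomb (*) (S k) (D k b)) z \<in> tens i V (j + 1)" .
    have "lincomb s (unit l) z - lincomb s (\<lambda>b. lincomb (*) (D i) (S i b)) z \<in> tens i V (j + 1)"
      using graded_group_add[OF graded_group_dsum[OF gmodule_group[OF V]] 1 2] by (simp add: algebra_simps)
    then show ?thesis by (simp only: lz dy)
  qed
  then show ?thesis using y by blast
qed

text \<open>
  If \<open>l\<close> is injective on \<open>G/P\<close> with cokernel \<open>k\<close>, then the long exact sequence of \<open>0 \<rightarrow> G/P(-1) \<rightarrow> G/P \<rightarrow> k \<rightarrow> 0\<close>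
  breaks into short ones because \<open>l\<close> acts as zero on \<open>Tor\<close>. The proof follows the connecting map by elements:
  for a cycle \<open>z\<close>, the product \<open>l z\<close> is the boundary of a chain \<open>y\<close>, which is a cycle modulo the irrelevant ideal, and
  correcting \<open>y\<close> by a boundary makes it divisible by \<open>l\<close>.
\<close>

lemma tor_zero_point_module:
  assumes P: "gmodule (*) P" and IP: "\<And>j. I j \<subseteq> P j" and Pirr: "\<And>j. P j \<subseteq> irr j"
    and l: "l \<in> G 1" and reg: "\<And>f j. f \<in> G j \<Longrightarrow> l * f \<in> P (j + 1) \<Longrightarrow> f \<in> P j"
    and split: "\<And>f j. f \<in> irr j \<Longrightarrow> \<exists>g\<in>shift 1 G j. f - l * g \<in> P j"
    and lin: "\<And>i j. i < j \<Longrightarrow> tor_zero (*) G irr i j" and ij: "i < j"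
  shows "tor_zero (*) G P i j"
  unfolding tor_zero_def
proof (intro ballI impI)
  fix z assume z: "z \<in> tens i G j" and cz: "cycle (*) P i j z"
  note m = module_mult
  have PG: "\<And>j. P j \<subseteq> G j" using Pirr irr_sub by blast
  have qP: "subquot (*) G P" using subquot_ideal[OF P IP PG] .
  have qm: "subquot (*) G irr" using subquot_ideal[OF gmodule_irr _ irr_sub] IP Pirr by blast
  note TP = graded_group_dsum[OF gmodule_group[OF P]] and Tm = graded_group_dsum[OF graded_group_irr]
  obtain y where y: "y \<in> tens (Suc i) G (j + 1)" "(\<lambda>b. l * z b) - lincomb (*) (D i) y \<in> tens i P (j + 1)"
    using linear_form_null_homotopic[OF qP l z cz] by blast
  have lz: "(\<lambda>b. l * z b) \<in> tens i irr (j + 1)"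
    by (rule dsum_map[OF z _ _ graded_group_irr]) (use mult_in_G[OF l] in \<open>auto simp: irr_def\<close>)
  have "lincomb (*) (D i) y \<in> tens i irr (j + 1)"
    by (rule graded_group_cancel[OF Tm lz tens_mono[OF Pirr y(2)]])
  then have "cycle (*) irr (Suc i) (j + 1) y" by (simp add: cycle_def)
  from tor_zeroE[OF lin y(1) this] ij obtain w where
    w: "w \<in> tens (Suc (Suc i)) G (j + 1)" "y - lincomb (*) (D (Suc i)) w \<in> tens (Suc i) irr (j + 1)" by auto
  obtain y' where y': "y' \<in> tens (Suc i) (shift 1 G) (j + 1)"
    "y - lincomb (*) (D (Suc i)) w - (\<lambda>b. l * y' b) \<in> tens (Suc i) P (j + 1)"
    by (rule dsum_lift[OF w(2) split])
      (use gmodule_group[OF P] graded_group_shift[OF graded_group_G] in auto)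
  have y'': "y' \<in> tens (Suc i) G j" using y'(1) dsum_shift by blast
  have ly': "(\<lambda>b. l * y' b) \<in> tens (Suc i) G (1 + j)" by (rule dsum_scale[OF gmodule_G l y''])
  have dw: "lincomb (*) (D (Suc i)) w \<in> tens (Suc i) G (j + 1)" by (rule d_in[OF gmodule_G w(1)])
  have "lincomb (*) (D i) (y - lincomb (*) (D (Suc i)) w - (\<lambda>b. l * y' b))
      = lincomb (*) (D i) y - lincomb (*) (D i) (lincomb (*) (D (Suc i)) w) - lincomb (*) (D i) (\<lambda>b. l * y' b)"
    using d_diff[OF m graded_group_diff[OF graded_group_dsum[OF graded_group_G] y(1) dw] ly', of "D i"]
      d_diff[OF m y(1) dw, of "D i"] by simp
  then have "(\<lambda>b. l * z b) - lincomb (*) (D i) (\<lambda>b. l * y' b)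
      = ((\<lambda>b. l * z b) - lincomb (*) (D i) y) + lincomb (*) (D i) (lincomb (*) (D (Suc i)) w)
        + lincomb (*) (D i) (y - lincomb (*) (D (Suc i)) w - (\<lambda>b. l * y' b))"
    by simp
  also have "\<dots> \<in> tens i P (j + 1)"
    by (intro graded_group_add[OF TP] y(2) d_d[OF qP w(1)] d_in[OF P y'(2)])
  finally have 1: "(\<lambda>b. l * z b) - lincomb (*) (D i) (\<lambda>b. l * y' b) \<in> tens i P (j + 1)" .
  have "(\<lambda>b. l * z b) - lincomb (*) (D i) (\<lambda>b. l * y' b) = (\<lambda>b. l * (z - lincomb (*) (D i) y') b)"
    using lincomb_scale[OF m dsum_finite[OF y''], of "D i" l] by (auto simp: algebra_simps)
  with 1 have 2: "(\<lambda>b. l * (z - lincomb (*) (D i) y') b) \<in> tens i P (j + 1)" by simp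
  have zd: "z - lincomb (*) (D i) y' \<in> tens i G j"
    by (intro graded_group_diff[OF graded_group_dsum[OF graded_group_G]] z d_in[OF gmodule_G y''])
  have "z - lincomb (*) (D i) y' \<in> tens i P j"
    by (rule dsum_pull[OF zd 2 reg gmodule_group[OF P]])
  then show "\<exists>y\<in>tens (Suc i) G j. z - lincomb (*) (D i) y \<in> tens i P j" using y'' by blast
qed

text \<open>
  The kernel of \<open>G/I \<rightarrow> G/I'\<close> is generated by \<open>h\<close> and is isomorphic to \<open>G/P(-d)\<close>. So \<open>Tor\<^sub>i(G/I', k)\<close> for positive \<open>i\<close>
  embeds into \<open>Tor\<close> of \<open>G/P\<close> with homological degree \<open>i - 1\<close> and internal degree lowered by \<open>d\<close>; the bound \<open>d \<le> 2\<close>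
  turns \<open>j > i + 1\<close> into \<open>j - d > i - 1\<close>.
\<close>

lemma tor_zero_quotient_by_form:
  assumes I': "gmodule (*) I'" and II': "\<And>j. I j \<subseteq> I' j" and I'G: "\<And>j. I' j \<subseteq> G j"
    and h: "h \<in> G d" "h \<in> I' d" and d: "d \<le> 2"
    and split: "\<And>f j. f \<in> I' j \<Longrightarrow> \<exists>g\<in>shift d G j. f - h * g \<in> I j"
    and P: "gmodule (*) P" and IP: "\<And>j. I j \<subseteq> P j" and PG: "\<And>j. P j \<subseteq> G j"
    and ann: "\<And>f j. f \<in> G j \<Longrightarrow> h * f \<in> I (d + j) \<longleftrightarrow> f \<in> P j"
    and lin: "\<And>i j. i < j \<Longrightarrow> tor_zero (*) G P i j" and ij: "i + 1 < j"
  shows "tor_zero (*) G I' i j"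
  unfolding tor_zero_def
proof (intro ballI impI)
  fix x assume x: "x \<in> tens i G j" and cx: "cycle (*) I' i j x"
  note m = module_mult
  have qI: "subquot (*) G I" using subquot_ideal[OF I _ I_sub] by blast
  have qI': "subquot (*) G I'" using subquot_ideal[OF I' II' I'G] .
  note TI = graded_group_dsum[OF gmodule_group[OF I]] and TI' = graded_group_dsum[OF gmodule_group[OF I']]
    and TG = graded_group_dsum[OF graded_group_G]
  show "\<exists>y\<in>tens (Suc i) G j. x - lincomb (*) (D i) y \<in> tens i I' j"
  proof (cases i)
    case 0
    then obtain y where "y \<in> tens (Suc i) G j" "x - lincomb (*) (D i) y \<in> tens i I j"
      using exact_0[of j x] x ij by auto
    then show ?thesis using tens_mono[where U = I and W = I', OF II'] by blast
  next
    case (Suc k)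
    have xk: "x \<in> tens (Suc k) G j" using x Suc by simp
    have dx: "lincomb (*) (D k) x \<in> tens k I' j" using cx Suc by (simp add: cycle_def)
    have dj: "d \<le> j" "k < j - d" using d ij Suc by auto
    obtain z where z: "z \<in> tens k (shift d G) j" "lincomb (*) (D k) x - (\<lambda>b. h * z b) \<in> tens k I j"
      by (rule dsum_lift[OF dx split])
        (use gmodule_group[OF I] graded_group_shift[OF graded_group_G] in auto)
    have z': "z \<in> tens k G (j - d)" using z(1) dsum_shift[of _ _ d G "j - d"] dj by simp
    have hz: "(\<lambda>b. h * z b) \<in> tens k G j" using dsum_scale[OF gmodule_G h(1) z'] dj by simp
    have jd: "j - d + d = j" using dj by simp
    have pull: "w \<in> tens l P (j - d)" if "w \<in> tens l G (j - d)" "(\<lambda>b. h * w b) \<in> tens l I j" for w l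
      by (rule dsum_pull[OF that(1), where f = "(*) h" and W = I and d = d])
        (use that(2) jd ann gmodule_group[OF P] in \<open>auto simp: add.commute\<close>)
    have push: "(\<lambda>b. h * w b) \<in> tens l I j" if "w \<in> tens l P (j - d)" for w l
      using dsum_map[OF that, of "(*) h" I d] ann PG gmodule_group[OF I] jd by (auto simp: add.commute subset_iff)
    have "cycle (*) P k (j - d) z"
      unfolding cycle_def
    proof (intro allI impI)
      fix l assume l: "k = Suc l"
      have zl: "z \<in> tens (Suc l) G (j - d)" using z' l by simp
      have ddx: "lincomb (*) (D l) (lincomb (*) (D k) x) \<in> tens l I j" using d_d[OF qI] xk l by simp
      have "lincomb (*) (D l) (lincomb (*) (D k) x - (\<lambda>b. h * z b)) \<in> tens l I j"
        using d_in[OF I] z(2) l by simp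
      moreover have "lincomb (*) (D l) (lincomb (*) (D k) x - (\<lambda>b. h * z b))
          = lincomb (*) (D l) (lincomb (*) (D k) x) - lincomb (*) (D l) (\<lambda>b. h * z b)"
        by (rule d_diff[OF m d_in[OF gmodule_G xk] hz])
      ultimately have "lincomb (*) (D l) (\<lambda>b. h * z b) \<in> tens l I j"
        using graded_group_cancel[OF TI ddx] by simp
      then have "(\<lambda>b. h * lincomb (*) (D l) z b) \<in> tens l I j"
        using lincomb_scale[OF m dsum_finite[OF z'], of "D l" h] by simp
      then show "lincomb (*) (D l) z \<in> tens l P (j - d)"
        using pull[OF d_in[OF gmodule_G zl]] by blast
    qed
    from tor_zeroE[OF lin[OF dj(2)] z' this] obtain y where
      y: "y \<in> tens (Suc k) G (j - d)" "z - lincomb (*) (D k) y \<in> tens k P (j - d)" .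
    have hy: "(\<lambda>b. h * y b) \<in> tens (Suc k) G j" using dsum_scale[OF gmodule_G h(1) y(1)] dj by simp
    have hy': "(\<lambda>b. h * y b) \<in> tens (Suc k) I' j"
      using dsum_map[OF y(1), of "(*) h" I' d] gmodule_mult[OF I' _ h(2)] gmodule_group[OF I'] jd
      by (simp add: mult.commute)
    have "lincomb (*) (D k) (x - (\<lambda>b. h * y b)) = lincomb (*) (D k) x - lincomb (*) (D k) (\<lambda>b. h * y b)"
      by (rule d_diff[OF m xk hy])
    also have "\<dots> = (lincomb (*) (D k) x - (\<lambda>b. h * z b)) + (\<lambda>b. h * (z - lincomb (*) (D k) y) b)"
      using lincomb_scale[OF m dsum_finite[OF y(1)], of "D k" h] by (auto simp: algebra_simps)
    also have "\<dots> \<in> tens k I j" by (rule graded_group_add[OF TI z(2) push[OF y(2)]])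
    finally obtain w where w: "w \<in> tens (Suc i) G j" "x - (\<lambda>b. h * y b) - lincomb (*) (D i) w \<in> tens i I j"
      using exact_Suc[OF graded_group_diff[OF TG xk hy]] Suc by auto
    have "x - lincomb (*) (D i) w = (x - (\<lambda>b. h * y b) - lincomb (*) (D i) w) + (\<lambda>b. h * y b)" by simp
    also have "\<dots> \<in> tens i I' j"
      by (rule graded_group_add[OF TI' tens_mono[OF II' w(2)]]) (use hy' Suc in simp)
    finally show ?thesis using w(1) by blast
  qed
qed

end

context graded_ring
begin

section \<open>A linear resolution from bounds on Tor\<close>

text \<open>
  Linear algebra over the field \<open>G 0\<close>: a subspace \<open>W\<close> of a space that is spanned, modulo \<open>W0\<close>, by a finite family
  has a finite basis modulo \<open>W0\<close>. By induction on the family, the last vector of the basis is any vector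
  whose expansion needs the last member of the family.
\<close>

lemma basis_modulo_subspace:
  fixes s :: "'r \<Rightarrow> 'm::ab_group_add \<Rightarrow> 'm" and v :: "'k \<Rightarrow> 'm"
  assumes field: "\<And>a. a \<in> G 0 \<Longrightarrow> a \<noteq> 0 \<Longrightarrow> \<exists>b\<in>G 0. b * a = 1"
    and s: "Modules.module s" and K: "finite K"
    and W0: "\<And>x y. x \<in> W0 \<Longrightarrow> y \<in> W0 \<Longrightarrow> x - y \<in> W0" "\<And>a x. a \<in> G 0 \<Longrightarrow> x \<in> W0 \<Longrightarrow> s a x \<in> W0"
    and W: "\<And>x y. x \<in> W \<Longrightarrow> y \<in> W \<Longrightarrow> x - y \<in> W" "\<And>a x. a \<in> G 0 \<Longrightarrow> x \<in> W \<Longrightarrow> s a x \<in> W"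
    and sub: "0 \<in> W0" "W0 \<subseteq> W"
    and span: "\<And>w. w \<in> W \<Longrightarrow> \<exists>c. (\<forall>k. c k \<in> G 0) \<and> w - (\<Sum>k\<in>K. s (c k) (v k)) \<in> W0"
  shows "\<exists>(n::nat) g. (\<forall>b<n. g b \<in> W) \<and>
    (\<forall>w\<in>W. \<exists>c. (\<forall>b. c b \<in> G 0) \<and> w - (\<Sum>b<n. s (c b) (g b)) \<in> W0) \<and>
    (\<forall>c. (\<forall>b. c b \<in> G 0) \<longrightarrow> (\<Sum>b<n. s (c b) (g b)) \<in> W0 \<longrightarrow> (\<forall>b<n. c b = 0))"
  using K W sub(2) span
proof (induction K arbitrary: W rule: finite_induct)
  case empty
  then show ?case
    by (intro exI[of _ 0] exI[of _ "\<lambda>_. 0"]) (auto intro!: exI[of _ "\<lambda>_. 1"] one_in_G)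
next
  case (insert k K)
  interpret s: Modules.module s by (rule s)
  have G0: "a - b \<in> G 0" "a * b \<in> G 0" "0 \<in> G 0" if "a \<in> G 0" "b \<in> G 0" for a b
    using that graded_group_diff[OF graded_group_G] mult_in_G[of a 0 b 0] graded_group_0[OF graded_group_G] by auto
  have W0_add: "x + y \<in> W0" if "x \<in> W0" "y \<in> W0" for x y
    using W0(1)[of 0 y] W0(1)[of x "0 - y"] that sub(1) by simp
  define W1 where "W1 = {w \<in> W. \<exists>c. (\<forall>k. c k \<in> G 0) \<and> w - (\<Sum>k\<in>K. s (c k) (v k)) \<in> W0}"
  have W1_diff: "x - y \<in> W1" if "x \<in> W1" "y \<in> W1" for x y
  proof -
    obtain c d where c: "x \<in> W" "\<forall>k. c k \<in> G 0" "x - (\<Sum>k\<in>K. s (c k) (v k)) \<in> W0"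
      and d: "y \<in> W" "\<forall>k. d k \<in> G 0" "y - (\<Sum>k\<in>K. s (d k) (v k)) \<in> W0" using \<open>x \<in> W1\<close> \<open>y \<in> W1\<close> by (auto simp: W1_def)
    have "x - y - (\<Sum>k\<in>K. s (c k - d k) (v k)) = (x - (\<Sum>k\<in>K. s (c k) (v k))) - (y - (\<Sum>k\<in>K. s (d k) (v k)))"
      by (simp add: s.scale_left_diff_distrib sum_subtractf)
    also have "\<dots> \<in> W0" by (rule W0(1)[OF c(3) d(3)])
    finally show "x - y \<in> W1" using c d G0 insert.prems(1) by (auto simp: W1_def intro!: exI[of _ "\<lambda>k. c k - d k"])
  qed
  have W1_scale: "s a x \<in> W1" if "a \<in> G 0" "x \<in> W1" for a x
  proof -
    obtain c where c: "x \<in> W" "\<forall>k. c k \<in> G 0" "x - (\<Sum>k\<in>K. s (c k) (v k)) \<in> W0" using \<open>x \<in> W1\<close> by (auto simp: W1_def)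
    have "s a x - (\<Sum>k\<in>K. s (a * c k) (v k)) = s a (x - (\<Sum>k\<in>K. s (c k) (v k)))"
      by (simp add: s.scale_right_diff_distrib s.scale_sum_right)
    also have "\<dots> \<in> W0" by (rule W0(2)[OF \<open>a \<in> G 0\<close> c(3)])
    finally show "s a x \<in> W1" using c \<open>a \<in> G 0\<close> G0 insert.prems(2) by (auto simp: W1_def intro!: exI[of _ "\<lambda>k. a * c k"])
  qed
  have W01: "W0 \<subseteq> W1"
  proof -
    have "w - (\<Sum>k\<in>K. s 0 (v k)) \<in> W0" if "w \<in> W0" for w using that by simp
    then show ?thesis using insert.prems(3) G0(3)[OF one_in_G one_in_G] by (force simp: W1_def)
  qed
  have "\<exists>(n::nat) g. (\<forall>b<n. g b \<in> W1) \<and>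
    (\<forall>w\<in>W1. \<exists>c. (\<forall>b. c b \<in> G 0) \<and> w - (\<Sum>b<n. s (c b) (g b)) \<in> W0) \<and>
    (\<forall>c. (\<forall>b. c b \<in> G 0) \<longrightarrow> (\<Sum>b<n. s (c b) (g b)) \<in> W0 \<longrightarrow> (\<forall>b<n. c b = 0))"
    by (rule insert.IH[OF W1_diff W1_scale W01]) (auto simp: W1_def)
  then obtain n :: nat and g where G': "(\<forall>b<n. g b \<in> W1) \<and>
    (\<forall>w\<in>W1. \<exists>c. (\<forall>b. c b \<in> G 0) \<and> w - (\<Sum>b<n. s (c b) (g b)) \<in> W0) \<and>
    (\<forall>c. (\<forall>b. c b \<in> G 0) \<longrightarrow> (\<Sum>b<n. s (c b) (g b)) \<in> W0 \<longrightarrow> (\<forall>b<n. c b = 0))"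
    by blast
  have g: "\<And>b. b < n \<Longrightarrow> g b \<in> W1"
    and gspan: "\<And>w. w \<in> W1 \<Longrightarrow> \<exists>c. (\<forall>b. c b \<in> G 0) \<and> w - (\<Sum>b<n. s (c b) (g b)) \<in> W0"
    and gind: "\<And>c b. (\<forall>b. c b \<in> G 0) \<Longrightarrow> (\<Sum>b<n. s (c b) (g b)) \<in> W0 \<Longrightarrow> b < n \<Longrightarrow> c b = 0"
    using G' by auto
  show ?case
  proof (cases "W \<subseteq> W1")
    case True
    then have "W1 = W" by (auto simp: W1_def)
    then show ?thesis using g gspan gind by blast
  next
    case False
    then obtain w where w: "w \<in> W" "w \<notin> W1" by blast
    obtain c where c: "\<forall>k. c k \<in> G 0" "w - (\<Sum>k\<in>insert k K. s (c k) (v k)) \<in> W0"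
      using insert.prems(4)[OF w(1)] by blast
    have ck: "c k \<noteq> 0"
    proof
      assume "c k = 0"
      then have "w \<in> W1" using c w(1) insert.hyps by (auto simp: W1_def)
      then show False using w(2) by blast
    qed
    obtain i where i: "i \<in> G 0" "i * c k = 1" using field[OF _ ck] c(1) by blast
    have reduce: "\<exists>a\<in>G 0. x - s a w \<in> W1" if x: "x \<in> W" for x
    proof -
      obtain d where d: "\<forall>k. d k \<in> G 0" "x - (\<Sum>k\<in>insert k K. s (d k) (v k)) \<in> W0"
        using insert.prems(4)[OF x] by blast
      let ?a = "d k * i"
      have a: "?a \<in> G 0" using d i G0 by blast
      have "x - s ?a w - (\<Sum>l\<in>insert k K. s (d l - ?a * c l) (v l))
          = (x - (\<Sum>k\<in>insert k K. s (d k) (v k))) - s ?a (w - (\<Sum>k\<in>insert k K. s (c k) (v k)))"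
        by (simp only: s.scale_left_diff_distrib sum_subtractf s.scale_right_diff_distrib s.scale_sum_right s.scale_scale)
          (simp add: algebra_simps)
      also have "\<dots> \<in> W0" by (rule W0(1)[OF d(2) W0(2)[OF a c(2)]])
      finally have "x - s ?a w - (\<Sum>l\<in>K. s (d l - ?a * c l) (v l)) \<in> W0"
        using insert.hyps i(2) by (simp add: mult.assoc)
      moreover have "\<forall>l. d l - ?a * c l \<in> G 0" using c(1) d(1) a G0 by blast
      ultimately show ?thesis using a x w insert.prems(1,2) by (auto simp: W1_def intro!: bexI[of _ ?a] exI[of _ "\<lambda>l. d l - ?a * c l"])
    qed
    let ?g = "g(n := w)"
    have sums: "(\<Sum>b<Suc n. s (d b) (?g b)) = (\<Sum>b<n. s (d b) (g b)) + s (d n) w" for d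
      by simp
    show ?thesis
    proof (intro exI[of _ "Suc n"] exI[of _ ?g] conjI allI impI ballI)
      fix b assume "b < Suc n"
      then show "?g b \<in> W" using g[of b] w(1) by (auto simp: W1_def less_Suc_eq)
    next
      fix x assume "x \<in> W"
      then obtain a where a: "a \<in> G 0" "x - s a w \<in> W1" using reduce by blast
      obtain d where d: "\<forall>b. d b \<in> G 0" "x - s a w - (\<Sum>b<n. s (d b) (g b)) \<in> W0" using gspan[OF a(2)] by blast
      have "(\<Sum>b<Suc n. s ((d(n := a)) b) (?g b)) = (\<Sum>b<n. s (d b) (g b)) + s a w" by (simp add: sums)
      then have "x - (\<Sum>b<Suc n. s ((d(n := a)) b) (?g b)) \<in> W0" using d(2) by (simp add: algebra_simps)
      moreover have "\<forall>b. (d(n := a)) b \<in> G 0" using d a by simp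
      ultimately show "\<exists>c. (\<forall>b. c b \<in> G 0) \<and> x - (\<Sum>b<Suc n. s (c b) (?g b)) \<in> W0" by blast
    next
      fix d b assume d: "\<forall>b. d b \<in> G 0" "(\<Sum>b<Suc n. s (d b) (?g b)) \<in> W0" and b: "b < Suc n"
      have dn: "d n = 0"
      proof (rule ccontr)
        assume "d n \<noteq> 0"
        then obtain a where a: "a \<in> G 0" "a * d n = 1" using field d(1) by blast
        have sm: "m \<le> n \<Longrightarrow> (\<Sum>b<m. s (d b) (g b)) \<in> W1" for m
        proof (induction m)
          case 0
          then show ?case using W01 sub(1) by auto
        next
          case (Suc m)
          have "0 \<in> W1" using W01 sub(1) by blast
          moreover have "(\<Sum>b<m. s (d b) (g b)) \<in> W1" using Suc by simp
          ultimately have "0 - (\<Sum>b<m. s (d b) (g b)) \<in> W1" by (rule W1_diff)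
          moreover have "s (d m) (g m) \<in> W1" using W1_scale g d(1) Suc.prems by simp
          ultimately have "s (d m) (g m) - (0 - (\<Sum>b<m. s (d b) (g b))) \<in> W1" by (rule W1_diff[rotated])
          then show ?case by (simp add: add.commute)
        qed
        have "(\<Sum>b<Suc n. s (d b) (?g b)) - (\<Sum>b<n. s (d b) (g b)) \<in> W1"
          using W1_diff d(2) W01 sm[OF order_refl] by blast
        then have "s (d n) w \<in> W1" unfolding sums by simp
        from W1_scale[OF a(1) this] have "w \<in> W1" using a(2) by simp
        then show False using w(2) by blast
      qed
      then have "(\<Sum>b<n. s (d b) (g b)) \<in> W0" using d(2) unfolding sums by simp
      then show "d b = 0" using gind[OF d(1)] dn b by (auto simp: less_Suc_eq)
    qed
  qed
qed

definition vscale :: "'r \<Rightarrow> (nat \<Rightarrow> 'r) \<Rightarrow> nat \<Rightarrow> 'r" where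
  "vscale = (\<lambda>a x i. a * x i)"

abbreviation free_mod :: "nat \<Rightarrow> nat \<Rightarrow> (nat \<Rightarrow> 'r set) \<Rightarrow> nat \<Rightarrow> (nat \<Rightarrow> 'r) set" where
  "free_mod n i \<equiv> dsum {..<n} (\<lambda>_. i)"

text \<open>
  A graded free resolution of \<open>k\<close> over \<open>G/I\<close>, lifted to \<open>G\<close>, in which the \<open>i\<close>-th free module has \<open>n i\<close> generators, all
  of degree \<open>i\<close>. The first module is the ring with its canonical augmentation, so exactness there concerns
  exactly the elements of positive degree.
\<close>

definition linear_resolution :: "(nat \<Rightarrow> 'r set) \<Rightarrow> (nat \<Rightarrow> nat) \<Rightarrow> (nat \<Rightarrow> nat \<Rightarrow> nat \<Rightarrow> 'r) \<Rightarrow> bool" where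
  "linear_resolution I n E \<longleftrightarrow> n 0 = 1 \<and>
    (\<forall>i. \<forall>b<n (Suc i). E i b \<in> free_mod (n i) i G (Suc i)) \<and>
    (\<forall>i. \<forall>b<n (Suc (Suc i)). lincomb (*) (E i) (E (Suc i) b) \<in> free_mod (n i) i I (Suc (Suc i))) \<and>
    (\<forall>j>0. \<forall>x\<in>free_mod (n 0) 0 G j. \<exists>y\<in>free_mod (n 1) 1 G j. x - lincomb (*) (E 0) y \<in> free_mod (n 0) 0 I j) \<and>
    (\<forall>i j. \<forall>x\<in>free_mod (n (Suc i)) (Suc i) G j. lincomb (*) (E i) x \<in> free_mod (n i) i I j \<longrightarrow>
      (\<exists>y\<in>free_mod (n (Suc (Suc i))) (Suc (Suc i)) G j. x - lincomb (*) (E (Suc i)) y \<in> free_mod (n (Suc i)) (Suc i) I j))"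

lemma gmodule_free_mod: "gmodule (*) U \<Longrightarrow> gmodule vscale (free_mod n i U)"
  unfolding vscale_def by (rule gmodule_dsum)

lemma free_low: "x \<in> free_mod n i U j \<Longrightarrow> j < i \<Longrightarrow> x = 0"
  using dsum_in'[of x "{..<n}" "\<lambda>_. i" U j] by fastforce

lemma free_span:
  assumes sp: "\<And>f. f \<in> G 1 \<Longrightarrow> \<exists>c. (\<forall>x. c x \<in> G 0) \<and> f = (\<Sum>x\<in>Y. c x * x)" and Y: "finite Y"
    and w: "w \<in> free_mod n i G (Suc i)"
  shows "\<exists>c. (\<forall>k. c k \<in> G 0) \<and> w = (\<Sum>k\<in>Y \<times> {..<n}. vscale (c k) (\<lambda>j. if j = snd k then fst k else 0))"
proof -
  have "w m \<in> G 1" if "m < n" for m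
    using dsum_in[of w "{..<n}" "\<lambda>_. i" G "Suc i" m] w that by (simp add: shift_def)
  then have "\<exists>c. (\<forall>x. c x \<in> G 0) \<and> (m < n \<longrightarrow> w m = (\<Sum>x\<in>Y. c x * x))" for m
    using sp one_in_G by (cases "m < n") (auto intro: exI[of _ "\<lambda>_. 1"])
  then obtain c where c: "\<And>m x. c m x \<in> G 0" "\<And>m. m < n \<Longrightarrow> w m = (\<Sum>x\<in>Y. c m x * x)" by metis
  let ?c = "\<lambda>k. c (snd k) (fst k)"
  have "w = (\<Sum>k\<in>Y \<times> {..<n}. vscale (?c k) (\<lambda>j. if j = snd k then fst k else 0))"
  proof
    fix j
    have "(\<Sum>k\<in>Y \<times> {..<n}. vscale (?c k) (\<lambda>j. if j = snd k then fst k else 0)) j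
        = (\<Sum>k\<in>Y \<times> {..<n}. vscale (?c k) (\<lambda>j. if j = snd k then fst k else 0) j)"
      by (induction rule: infinite_finite_induct) auto
    also have "\<dots> = (\<Sum>(x, m)\<in>Y \<times> {..<n}. if j = m then c m x * x else 0)"
      by (rule sum.cong) (auto simp: vscale_def)
    also have "\<dots> = (\<Sum>x\<in>Y. \<Sum>m<n. if j = m then c m x * x else 0)"
      by (rule sum.cartesian_product[symmetric])
    also have "\<dots> = (if j < n then (\<Sum>x\<in>Y. c j x * x) else 0)" by simp
    also have "\<dots> = w j" using c(2)[of j] dsum_zero[of w "{..<n}" "\<lambda>_. i" G "Suc i" j] w by auto
    finally show "w j = (\<Sum>k\<in>Y \<times> {..<n}. vscale (?c k) (\<lambda>j. if j = snd k then fst k else 0)) j" by simp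
  qed
  then show ?thesis using c(1) by (intro exI[of _ ?c]) simp
qed

end

context residue_resolution
begin

lemma tor_zero_shift: "tor_zero s U V q j \<Longrightarrow> tor_zero s (shift c U) (shift c V) q (j + c)"
  by (simp add: tor_zero_def cycle_def dsum_shift)

lemma lincomb_coordinate: "x \<in> tens q U j \<Longrightarrow> lincomb vscale N x c m = lincomb (*) N (\<lambda>b. x b m) c"
  using lincomb_commute[where f = "\<lambda>u. u m" and s = vscale and s' = "(*)" and x = x and N = N, OF _ _ module_mult dsum_finite]
  by (auto simp: vscale_def additive_def)

text \<open>
  \<open>Tor\<close> of a finite direct sum is computed coordinate by coordinate.
\<close>

lemma tor_zero_dsum:
  assumes C: "finite C" and U: "gmodule (*) U" and V: "gmodule (*) V"
    and v: "\<And>m. m \<in> C \<Longrightarrow> tor_zero (*) (shift (f m) U) (shift (f m) V) q j"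
  shows "tor_zero vscale (dsum C f U) (dsum C f V) q j"
  unfolding tor_zero_def
proof (intro ballI impI)
  fix x assume x: "x \<in> tens q (dsum C f U) j" and cx: "cycle vscale (dsum C f V) q j x"
  have comp: "(\<lambda>b. y b m) \<in> tens k (shift (f m) W) j" if "y \<in> tens k (dsum C f W) j" "m \<in> C" "graded_group W" for y k W m
    using dsum_map[OF that(1), of "\<lambda>u. u m" "shift (f m) W" 0, OF _ _ graded_group_shift[OF that(3)]]
      dsum_in[of _ C f W _ m] that(2) by simp
  have glue: "y \<in> tens k (dsum C f W) j"
    if "\<And>m. m \<in> C \<Longrightarrow> (\<lambda>b. y b m) \<in> tens k (shift (f m) W) j" "\<And>b m. m \<notin> C \<Longrightarrow> y b m = 0" "graded_group W" for y k W
  proof -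
    have "{b. y b \<noteq> 0} \<subseteq> (\<Union>m\<in>C. {b. y b m \<noteq> 0})"
    proof
      fix b assume "b \<in> {b. y b \<noteq> 0}"
      then obtain m where "y b m \<noteq> 0" by (auto simp: fun_eq_iff)
      then show "b \<in> (\<Union>m\<in>C. {b. y b m \<noteq> 0})" using that(2) by blast
    qed
    then have "finite {b. y b \<noteq> 0}"
      using C dsum_finite[OF that(1)] by (meson finite_UN finite_subset)
    moreover have "y b = 0" if "b \<notin> B k" for b
    proof
      fix m show "y b m = 0 m"
        using dsum_zero[OF \<open>\<And>m. m \<in> C \<Longrightarrow> (\<lambda>b. y b m) \<in> tens k (shift (f m) W) j\<close> that] \<open>\<And>b m. m \<notin> C \<Longrightarrow> y b m = 0\<close>
        by (cases "m \<in> C") auto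
    qed
    moreover have "y b \<in> shift (e k b) (dsum C f W) j" if "b \<in> B k" for b
    proof -
      have m: "y b m \<in> shift (e k b) (shift (f m) W) j" if "m \<in> C" for m
        using dsum_in[OF \<open>\<And>m. m \<in> C \<Longrightarrow> (\<lambda>b. y b m) \<in> tens k (shift (f m) W) j\<close>[OF that] \<open>b \<in> B k\<close>] .
      show ?thesis
      proof (cases "e k b \<le> j")
        case True
        have "finite {m. y b m \<noteq> 0}" by (rule finite_subset[OF _ C]) (use that(1) \<open>\<And>b m. m \<notin> C \<Longrightarrow> y b m = 0\<close> in auto)
        then show ?thesis using m True \<open>\<And>b m. m \<notin> C \<Longrightarrow> y b m = 0\<close> by (auto simp: shift_def[of "e k b"] dsum_def)
      next
        case False
        have "y b = 0"
        proof
          fix n show "y b n = 0 n"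
            using m[of n] False \<open>\<And>b m. m \<notin> C \<Longrightarrow> y b m = 0\<close> by (cases "n \<in> C") (auto simp: shift_def)
        qed
        then show ?thesis using False by (simp add: shift_def)
      qed
    qed
    ultimately show ?thesis by (auto simp: dsum_def[of "B k"])
  qed
  have out: "y b m = 0" if "y \<in> tens k (dsum C f W) j" "m \<notin> C" for y k b m and W :: "nat \<Rightarrow> 'r set"
    using dsum_in'[OF that(1), of b] dsum_zero[of "y b" C f W _ m] that(2) by (cases "y b = 0") auto
  have U2: "gmodule vscale (dsum C f U)" unfolding vscale_def by (rule gmodule_dsum[OF U])
  have "\<exists>y. y \<in> tens (Suc q) (shift (f m) U) j \<and> (\<lambda>b. x b m) - lincomb (*) (D q) y \<in> tens q (shift (f m) V) j"
    if m: "m \<in> C" for m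
  proof -
    have "cycle (*) (shift (f m) V) q j (\<lambda>b. x b m)"
      unfolding cycle_def
    proof (intro allI impI)
      fix l assume "q = Suc l"
      then have "lincomb vscale (D l) x \<in> tens l (dsum C f V) j" using cx by (simp add: cycle_def)
      from comp[OF this m gmodule_group[OF V]] show "lincomb (*) (D l) (\<lambda>b. x b m) \<in> tens l (shift (f m) V) j"
        using lincomb_coordinate[OF x, of "D l"] by simp
    qed
    from tor_zeroE[OF v[OF m] comp[OF x m gmodule_group[OF U]] this] show ?thesis by blast
  qed
  then obtain y where y: "\<And>m. m \<in> C \<Longrightarrow> y m \<in> tens (Suc q) (shift (f m) U) j"
    "\<And>m. m \<in> C \<Longrightarrow> (\<lambda>b. x b m) - lincomb (*) (D q) (y m) \<in> tens q (shift (f m) V) j" by metis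
  let ?y = "\<lambda>b m. if m \<in> C then y m b else 0"
  have y1: "?y \<in> tens (Suc q) (dsum C f U) j"
    by (rule glue) (use y(1) gmodule_group[OF U] in auto)
  have dy: "lincomb vscale (D q) ?y \<in> tens q (dsum C f U) j" by (rule d_in[OF U2 y1])
  have "x - lincomb vscale (D q) ?y \<in> tens q (dsum C f V) j"
  proof (rule glue[OF _ _ gmodule_group[OF V]])
    fix m assume "m \<in> C"
    then have "(\<lambda>b. (x - lincomb vscale (D q) ?y) b m) = (\<lambda>b. x b m) - lincomb (*) (D q) (y m)"
      using lincomb_coordinate[OF y1, of "D q"] by auto
    then show "(\<lambda>b. (x - lincomb vscale (D q) ?y) b m) \<in> tens q (shift (f m) V) j" using y(2)[OF \<open>m \<in> C\<close>] by simp
  next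
    fix b m assume "m \<notin> C"
    then show "(x - lincomb vscale (D q) ?y) b m = 0" using out[OF x] out[OF dy] by simp
  qed
  then show "\<exists>y\<in>tens (Suc q) (dsum C f U) j. x - lincomb vscale (D q) y \<in> tens q (dsum C f V) j" using y1 by blast
qed

lemma subquot_dsum:
  assumes q: "subquot (*) U V" shows "subquot vscale (dsum C f U) (dsum C f V)"
  unfolding subquot_def
proof (intro conjI allI ballI)
  show "gmodule vscale (dsum C f U)" "gmodule vscale (dsum C f V)"
    unfolding vscale_def by (intro gmodule_dsum subquotD[OF q])+
  show "dsum C f V j \<subseteq> dsum C f U j" for j
    by (rule dsum_mono) (rule subquotD(4)[OF q])
  fix p j a u assume a: "a \<in> I p" and u: "u \<in> dsum C f U j"
  have "(\<lambda>b. a * u b) \<in> dsum C f V (j + p)"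
    by (rule dsum_map[OF u]) (use subquotD(5)[OF q a] gmodule_group[OF subquotD(3)[OF q]] in \<open>auto simp: add.commute\<close>)
  then show "vscale a u \<in> dsum C f V (p + j)" by (simp add: vscale_def add.commute)
qed

text \<open>
  The invariant of the construction. In the free module with \<open>n\<close> generators of degree \<open>i\<close>, the submodule \<open>Z\<close> consists
  of the relations between the generators of the \<open>i\<close>-th syzygy module of \<open>k\<close> over \<open>G/I'\<close>. There is no relation in
  degree \<open>i\<close>, as the generators are minimal; and the \<open>i\<close>-th syzygy module, which is the free module modulo \<open>Z\<close>, has
  its \<open>Tor\<^sub>q\<close> over \<open>G/I\<close> in degrees at most \<open>q + i\<close>.
\<close>

definition syzygy_inv :: "(nat \<Rightarrow> 'r set) \<Rightarrow> nat \<Rightarrow> nat \<Rightarrow> (nat \<Rightarrow> (nat \<Rightarrow> 'r) set) \<Rightarrow> bool" where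
  "syzygy_inv I' i n Z \<longleftrightarrow> gmodule vscale Z \<and> (\<forall>j. Z j \<subseteq> free_mod n i G j) \<and> (\<forall>j. free_mod n i I' j \<subseteq> Z j) \<and> Z i \<subseteq> {0} \<and>
    (\<forall>q j. q + i < j \<longrightarrow> tor_zero vscale (free_mod n i G) Z q j)"

text \<open>
  The long exact sequence moves the bound for the quotient by \<open>Z\<close> and the bound for \<open>G/I'\<close> to \<open>Z\<close> modulo \<open>I'\<close>.
  For \<open>q = 0\<close> this bound says that \<open>Z\<close> is generated in degree \<open>Suc i\<close>, since it has no elements of degree at most \<open>i\<close>.
  A basis \<open>E\<close> of its part of that degree generates it minimally, and the relations of \<open>E\<close> inherit the bound, because
  the free module on \<open>E\<close> modulo its relations is isomorphic to \<open>Z\<close> modulo \<open>I'\<close>.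
\<close>

lemma syzygy_step:
  assumes I': "gmodule (*) I'" and II': "\<And>j. I j \<subseteq> I' j" and I'G: "\<And>j. I' j \<subseteq> G j"
    and reg: "\<And>q j. q + 1 < j \<Longrightarrow> tor_zero (*) G I' q j"
    and field: "\<And>a. a \<in> G 0 \<Longrightarrow> a \<noteq> 0 \<Longrightarrow> \<exists>b\<in>G 0. b * a = 1"
    and Y: "finite Y" "\<And>f. f \<in> G 1 \<Longrightarrow> \<exists>c. (\<forall>x. c x \<in> G 0) \<and> f = (\<Sum>x\<in>Y. c x * x)"
    and inv: "syzygy_inv I' i n Z"
  shows "\<exists>n' E Z'. syzygy_inv I' (Suc i) n' Z' \<and> (\<forall>b<n'. E b \<in> Z (Suc i)) \<and>
    (\<forall>j. \<forall>z\<in>Z j. \<exists>y\<in>free_mod n' (Suc i) G j. z - lincomb (*) E y \<in> free_mod n i I' j) \<and>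
    Z' = (\<lambda>j. {y \<in> free_mod n' (Suc i) G j. lincomb (*) E y \<in> free_mod n i I' j})"
proof -
  note m = module_mult
  define L where "L = free_mod n i G"
  define LI where "LI = free_mod n i I'"
  have Z: "gmodule vscale Z" and ZL: "\<And>j. Z j \<subseteq> L j" and LIZ: "\<And>j. LI j \<subseteq> Z j" and Zi: "Z i \<subseteq> {0}"
    and vZ: "\<And>q j. q + i < j \<Longrightarrow> tor_zero vscale L Z q j"
    using inv by (auto simp: syzygy_inv_def L_def LI_def)
  have qL: "subquot vscale L LI"
    unfolding L_def LI_def by (rule subquot_dsum[OF subquot_ideal[OF I' II' I'G]])
  have LI: "gmodule vscale LI" by (rule subquotD(3)[OF qL])
  have gLI: "graded_group LI" by (rule gmodule_group[OF LI])
  have ms: "Modules.module vscale" by (rule subquotD(1)[OF qL])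
  have vL: "tor_zero vscale L LI q j" if "q + i + 1 < j" for q j
    unfolding L_def LI_def
  proof (rule tor_zero_dsum[OF _ gmodule_G I'])
    show "tor_zero (*) (shift i G) (shift i I') q j"
      using tor_zero_shift[OF reg[of q "j - i"], of i] that by simp
  qed simp
  have vZL: "tor_zero vscale Z LI q j" if "q + i + 1 < j" for q j
    by (rule tor_zero_sub[OF qL Z LIZ ZL vL[OF that]]) (use vZ[of "Suc q" j] that in simp)
  have qZ: "subquot vscale Z LI"
    using qL Z LIZ ZL unfolding subquot_def by blast
  have "\<exists>(n'::nat) g. (\<forall>b<n'. g b \<in> Z (Suc i)) \<and>
      (\<forall>w\<in>Z (Suc i). \<exists>c. (\<forall>b. c b \<in> G 0) \<and> w - (\<Sum>b<n'. vscale (c b) (g b)) \<in> LI (Suc i)) \<and>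
      (\<forall>c. (\<forall>b. c b \<in> G 0) \<longrightarrow> (\<Sum>b<n'. vscale (c b) (g b)) \<in> LI (Suc i) \<longrightarrow> (\<forall>b<n'. c b = 0))"
  proof (rule basis_modulo_subspace[OF field ms, where K = "Y \<times> {..<n}" and v = "\<lambda>k j. if j = snd k then fst k else 0"])
    fix w assume "w \<in> Z (Suc i)"
    then have "w \<in> free_mod n i G (Suc i)" using ZL unfolding L_def by blast
    then obtain c where "\<forall>k. c k \<in> G 0"
      "w = (\<Sum>k\<in>Y \<times> {..<n}. vscale (c k) (\<lambda>j. if j = snd k then fst k else 0))"
      using free_span[OF Y(2,1)] by blast
    then show "\<exists>c. (\<forall>k. c k \<in> G 0) \<and>
        w - (\<Sum>k\<in>Y \<times> {..<n}. vscale (c k) (\<lambda>j. if j = snd k then fst k else 0)) \<in> LI (Suc i)"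
      by (intro exI[of _ c]) (use graded_group_0[OF gLI] in \<open>simp del: sum.cartesian_product\<close>)
  qed (use Y(1) LIZ graded_group_diff[OF gLI] graded_group_diff[OF gmodule_group[OF Z]] graded_group_0[OF gLI]
      gmodule_mult[OF LI, of _ 0] gmodule_mult[OF Z, of _ 0] in auto)
  then obtain n' :: nat and E where E': "(\<forall>b<n'. E b \<in> Z (Suc i)) \<and>
      (\<forall>w\<in>Z (Suc i). \<exists>c. (\<forall>b. c b \<in> G 0) \<and> w - (\<Sum>b<n'. vscale (c b) (E b)) \<in> LI (Suc i)) \<and>
      (\<forall>c. (\<forall>b. c b \<in> G 0) \<longrightarrow> (\<Sum>b<n'. vscale (c b) (E b)) \<in> LI (Suc i) \<longrightarrow> (\<forall>b<n'. c b = 0))"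
    by blast
  have E: "\<And>b. b < n' \<Longrightarrow> E b \<in> Z (Suc i)"
    and Espan: "\<And>w. w \<in> Z (Suc i) \<Longrightarrow> \<exists>c. (\<forall>b. c b \<in> G 0) \<and> w - (\<Sum>b<n'. vscale (c b) (E b)) \<in> LI (Suc i)"
    and Eind: "\<And>c b. (\<forall>b. c b \<in> G 0) \<Longrightarrow> (\<Sum>b<n'. vscale (c b) (E b)) \<in> LI (Suc i) \<Longrightarrow> b < n' \<Longrightarrow> c b = 0"
    using E' by auto
  define L' where "L' = free_mod n' (Suc i) G"
  have L': "gmodule vscale L'" unfolding L'_def by (rule gmodule_free_mod[OF gmodule_G])
  \<comment> \<open>Unlike \<open>lincomb\<close>, the finite sum \<open>f\<close> is additive on all functions, also on those of infinite support.\<close>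
  define f where "f y = (\<Sum>b<n'. vscale (y b) (E b))" for y
  interpret s: Modules.module vscale by (rule ms)
  have f_add: "Modules.additive f"
    by unfold_locales (simp add: f_def s.scale_left_distrib sum.distrib)
  have f_scale: "f (vscale a y) = vscale a (f y)" for a y
  proof -
    have "vscale (vscale a y b) (E b) = vscale a (vscale (y b) (E b))" for b
      by (simp add: vscale_def mult.assoc)
    then show ?thesis by (simp add: f_def s.scale_sum_right)
  qed
  have f_app: "lincomb (*) E y = f y" if "y \<in> L' j" for y j
  proof
    fix c
    have "{b. y b \<noteq> 0} \<subseteq> {..<n'}" using dsum_zero[of y "{..<n'}"] that unfolding L'_def by blast
    then have "lincomb (*) E y c = (\<Sum>b<n'. E b c * y b)" by (intro lincomb_superset[OF m]) auto
    moreover have "f y c = (\<Sum>b<n'. vscale (y b) (E b) c)"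
      unfolding f_def by (induction rule: infinite_finite_induct) auto
    ultimately show "lincomb (*) E y c = f y c" by (simp add: vscale_def mult.commute)
  qed
  have f_in: "f y \<in> W j" if y: "y \<in> free_mod n' (Suc i) U j" and W: "graded_group W"
    and mult: "\<And>p a b. a \<in> U p \<Longrightarrow> b < n' \<Longrightarrow> vscale a (E b) \<in> W (p + Suc i)" for y j U and W :: "nat \<Rightarrow> (nat \<Rightarrow> 'r) set"
    unfolding f_def
  proof (rule graded_group_sum[OF W])
    fix b assume b: "b \<in> {..<n'}"
    show "vscale (y b) (E b) \<in> W j"
    proof (cases "y b = 0")
      case True
      then show ?thesis using graded_group_0[OF W] by simp
    next
      case False
      then show ?thesis using dsum_in'[of y "{..<n'}" "\<lambda>_. Suc i" U j b] y mult[of "y b" "j - Suc i" b] b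
        by simp
    qed
  qed
  have fZ: "f y \<in> Z j" if "y \<in> L' j" for y j
    by (rule f_in[OF that[unfolded L'_def] gmodule_group[OF Z] gmodule_mult[OF Z _ E]])
  define W where "W j = {z \<in> L j. \<exists>y\<in>L' j. z - f y \<in> LI j}" for j
  have L: "gmodule vscale L" by (rule subquotD(2)[OF qL])
  have W: "graded_group W"
    unfolding graded_group_def
  proof (intro allI conjI ballI)
    fix j
    show "0 \<in> W j" using graded_group_0[OF gmodule_group[OF L]] graded_group_0[OF gmodule_group[OF L']] graded_group_0[OF gLI]
      additive.zero[OF f_add] by (auto simp: W_def intro!: bexI[of _ 0])
    fix x y assume "x \<in> W j" "y \<in> W j"
    then obtain x' y' where x: "x \<in> L j" "x' \<in> L' j" "x - f x' \<in> LI j" and y: "y \<in> L j" "y' \<in> L' j" "y - f y' \<in> LI j"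
      by (auto simp: W_def)
    have "(x - y) - f (x' - y') = (x - f x') - (y - f y')" by (simp add: additive.diff[OF f_add])
    also have "\<dots> \<in> LI j" by (rule graded_group_diff[OF gLI x(3) y(3)])
    finally show "x - y \<in> W j"
      using graded_group_diff[OF gmodule_group[OF L] x(1) y(1)] graded_group_diff[OF gmodule_group[OF L'] x(2) y(2)]
      unfolding W_def by blast
  qed
  have W_scale: "vscale a z \<in> W (p + j)" if "a \<in> G p" "z \<in> W j" for a z p j
  proof -
    obtain y where y: "z \<in> L j" "y \<in> L' j" "z - f y \<in> LI j" using \<open>z \<in> W j\<close> by (auto simp: W_def)
    have "vscale a z - f (vscale a y) = vscale a (z - f y)" by (simp only: f_scale s.scale_right_diff_distrib)
    also have "\<dots> \<in> LI (p + j)" by (rule gmodule_mult[OF LI that(1) y(3)])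
    finally show ?thesis using gmodule_mult[OF L that(1) y(1)] gmodule_mult[OF L' that(1) y(2)] unfolding W_def by blast
  qed
  have ZW: "z \<in> W j" if "z \<in> Z j" for z j
    using that
  proof (induction j arbitrary: z rule: less_induct)
    case (less j)
    consider "j \<le> i" | "j = Suc i" | "Suc i < j" by linarith
    then show ?case
    proof cases
      case 1
      then have "z = 0" using Zi less.prems free_low[of z n i G j] ZL unfolding L_def by (cases "j = i") auto
      then show ?thesis using graded_group_0[OF W] by (simp only:)
    next
      case 2
      obtain c where c: "\<forall>b. c b \<in> G 0" "z - (\<Sum>b<n'. vscale (c b) (E b)) \<in> LI (Suc i)"
        using Espan less.prems 2 by blast
      let ?y = "\<lambda>b. if b < n' then c b else 0"
      have "?y \<in> L' (Suc i)" using c(1) by (auto simp: L'_def dsum_def shift_def)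
      moreover have "f ?y = (\<Sum>b<n'. vscale (c b) (E b))" by (simp add: f_def)
      ultimately show ?thesis using c(2) less.prems 2 ZL unfolding W_def by (auto intro!: bexI[of _ ?y])
    next
      case 3
      show ?thesis
      proof (rule generated_by_lower_degrees[OF qZ vZL less.prems W])
        show "LI j \<subseteq> W j"
        proof
          fix x assume "x \<in> LI j"
          then have "x \<in> L j" "x - f 0 \<in> LI j" using LIZ ZL additive.zero[OF f_add] by auto
          then show "x \<in> W j" using graded_group_0[OF gmodule_group[OF L']] unfolding W_def by blast
        qed
        fix p a u assume "0 < p" "p \<le> j" "a \<in> G p" "u \<in> Z (j - p)"
        then show "vscale a u \<in> W j" using W_scale[of a p u "j - p"] less.IH[of "j - p" u] by simp
      qed (use 3 in simp)
    qed
  qed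
  define Z' where "Z' j = {y \<in> L' j. f y \<in> LI j}" for j
  have Z': "gmodule vscale Z'"
    unfolding gmodule_def graded_group_def
  proof (intro conjI allI ballI ms)
    show "0 \<in> Z' j" for j using graded_group_0[OF gmodule_group[OF L']] graded_group_0[OF gLI] additive.zero[OF f_add]
      by (simp add: Z'_def)
    show "x - y \<in> Z' j" if "x \<in> Z' j" "y \<in> Z' j" for x y j
      using that graded_group_diff[OF gmodule_group[OF L']] graded_group_diff[OF gLI] additive.diff[OF f_add]
      by (simp add: Z'_def)
    show "vscale a u \<in> Z' (p + q)" if "a \<in> G p" "u \<in> Z' q" for a u p q
      using that gmodule_mult[OF L'] gmodule_mult[OF LI] f_scale by (simp add: Z'_def)
  qed
  have "syzygy_inv I' (Suc i) n' Z'"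
    unfolding syzygy_inv_def
  proof (intro conjI allI impI Z')
    show "Z' j \<subseteq> free_mod n' (Suc i) G j" for j by (auto simp: Z'_def L'_def)
    show "free_mod n' (Suc i) I' j \<subseteq> Z' j" for j
    proof
      fix y assume y: "y \<in> free_mod n' (Suc i) I' j"
      have "vscale a (E b) \<in> LI (p + Suc i)" if "a \<in> I' p" "b < n'" for a b p
      proof -
        have Eb: "E b \<in> dsum {..<n} (\<lambda>_. i) G (Suc i)"
          using ZL E[OF that(2)] by (auto simp: L_def)
        have "(\<lambda>c. a * E b c) \<in> dsum {..<n} (\<lambda>_. i) I' (Suc i + p)"
          by (rule dsum_map[OF Eb]) (use gmodule_mult[OF I' _ \<open>a \<in> I' p\<close>] gmodule_group[OF I'] in \<open>auto simp: mult.commute\<close>)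
        then show ?thesis by (simp add: LI_def vscale_def add.commute)
      qed
      then have "f y \<in> LI j" by (rule f_in[OF y gLI])
      moreover have "y \<in> L' j" using y dsum_mono[where U = I' and W = G, OF I'G] unfolding L'_def by blast
      ultimately show "y \<in> Z' j" by (simp add: Z'_def)
    qed
    show "Z' (Suc i) \<subseteq> {0}"
    proof
      fix y assume "y \<in> Z' (Suc i)"
      then have y: "y \<in> dsum {..<n'} (\<lambda>_. Suc i) G (Suc i)" "f y \<in> LI (Suc i)" by (auto simp: Z'_def L'_def)
      have "y b \<in> G 0" for b
        using dsum_in[OF y(1), of b] dsum_zero[OF y(1), of b] graded_group_0[OF graded_group_G]
        by (cases "b < n'") (auto simp: shift_def)
      then have "y b = 0" for b using Eind[of y b] y(2) dsum_zero[OF y(1), of b] by (cases "b < n'") (auto simp: f_def)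
      then show "y \<in> {0}" by auto
    qed
    show "tor_zero vscale (free_mod n' (Suc i) G) Z' q j" if "q + Suc i < j" for q j
      unfolding L'_def[symmetric]
    proof (rule tor_zero_iso[where f = f and U = Z and V = LI and s = vscale])
      show "gmodule vscale Z" "gmodule vscale LI" "gmodule vscale L'" "Modules.additive f" by fact+
      show "graded_group Z'" by (rule gmodule_group[OF Z'])
      show "Z' j \<subseteq> L' j" for j by (auto simp: Z'_def)
      show "f (vscale a u) = vscale a (f u)" for a u by (rule f_scale)
      show "f u \<in> Z j" if "u \<in> L' j" for u j using that by (rule fZ)
      show "\<exists>u'\<in>L' j. u - f u' \<in> LI j" if "u \<in> Z j" for u j using ZW[OF that] by (auto simp: W_def)
      show "f u \<in> LI j \<longleftrightarrow> u \<in> Z' j" if "u \<in> L' j" for u j using that by (simp add: Z'_def)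
      show "tor_zero vscale Z LI q j" using vZL that by simp
    qed
  qed
  moreover have "\<exists>y\<in>L' j. z - lincomb (*) E y \<in> LI j" if "z \<in> Z j" for z j
    using ZW[OF that] f_app by (auto simp: W_def)
  moreover have "Z' = (\<lambda>j. {y \<in> L' j. lincomb (*) E y \<in> LI j})"
  proof
    fix j show "Z' j = {y \<in> L' j. lincomb (*) E y \<in> LI j}"
      unfolding Z'_def using f_app by (intro Collect_cong conj_cong) simp_all
  qed
  ultimately show ?thesis using E unfolding L'_def LI_def by blast
qed

text \<open>
  The construction starts with the ring itself and with the irrelevant ideal as the module of relations.
\<close>

theorem linear_resolution_exists:
  assumes I': "gmodule (*) I'" and II': "\<And>j. I j \<subseteq> I' j" and I'm: "\<And>j. I' j \<subseteq> irr j"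
    and reg: "\<And>q j. q + 1 < j \<Longrightarrow> tor_zero (*) G I' q j"
    and lin: "\<And>q j. q < j \<Longrightarrow> tor_zero (*) G irr q j"
    and field: "\<And>a. a \<in> G 0 \<Longrightarrow> a \<noteq> 0 \<Longrightarrow> \<exists>b\<in>G 0. b * a = 1"
    and Y: "finite Y" "\<And>f. f \<in> G 1 \<Longrightarrow> \<exists>c. (\<forall>x. c x \<in> G 0) \<and> f = (\<Sum>x\<in>Y. c x * x)"
  shows "\<exists>n E. linear_resolution I' n E"
proof -
  have I'G: "\<And>j. I' j \<subseteq> G j" using I'm irr_sub by blast
  define ok where "ok i = (\<lambda>(n, Z). syzygy_inv I' i n Z \<and> (i = 0 \<longrightarrow> n = 1 \<and> Z = free_mod 1 0 irr))" for i
  define step where "step i = (\<lambda>(n, Z) (n', Z'). \<exists>E. (\<forall>b<n'. E b \<in> Z (Suc i)) \<and>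
    (\<forall>j. \<forall>z\<in>Z j. \<exists>y\<in>free_mod n' (Suc i) G j. z - lincomb (*) E y \<in> free_mod n i I' j) \<and>
    Z' = (\<lambda>j. {y \<in> free_mod n' (Suc i) G j. lincomb (*) E y \<in> free_mod n i I' j}))" for i
  have "\<exists>F. \<forall>i. ok i (F i) \<and> step i (F i) (F (Suc i))"
  proof (rule dependent_nat_choice)
    have "syzygy_inv I' 0 1 (free_mod 1 0 irr)"
      unfolding syzygy_inv_def
    proof (intro conjI allI impI)
      show "gmodule vscale (free_mod 1 0 irr)" by (rule gmodule_free_mod[OF gmodule_irr])
      show "free_mod 1 0 irr j \<subseteq> free_mod 1 0 G j" for j by (rule dsum_mono) (rule irr_sub)
      show "free_mod 1 0 I' j \<subseteq> free_mod 1 0 irr j" for j by (rule dsum_mono) (rule I'm)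
      show "free_mod 1 0 irr 0 \<subseteq> {0}"
      proof
        fix x assume "x \<in> free_mod 1 0 irr 0"
        then have "x b = 0" for b by (cases "b = 0") (auto simp: dsum_def irr_def)
        then show "x \<in> {0}" by auto
      qed
      show "tor_zero vscale (free_mod 1 0 G) (free_mod 1 0 irr) q j" if "q + 0 < j" for q j
        by (rule tor_zero_dsum[OF _ gmodule_G gmodule_irr]) (use lin that in simp_all)
    qed
    then show "\<exists>x. ok 0 x" by (auto simp: ok_def)
  next
    fix F i assume "ok i F"
    then obtain n Z where F: "F = (n, Z)" "syzygy_inv I' i n Z" by (cases F) (auto simp: ok_def)
    from syzygy_step[OF I' II' I'G reg field Y F(2)]
    show "\<exists>F'. ok (Suc i) F' \<and> step i F F'"
      unfolding F(1) ok_def step_def by fast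
  qed
  then obtain F where F: "\<And>i. ok i (F i)" "\<And>i. step i (F i) (F (Suc i))" by blast
  define n where "n i = fst (F i)" for i
  define Z where "Z i = snd (F i)" for i
  have inv: "syzygy_inv I' i (n i) (Z i)" for i using F(1)[of i] by (auto simp: ok_def n_def Z_def)
  have n0: "n 0 = 1" "Z 0 = free_mod 1 0 irr" using F(1)[of 0] by (auto simp: ok_def n_def Z_def)
  have "\<forall>i. \<exists>E. (\<forall>b<n (Suc i). E b \<in> Z i (Suc i)) \<and>
    (\<forall>j. \<forall>z\<in>Z i j. \<exists>y\<in>free_mod (n (Suc i)) (Suc i) G j. z - lincomb (*) E y \<in> free_mod (n i) i I' j) \<and>
    Z (Suc i) = (\<lambda>j. {y \<in> free_mod (n (Suc i)) (Suc i) G j. lincomb (*) E y \<in> free_mod (n i) i I' j})"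
    using F(2) unfolding step_def n_def Z_def by (simp add: case_prod_beta)
  from choice[OF this] obtain E where E': "\<forall>i. (\<forall>b<n (Suc i). E i b \<in> Z i (Suc i)) \<and>
    (\<forall>j. \<forall>z\<in>Z i j. \<exists>y\<in>free_mod (n (Suc i)) (Suc i) G j. z - lincomb (*) (E i) y \<in> free_mod (n i) i I' j) \<and>
    Z (Suc i) = (\<lambda>j. {y \<in> free_mod (n (Suc i)) (Suc i) G j. lincomb (*) (E i) y \<in> free_mod (n i) i I' j})" ..
  have E: "\<And>i b. b < n (Suc i) \<Longrightarrow> E i b \<in> Z i (Suc i)"
    and ex: "\<And>i j z. z \<in> Z i j \<Longrightarrow> \<exists>y\<in>free_mod (n (Suc i)) (Suc i) G j. z - lincomb (*) (E i) y \<in> free_mod (n i) i I' j"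
    and Z: "\<And>i. Z (Suc i) = (\<lambda>j. {y \<in> free_mod (n (Suc i)) (Suc i) G j. lincomb (*) (E i) y \<in> free_mod (n i) i I' j})"
    using E' by blast+
  have "linear_resolution I' n E"
    unfolding linear_resolution_def
  proof (intro conjI allI impI ballI)
    show "n 0 = 1" by (rule n0)
    show "E i b \<in> free_mod (n i) i G (Suc i)" if "b < n (Suc i)" for i b
      using E[OF that] inv[of i] by (auto simp: syzygy_inv_def)
    show "lincomb (*) (E i) (E (Suc i) b) \<in> free_mod (n i) i I' (Suc (Suc i))" if "b < n (Suc (Suc i))" for i b
      using E[OF that] unfolding Z by simp
    show "\<exists>y\<in>free_mod (n 1) 1 G j. x - lincomb (*) (E 0) y \<in> free_mod (n 0) 0 I' j" if "0 < j" "x \<in> free_mod (n 0) 0 G j" for j x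
    proof -
      have "x \<in> Z 0 j" using that n0 by (simp add: dsum_def irr_def)
      then show ?thesis using ex by simp
    qed
    show "\<exists>y\<in>free_mod (n (Suc (Suc i))) (Suc (Suc i)) G j. x - lincomb (*) (E (Suc i)) y \<in> free_mod (n (Suc i)) (Suc i) I' j"
      if "x \<in> free_mod (n (Suc i)) (Suc i) G j" "lincomb (*) (E i) x \<in> free_mod (n i) i I' j" for i j x
    proof -
      have "x \<in> Z (Suc i) j" using that Z by simp
      then show ?thesis by (rule ex)
    qed
  qed
  then show ?thesis by blast
qed

end

section \<open>Resolutions over a quotient ring as matrices\<close>

text \<open>
  The algebraic library treats a ring as a record with a carrier, so the quotient rings in the definition of
  Koszul algebras are described here by classes of elements of the type.
\<close>

abbreviation type_ring :: "'r::comm_ring_1 ring" where "type_ring \<equiv> ring_of_type_algebra"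

lemma type_ring_simps: "carrier type_ring = UNIV" "x \<otimes>\<^bsub>type_ring\<^esub> y = x * y" "x \<oplus>\<^bsub>type_ring\<^esub> y = x + y" "\<zero>\<^bsub>type_ring\<^esub> = 0" "\<one>\<^bsub>type_ring\<^esub> = 1"
  by (simp_all add: ring_of_type_algebra_def)

lemma type_ring_minus: "\<ominus>\<^bsub>type_ring\<^esub> f = - f"
proof -
  interpret r: ring type_ring by (rule ring_from_type_algebra)
  show ?thesis by (rule r.minus_equality) (simp_all add: type_ring_simps)
qed

lemma type_ring_ideal:
  fixes J :: "'r::comm_ring_1 set"
  assumes "0 \<in> J" "\<And>f g. f \<in> J \<Longrightarrow> g \<in> J \<Longrightarrow> f - g \<in> J" "\<And>a f. f \<in> J \<Longrightarrow> a * f \<in> J"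
  shows "ideal J type_ring"
proof (rule idealI)
  show "ring type_ring" by (rule ring_from_type_algebra)
  have add: "f + g \<in> J" if "f \<in> J" "g \<in> J" for f g
    using assms(2)[OF that(1) assms(2)[OF assms(1) that(2)]] by simp
  show "subgroup J (add_monoid type_ring)"
  proof
    show "inv\<^bsub>add_monoid type_ring\<^esub> x \<in> J" if "x \<in> J" for x
      using type_ring_minus[of x] assms(2)[OF assms(1) that] by (simp add: a_inv_def)
  qed (use assms(1) add in \<open>auto simp: type_ring_simps\<close>)
  show "x \<otimes>\<^bsub>type_ring\<^esub> a \<in> J" "a \<otimes>\<^bsub>type_ring\<^esub> x \<in> J" if "a \<in> J" "x \<in> carrier type_ring" for a x
    using assms(3)[OF that(1), of x] by (simp_all add: type_ring_simps mult.commute)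
qed

text \<open>
  Inhomogeneous elements enter only through the definition of a resolution over the quotient ring; they
  are split into homogeneous components.
\<close>

locale graded_components = graded_ring G for G :: "nat \<Rightarrow> 'r::comm_ring_1 set" +
  fixes comp :: "nat \<Rightarrow> 'r \<Rightarrow> 'r"
  assumes comp_in: "comp d f \<in> G d"
    and comp_hom: "f \<in> G d \<Longrightarrow> comp d' f = (if d' = d then f else 0)"
    and comp_add: "comp d (f + g) = comp d f + comp d g"
    and comp_fin: "finite {d. comp d f \<noteq> 0}"
    and comp_sum: "(\<Sum>d | comp d f \<noteq> 0. comp d f) = f"
begin

text \<open>
  The irrelevant ideal of the ring, as a set of possibly inhomogeneous elements.
\<close>

definition pos :: "'r set" where "pos = {f. comp 0 f = 0}"

lemma comp_0 [simp]: "comp d 0 = 0"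
  using comp_add[of d 0 0] by simp

lemma comp_minus: "comp d (- f) = - comp d f"
  using comp_add[of d f "- f"] by (simp add: eq_neg_iff_add_eq_0 add.commute)

lemma comp_diff: "comp d (f - g) = comp d f - comp d g"
  using comp_add[of d f "- g"] by (simp add: comp_minus)

lemma comp_sum': "comp d (sum f K) = (\<Sum>k\<in>K. comp d (f k))"
  by (induction K rule: infinite_finite_induct) (auto simp: comp_add)

lemma comp_mult:
  assumes a: "a \<in> G p"
  shows "comp d (a * f) = (if p \<le> d then a * comp (d - p) f else 0)"
proof -
  let ?K = "{q. comp q f \<noteq> 0}"
  have "comp d (a * f) = comp d (\<Sum>q\<in>?K. a * comp q f)"
    by (subst (1) comp_sum[of f, symmetric]) (simp add: sum_distrib_left)
  also have "\<dots> = (\<Sum>q\<in>?K. comp d (a * comp q f))" by (rule comp_sum')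
  also have "\<dots> = (\<Sum>q\<in>?K. if q = d - p \<and> p \<le> d then a * comp q f else 0)"
    by (rule sum.cong) (use comp_hom[OF mult_in_G[OF a comp_in], of d] in auto)
  also have "\<dots> = (if p \<le> d then a * comp (d - p) f else 0)"
    using comp_fin[of f] by (cases "p \<le> d") (auto simp: sum.delta)
  finally show ?thesis .
qed

lemma pos_mult: "f \<in> pos \<Longrightarrow> a * f \<in> pos"
proof -
  assume f: "f \<in> pos"
  have "comp 0 (a * f) = comp 0 (\<Sum>q | comp q a \<noteq> 0. comp q a * f)"
    by (subst (1) comp_sum[of a, symmetric]) (simp add: sum_distrib_right)
  also have "\<dots> = 0"
    unfolding comp_sum' by (rule sum.neutral) (use f in \<open>auto simp: comp_mult[OF comp_in] pos_def\<close>)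
  finally show ?thesis by (simp add: pos_def)
qed

lemma ideal_pos: "ideal pos type_ring"
proof (rule type_ring_ideal)
  show "f - g \<in> pos" if "f \<in> pos" "g \<in> pos" for f g using that by (simp add: pos_def comp_diff)
  show "0 \<in> pos" by (simp add: pos_def)
qed (rule pos_mult)

end

text \<open>
  The quotient by a homogeneous ideal without elements of degree zero.
\<close>

locale graded_quotient = graded_components G comp
  for G :: "nat \<Rightarrow> 'r::comm_ring_1 set" and comp +
  fixes I :: "'r set"
  assumes I_zero: "0 \<in> I" and I_diff: "f \<in> I \<Longrightarrow> g \<in> I \<Longrightarrow> f - g \<in> I"
    and I_mult: "f \<in> I \<Longrightarrow> a * f \<in> I"
    and I_comp: "f \<in> I \<Longrightarrow> comp d f \<in> I"
    and I_comp0: "f \<in> I \<Longrightarrow> comp 0 f = 0"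
begin

abbreviation R :: "'r ring" where "R \<equiv> ring_of_type_algebra"
abbreviation A :: "'r set ring" where "A \<equiv> R Quot I"
abbreviation cl :: "'r \<Rightarrow> 'r set" where "cl f \<equiv> I +>\<^bsub>R\<^esub> f"
abbreviation gr :: "nat \<Rightarrow> 'r set set" where "gr d \<equiv> (\<lambda>f. I +>\<^bsub>R\<^esub> f) ` G d"

lemma ideal_I: "ideal I R"
  by (rule type_ring_ideal) (auto intro: I_zero I_diff I_mult)

lemma I_sum: "(\<And>k. k \<in> K \<Longrightarrow> f k \<in> I) \<Longrightarrow> sum f K \<in> I"
proof (induction K rule: infinite_finite_induct)
  case (insert k K)
  then have "f k \<in> I" "sum f K \<in> I" by simp_all
  from I_diff[OF this(1) I_diff[OF I_zero this(2)]] show ?case using insert.hyps by simp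
qed (simp_all add: I_zero)

lemma I_pos: "f \<in> I \<Longrightarrow> f \<in> pos" by (simp add: pos_def I_comp0)

interpretation ideal I R by (rule ideal_I)

lemma cring_A: "cring A"
  by (rule quotient_is_cring) (rule cring_from_type_algebra)

lemma class_eq: "cl f = cl g \<longleftrightarrow> f - g \<in> I"
proof -
  have "f - g = f \<ominus>\<^bsub>R\<^esub> g" by (simp add: a_minus_def type_ring_minus type_ring_simps)
  then show ?thesis using quotient_eq_iff_same_a_r_cos[OF ideal_I, of f g] by (simp add: type_ring_simps)
qed

lemma A_simps:
  shows A_carrier: "carrier A = range (\<lambda>f. I +>\<^bsub>R\<^esub> f)"
    and A_mult: "cl f \<otimes>\<^bsub>A\<^esub> cl g = cl (f * g)"
    and A_add: "cl f \<oplus>\<^bsub>A\<^esub> cl g = cl (f + g)"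
    and A_zero: "\<zero>\<^bsub>A\<^esub> = cl 0"
proof -
  show "carrier A = range (\<lambda>f. I +>\<^bsub>R\<^esub> f)"
    by (auto simp: FactRing_def A_RCOSETS_def RCOSETS_def a_r_coset_def type_ring_simps)
  show "cl f \<otimes>\<^bsub>A\<^esub> cl g = cl (f * g)"
    using rcoset_mult_add[of f g] by (simp add: FactRing_def type_ring_simps)
  show "cl f \<oplus>\<^bsub>A\<^esub> cl g = cl (f + g)"
    using a_rcos_sum[of f g] by (simp add: FactRing_def type_ring_simps)
  show "\<zero>\<^bsub>A\<^esub> = cl 0"
    by (simp add: FactRing_def a_r_coset_def r_coset_def type_ring_simps)
qed

lemma class_in_pos_iff: "cl f \<in> (\<lambda>f. I +>\<^bsub>R\<^esub> f) ` pos \<longleftrightarrow> f \<in> pos"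
proof
  assume "cl f \<in> (\<lambda>f. I +>\<^bsub>R\<^esub> f) ` pos"
  then obtain g where "g \<in> pos" "f - g \<in> I" using class_eq by blast
  then show "f \<in> pos" using I_pos[of "f - g"] by (simp add: pos_def comp_diff)
qed blast

text \<open>
  The irrelevant ideal of the quotient consists of the classes of the irrelevant ideal of the ring.
\<close>

lemma irrel_eq: "irrel A gr = (\<lambda>f. I +>\<^bsub>R\<^esub> f) ` pos"
proof
  have id: "ideal ((\<lambda>f. I +>\<^bsub>R\<^esub> f) ` pos) A"
    using ring.ring_ideal_imp_quot_ideal[OF ring_from_type_algebra ideal_I ideal_pos] .
  show "irrel A gr \<subseteq> (\<lambda>f. I +>\<^bsub>R\<^esub> f) ` pos"
    unfolding irrel_def
  proof (rule ring.genideal_minimal[OF cring.axioms(1)[OF cring_A] id])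
    show "(\<Union>m\<in>{0<..}. gr m) \<subseteq> (\<lambda>f. I +>\<^bsub>R\<^esub> f) ` pos"
      using comp_hom by (force simp: pos_def)
  qed
  show "(\<lambda>f. I +>\<^bsub>R\<^esub> f) ` pos \<subseteq> irrel A gr"
  proof
    fix u assume "u \<in> (\<lambda>f. I +>\<^bsub>R\<^esub> f) ` pos"
    then obtain f where f: "comp 0 f = 0" "u = cl f" by (auto simp: pos_def)
    have "u \<in> J" if J: "ideal J A" "(\<Union>m\<in>{0<..}. gr m) \<subseteq> J" for J
    proof -
      interpret J: ideal J A by (rule J(1))
      have z: "cl 0 \<in> J" using additive_subgroup.zero_closed[OF ideal.axioms(1)[OF J(1)]] unfolding A_zero .
      have "cl (\<Sum>d\<in>K. comp d f) \<in> J" if "0 \<notin> K" for K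
        using that
      proof (induction K rule: infinite_finite_induct)
        case (insert d K)
        have "cl (comp d f) \<in> gr d" using comp_in by blast
        then have "cl (comp d f) \<in> J" using J(2) insert.prems by (auto simp: subset_iff)
        then show ?case using insert J.a_closed A_add[symmetric] by simp
      qed (use z in simp_all)
      from this[of "{d. comp d f \<noteq> 0}"] show ?thesis using f comp_sum by simp
    qed
    then show "u \<in> irrel A gr" unfolding irrel_def genideal_def by blast
  qed
qed

text \<open>
  The value of an element in the residue field \<open>k\<close> of the quotient.
\<close>

definition res :: "'r \<Rightarrow> 'r set set" where "res f = irrel A gr +>\<^bsub>A\<^esub> cl f"

lemma ideal_irrel: "ideal (irrel A gr) A"
  unfolding irrel_eq using ring.ring_ideal_imp_quot_ideal[OF ring_from_type_algebra ideal_I ideal_pos] .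

lemma resmod_simps:
  shows resmod_carrier: "carrier (resmod A gr) = range res"
    and resmod_add: "res f \<oplus>\<^bsub>resmod A gr\<^esub> res g = res (f + g)"
    and resmod_zero: "\<zero>\<^bsub>resmod A gr\<^esub> = res 0"
    and resmod_smult: "cl a \<odot>\<^bsub>resmod A gr\<^esub> res g = res (a * g)"
    and res_eq: "res f = res g \<longleftrightarrow> f - g \<in> pos"
proof -
  interpret Ir: ideal "irrel A gr" A by (rule ideal_irrel)
  interpret cA: cring A by (rule cring_A)
  note e = resmod_def ring.extend_def module.fields_def FactRing_def[of A]
  have c: "cl f \<in> carrier A" for f by (simp add: A_carrier)
  show "carrier (resmod A gr) = range res"
  proof -
    have "carrier (resmod A gr) = a_rcosets\<^bsub>A\<^esub> (irrel A gr)" by (simp add: e)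
    then show ?thesis unfolding A_RCOSETS_def' A_carrier res_def by auto
  qed
  show "res f \<oplus>\<^bsub>resmod A gr\<^esub> res g = res (f + g)"
    using Ir.a_rcos_sum[OF c[of f] c[of g]] by (simp add: e res_def A_add)
  show "\<zero>\<^bsub>resmod A gr\<^esub> = res 0"
    using Ir.a_rcos_const[OF additive_subgroup.zero_closed[OF ideal.axioms(1)[OF ideal_irrel]]] by (simp add: e res_def A_zero)
  show "cl a \<odot>\<^bsub>resmod A gr\<^esub> res g = res (a * g)"
    using Ir.rcoset_mult_add[OF c[of a] c[of g]] by (simp add: e res_def A_mult)
  have "\<ominus>\<^bsub>A\<^esub> cl g = cl (- g)"
    by (rule Ir.minus_equality) (simp_all add: A_add A_zero c)
  then have "cl f \<ominus>\<^bsub>A\<^esub> cl g = cl (f - g)" by (simp add: a_minus_def A_add)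
  then show "res f = res g \<longleftrightarrow> f - g \<in> pos"
    using Ir.quotient_eq_iff_same_a_r_cos[OF ideal_irrel c[of f] c[of g]] class_in_pos_iff
    by (simp add: res_def irrel_eq)
qed

definition finsupp :: "nat set \<Rightarrow> (nat \<Rightarrow> 'r) set" where
  "finsupp B = {f. finite {b. f b \<noteq> 0} \<and> (\<forall>b. b \<notin> B \<longrightarrow> f b = 0)}"

definition cvec :: "(nat \<Rightarrow> 'r) \<Rightarrow> nat \<Rightarrow> 'r set" where "cvec f b = cl (f b)"

text \<open>
  Representatives of classes. The class of zero is represented by zero, so that finite supports are preserved.
\<close>

definition repr :: "'r set \<Rightarrow> 'r" where "repr u = (if u = cl 0 then 0 else SOME f. u = cl f)"

lemma class_repr: "u \<in> carrier A \<Longrightarrow> cl (repr u) = u"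
proof (cases "u = cl 0")
  case False
  assume "u \<in> carrier A"
  then have "\<exists>f. u = cl f" by (auto simp: A_carrier)
  from someI_ex[OF this] show "cl (repr u) = u" using False by (simp add: repr_def)
qed (simp add: repr_def)

lemma repr_zero: "repr (cl 0) = 0" by (simp add: repr_def)

lemma cvec_eq: "cvec f = cvec g \<longleftrightarrow> (\<forall>b. f b - g b \<in> I)"
  by (simp add: cvec_def fun_eq_iff class_eq)

lemma finsupp_repr: "x \<in> carrier (free_module A B) \<Longrightarrow> (\<lambda>b. repr (x b)) \<in> finsupp B"
proof -
  assume x: "x \<in> carrier (free_module A B)"
  have "finite {b. repr (x b) \<noteq> 0}"
    by (rule finite_subset[of _ "{b. x b \<noteq> \<zero>\<^bsub>A\<^esub>}"])
      (use x in \<open>auto simp: free_module_def A_zero repr_zero\<close>)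
  then show ?thesis using x by (auto simp: free_module_def finsupp_def A_zero repr_zero)
qed

lemma cvec_repr: "x \<in> carrier (free_module A B) \<Longrightarrow> cvec (\<lambda>b. repr (x b)) = x"
  by (auto simp: cvec_def free_module_def class_repr fun_eq_iff)

lemma cvec_in: "f \<in> finsupp B \<Longrightarrow> cvec f \<in> carrier (free_module A B)"
proof -
  assume f: "f \<in> finsupp B"
  have "finite {b. cvec f b \<noteq> \<zero>\<^bsub>A\<^esub>}"
    by (rule finite_subset[of _ "{b. f b \<noteq> 0}"]) (use f in \<open>auto simp: finsupp_def A_zero cvec_def\<close>)
  then show ?thesis using f by (auto simp: free_module_def finsupp_def A_zero cvec_def A_carrier)
qed

lemma free_module_simps:
  shows fm_carrier: "carrier (free_module A B) = cvec ` finsupp B"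
    and fm_add: "cvec f \<oplus>\<^bsub>free_module A B\<^esub> cvec g = cvec (f + g)"
    and fm_zero: "\<zero>\<^bsub>free_module A B\<^esub> = cvec 0"
    and fm_smult: "cl a \<odot>\<^bsub>free_module A B\<^esub> cvec f = cvec (\<lambda>b. a * f b)"
proof -
  show "carrier (free_module A B) = cvec ` finsupp B"
    using cvec_in cvec_repr[symmetric] finsupp_repr by blast
qed (auto simp: free_module_def cvec_def A_add A_zero A_mult fun_eq_iff)

lemma dsum_finsupp: "x \<in> dsum B e U j \<Longrightarrow> x \<in> finsupp B"
  by (auto simp: dsum_def finsupp_def)

lemma finsupp_finite: "f \<in> finsupp B \<Longrightarrow> finite {b. f b \<noteq> 0}" by (simp add: finsupp_def)

text \<open>
  Every homogeneous vector over the quotient is the class of a homogeneous vector of the same degree.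
\<close>

lemma free_part_eq: "free_part A gr B e j = cvec ` dsum B e G j"
proof
  show "cvec ` dsum B e G j \<subseteq> free_part A gr B e j"
  proof (rule image_subsetI)
    fix f assume f: "f \<in> dsum B e G j"
    have "if e b \<le> j then cvec f b \<in> gr (j - e b) else cvec f b = \<zero>\<^bsub>A\<^esub>" if "b \<in> B" for b
      using dsum_in[OF f that] by (auto simp: shift_def cvec_def A_zero)
    then show "cvec f \<in> free_part A gr B e j"
      using cvec_in[OF dsum_finsupp[OF f]] by (simp add: free_part_def)
  qed
  show "free_part A gr B e j \<subseteq> cvec ` dsum B e G j"
  proof
    fix x assume x: "x \<in> free_part A gr B e j"
    then have xc: "x \<in> carrier (free_module A B)" by (simp add: free_part_def)
    have "\<exists>f. x b = cl f \<and> (x b = cl 0 \<longrightarrow> f = 0) \<and> (b \<in> B \<longrightarrow> f \<in> shift (e b) G j)" for b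
    proof (cases "x b = cl 0")
      case True
      then show ?thesis using graded_group_0[OF graded_group_shift[OF graded_group_G]] by auto
    next
      case False
      then have b: "b \<in> B" using xc by (auto simp: free_module_def A_zero)
      then have "e b \<le> j" "x b \<in> gr (j - e b)" using x False by (auto simp: free_part_def A_zero split: if_splits)
      then show ?thesis using False by (auto simp: shift_def)
    qed
    then obtain f where f: "\<And>b. x b = cl (f b)" "\<And>b. x b = cl 0 \<Longrightarrow> f b = 0"
      "\<And>b. b \<in> B \<Longrightarrow> f b \<in> shift (e b) G j" by metis
    have "finite {b. f b \<noteq> 0}"
      by (rule finite_subset[of _ "{b. x b \<noteq> \<zero>\<^bsub>A\<^esub>}"])
        (use f(2) xc in \<open>auto simp: free_module_def A_zero\<close>)
    moreover have "f b = 0" if "b \<notin> B" for b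
      using f(2)[of b] xc that by (auto simp: free_module_def A_zero)
    ultimately have "f \<in> dsum B e G j" using f(3) by (simp add: dsum_def)
    moreover have "x = cvec f" using f(1) by (auto simp: cvec_def)
    ultimately show "x \<in> cvec ` dsum B e G j" by blast
  qed
qed

lemma irrel_part_iff: "f \<in> finsupp B \<Longrightarrow> cvec f \<in> irrel_part A gr B \<longleftrightarrow> (\<forall>b. f b \<in> pos)"
  using cvec_in[of f B] by (auto simp: irrel_part_def cvec_def irrel_eq class_in_pos_iff)

text \<open>
  The component of degree \<open>j\<close> of a vector whose \<open>b\<close>-th coordinate belongs to a generator of degree \<open>e b\<close>.
\<close>

definition homog :: "(nat \<Rightarrow> nat) \<Rightarrow> nat \<Rightarrow> (nat \<Rightarrow> 'r) \<Rightarrow> nat \<Rightarrow> 'r" where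
  "homog e j f b = (if e b \<le> j then comp (j - e b) (f b) else 0)"

lemma homog_in: "f \<in> finsupp B \<Longrightarrow> homog e j f \<in> dsum B e G j"
proof -
  assume f: "f \<in> finsupp B"
  have "finite {b. homog e j f b \<noteq> 0}"
    by (rule finite_subset[of _ "{b. f b \<noteq> 0}"]) (use f in \<open>auto simp: finsupp_def homog_def\<close>)
  then show ?thesis using f comp_in by (auto simp: dsum_def finsupp_def homog_def shift_def)
qed

lemma homog_id: "x \<in> dsum B e G j \<Longrightarrow> homog e j x = x"
proof
  fix b assume x: "x \<in> dsum B e G j"
  show "homog e j x b = x b"
    using dsum_in'[OF x, of b] by (cases "x b = 0") (auto simp: homog_def comp_hom)
qed

lemma homog_diff: "homog e j (f - g) = homog e j f - homog e j g"
  by (auto simp: homog_def comp_diff fun_eq_iff)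

lemma homog_I: "(\<And>b. f b \<in> I) \<Longrightarrow> homog e j f b \<in> I"
  by (auto simp: homog_def I_comp I_zero)

text \<open>
  A matrix whose rows are homogeneous of the right degrees commutes with taking components.
\<close>

lemma homog_lincomb:
  assumes f: "f \<in> finsupp B" and N: "\<And>b. b \<in> B \<Longrightarrow> N b \<in> dsum B' e' G (e b)"
  shows "homog e' j (lincomb (*) N f) = lincomb (*) N (homog e j f)"
proof
  fix c
  have "lincomb (*) N (homog e j f) c = (\<Sum>b | f b \<noteq> 0. N b c * homog e j f b)"
    by (rule lincomb_superset[OF module_mult]) (use f in \<open>auto simp: finsupp_def homog_def\<close>)
  also have "\<dots> = (\<Sum>b | f b \<noteq> 0. if e' c \<le> j then comp (j - e' c) (N b c * f b) else 0)"
  proof (rule sum.cong[OF refl])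
    fix b assume "b \<in> {b. f b \<noteq> 0}"
    then have b: "b \<in> B" using f by (auto simp: finsupp_def)
    show "N b c * homog e j f b = (if e' c \<le> j then comp (j - e' c) (N b c * f b) else 0)"
    proof (cases "N b c = 0")
      case True then show ?thesis by simp
    next
      case False
      then have n: "e' c \<le> e b" "N b c \<in> G (e b - e' c)" using dsum_in'[OF N[OF b]] by auto
      show ?thesis
      proof (cases "e b \<le> j")
        case True
        then have "e' c \<le> j" "e b - e' c \<le> j - e' c" "j - e' c - (e b - e' c) = j - e b" using n by auto
        then show ?thesis using True comp_mult[OF n(2), of "j - e' c" "f b"] by (simp add: homog_def)
      next
        case False
        then have "e' c \<le> j \<Longrightarrow> \<not> e b - e' c \<le> j - e' c" using n by auto
        then show ?thesis using False comp_mult[OF n(2), of "j - e' c" "f b"] by (auto simp: homog_def)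
      qed
    qed
  qed
  also have "\<dots> = homog e' j (lincomb (*) N f) c" by (simp add: homog_def lincomb_def comp_sum')
  finally show "homog e' j (lincomb (*) N f) c = lincomb (*) N (homog e j f) c" by simp
qed

lemma lincomb_finsupp:
  assumes f: "f \<in> finsupp B" and N: "\<And>b. b \<in> B \<Longrightarrow> N b \<in> finsupp B'"
  shows "lincomb (*) N f \<in> finsupp B'"
proof -
  have z: "lincomb (*) N f c = 0" if "\<And>b. f b \<noteq> 0 \<Longrightarrow> N b c = 0" for c
    unfolding lincomb_def using that by (auto intro!: sum.neutral)
  have "{c. lincomb (*) N f c \<noteq> 0} \<subseteq> (\<Union>b\<in>{b. f b \<noteq> 0}. {c. N b c \<noteq> 0})" using z by blast
  moreover have "finite (\<Union>b\<in>{b. f b \<noteq> 0}. {c. N b c \<noteq> 0})"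
  proof (rule finite_UN_I)
    show "finite {b. f b \<noteq> 0}" using f by (rule finsupp_finite)
    show "finite {c. N b c \<noteq> 0}" if "b \<in> {b. f b \<noteq> 0}" for b
      by (rule finsupp_finite[OF N]) (use that f in \<open>auto simp: finsupp_def\<close>)
  qed
  ultimately have "finite {c. lincomb (*) N f c \<noteq> 0}" by (rule finite_subset)
  moreover have "lincomb (*) N f c = 0" if "c \<notin> B'" for c
    by (rule z) (use that f N in \<open>auto simp: finsupp_def\<close>)
  ultimately show ?thesis by (simp add: finsupp_def)
qed

text \<open>
  A module homomorphism from a free module is given by its values on the basis. The target is presented by a
  map \<open>q\<close> from a module over the type onto it, which covers both free modules and the residue field.
\<close>

lemma hom_determined_by_basis:
  fixes s :: "'r \<Rightarrow> 'm::ab_group_add \<Rightarrow> 'm"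
  assumes h: "h \<in> module_hom A (free_module A B) N"
    and q: "\<And>u w. q (u + w) = q u \<oplus>\<^bsub>N\<^esub> q w" "\<And>a u. q (s a u) = cl a \<odot>\<^bsub>N\<^esub> q u"
    and s0: "\<And>u. s 0 u = 0" and range: "carrier N \<subseteq> range q"
    and unit: "\<And>b. b \<in> B \<Longrightarrow> h (cvec (\<lambda>c. if c = b then 1 else 0)) = q (n b)"
    and f: "f \<in> finsupp B"
  shows "h (cvec f) = q (\<Sum>b | f b \<noteq> 0. s (f b) (n b))"
proof -
  have h0: "h (cvec 0) = q 0"
  proof -
    have z: "(0 :: nat \<Rightarrow> 'r) \<in> finsupp B" by (simp add: finsupp_def)
    have "h (cvec 0) \<in> carrier N" using h cvec_in[OF z] by (auto simp: module_hom_def hom_def)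
    then obtain u where u: "h (cvec 0) = q u" using range by blast
    have e: "(\<lambda>b. 0 * (v :: nat \<Rightarrow> 'r) b) = 0" for v by auto
    have "cvec 0 = cl 0 \<odot>\<^bsub>free_module A B\<^esub> cvec 0" by (simp only: fm_smult e)
    then have "h (cvec 0) = h (cl 0 \<odot>\<^bsub>free_module A B\<^esub> cvec 0)" by simp
    also have "\<dots> = cl 0 \<odot>\<^bsub>N\<^esub> h (cvec 0)"
      using h cvec_in[OF z] by (auto simp: module_hom_def A_carrier)
    also have "\<dots> = q (s 0 u)" by (simp only: u q(2))
    also have "\<dots> = q 0" by (simp only: s0)
    finally show ?thesis .
  qed
  have "h (cvec (\<lambda>c. if c \<in> K then f c else 0)) = q (\<Sum>b\<in>K. s (f b) (n b))" if "K \<subseteq> {b. f b \<noteq> 0}" for K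
    using finite_subset[OF that finsupp_finite[OF f]] that
  proof (induction K rule: finite_induct)
    case empty
    have "(\<lambda>c. if c \<in> {} then f c else 0) = 0" by auto
    then show ?case using h0 by simp
  next
    case (insert b K)
    let ?g = "\<lambda>c. if c \<in> K then f c else 0" and ?d = "\<lambda>c. if c = b then 1 else 0 :: 'r"
    have b: "b \<in> B" using insert f by (auto simp: finsupp_def)
    have g: "?g \<in> finsupp B" using insert f by (auto simp: finsupp_def)
    have d: "?d \<in> finsupp B" using b by (auto simp: finsupp_def)
    have fd: "(\<lambda>c. f b * ?d c) \<in> finsupp B" using b by (auto simp: finsupp_def)
    have "(\<lambda>c. if c \<in> insert b K then f c else 0) = (\<lambda>c. f b * ?d c) + ?g"
      using insert.hyps by auto
    then have "h (cvec (\<lambda>c. if c \<in> insert b K then f c else 0))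
        = h (cvec (\<lambda>c. f b * ?d c) \<oplus>\<^bsub>free_module A B\<^esub> cvec ?g)" by (simp only: fm_add)
    also have "\<dots> = h (cvec (\<lambda>c. f b * ?d c)) \<oplus>\<^bsub>N\<^esub> h (cvec ?g)"
      using h cvec_in[OF fd] cvec_in[OF g] by (simp add: module_hom_def hom_def)
    also have "h (cvec (\<lambda>c. f b * ?d c)) = h (cl (f b) \<odot>\<^bsub>free_module A B\<^esub> cvec ?d)" by (simp only: fm_smult)
    also have "\<dots> = cl (f b) \<odot>\<^bsub>N\<^esub> h (cvec ?d)"
      using h cvec_in[OF d] by (auto simp: module_hom_def A_carrier)
    also have "\<dots> = q (s (f b) (n b))" by (simp only: unit[OF b] q(2))
    also have "h (cvec ?g) = q (\<Sum>b\<in>K. s (f b) (n b))" using insert by simp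
    also have "q (s (f b) (n b)) \<oplus>\<^bsub>N\<^esub> q (\<Sum>b\<in>K. s (f b) (n b)) = q (\<Sum>b\<in>insert b K. s (f b) (n b))"
      using insert.hyps by (simp add: q(1))
    finally show ?case .
  qed
  from this[OF order_refl] have "h (cvec (\<lambda>c. if c \<in> {b. f b \<noteq> 0} then f c else 0)) = q (\<Sum>b | f b \<noteq> 0. s (f b) (n b))" .
  moreover have "(\<lambda>c. if c \<in> {b. f b \<noteq> 0} then f c else 0) = f" by auto
  ultimately show ?thesis by simp
qed

definition pieces :: "nat \<Rightarrow> 'r set" where "pieces d = I \<inter> G d"

lemma gmodule_pieces: "gmodule (*) pieces"
  unfolding gmodule_def graded_group_def
  using I_zero I_diff I_mult graded_group_0[OF graded_group_G] graded_group_diff[OF graded_group_G] mult_in_G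
  by (auto simp: pieces_def module_mult)

lemma pieces_irr: "pieces j \<subseteq> irr j"
proof
  fix f assume "f \<in> pieces j"
  then have "f \<in> G j" "comp 0 f = 0" by (auto simp: pieces_def I_comp0)
  then show "f \<in> irr j" using comp_hom[of f j 0] by (auto simp: irr_def)
qed

lemma pos_irr: "f \<in> G j \<Longrightarrow> f \<in> pos \<Longrightarrow> f \<in> irr j"
  using comp_hom[of f j 0] by (auto simp: pos_def irr_def)

lemma dsum_I: "x \<in> dsum B e pieces j \<longleftrightarrow> x \<in> dsum B e G j \<and> (\<forall>b. x b \<in> I)"
proof
  assume x: "x \<in> dsum B e pieces j"
  have "pieces q \<subseteq> G q" for q by (simp add: pieces_def)
  then have "x \<in> dsum B e G j" using x dsum_mono[of pieces G] by blast
  moreover have "x b \<in> I" for b using dsum_in'[OF x, of b] I_zero by (cases "x b = 0") (auto simp: pieces_def)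
  ultimately show "x \<in> dsum B e G j \<and> (\<forall>b. x b \<in> I)" by blast
next
  assume "x \<in> dsum B e G j \<and> (\<forall>b. x b \<in> I)"
  then show "x \<in> dsum B e pieces j" by (auto simp: dsum_def shift_def pieces_def)
qed

end

context graded_quotient
begin

definition basis_vec :: "nat \<Rightarrow> nat \<Rightarrow> 'r" where "basis_vec b = (\<lambda>c. if c = b then 1 else 0)"

lemma basis_vec_in: "b \<in> B \<Longrightarrow> basis_vec b \<in> dsum B e G (e b)"
  using graded_group_0[OF graded_group_G] one_in_G by (auto simp: dsum_def basis_vec_def shift_def)

lemma hom_free:
  assumes h: "h \<in> module_hom A (free_module A B) (free_module A B')"
    and unit: "\<And>b. b \<in> B \<Longrightarrow> h (cvec (basis_vec b)) = cvec (N b)" and f: "f \<in> finsupp B"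
  shows "h (cvec f) = cvec (lincomb (*) N f)"
proof -
  have "h (cvec f) = cvec (\<Sum>b | f b \<noteq> 0. vscale (f b) (N b))"
  proof (rule hom_determined_by_basis[where q = cvec and s = vscale and n = N, OF h _ _ _ _ _ f])
    show "vscale 0 u = 0" for u by (auto simp: vscale_def)
    show "carrier (free_module A B') \<subseteq> range cvec" by (auto simp: fm_carrier)
    show "cvec (u + w) = cvec u \<oplus>\<^bsub>free_module A B'\<^esub> cvec w" for u w by (simp only: fm_add)
    show "cvec (vscale a u) = cl a \<odot>\<^bsub>free_module A B'\<^esub> cvec u" for a u by (simp only: fm_smult vscale_def)
    show "h (cvec (\<lambda>c. if c = b then 1 else 0)) = cvec (N b)" if "b \<in> B" for b
      using unit[OF that] by (simp add: basis_vec_def)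
  qed
  also have "(\<Sum>b | f b \<noteq> 0. vscale (f b) (N b)) = lincomb (*) N f"
  proof
    fix c
    have "(\<Sum>b\<in>K. vscale (f b) (N b)) c = (\<Sum>b\<in>K. vscale (f b) (N b) c)" for K
      by (induction K rule: infinite_finite_induct) auto
    then show "(\<Sum>b | f b \<noteq> 0. vscale (f b) (N b)) c = lincomb (*) N f c"
      by (simp add: lincomb_def vscale_def mult.commute)
  qed
  finally show ?thesis .
qed

lemma hom_aug:
  assumes h: "h \<in> module_hom A (free_module A B) (resmod A gr)"
    and unit: "\<And>b. b \<in> B \<Longrightarrow> h (cvec (basis_vec b)) = res (\<alpha> b)" and f: "f \<in> finsupp B"
  shows "h (cvec f) = res (lincomb (*) (\<lambda>c _. \<alpha> c) f 0)"
proof -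
  have "h (cvec f) = res (\<Sum>b | f b \<noteq> 0. f b * \<alpha> b)"
  proof (rule hom_determined_by_basis[where q = res and s = "(*)" and n = \<alpha>, OF h _ _ _ _ _ f])
    show "0 * u = 0" for u :: 'r by simp
    show "carrier (resmod A gr) \<subseteq> range res" by (simp add: resmod_carrier)
    show "res (u + w) = res u \<oplus>\<^bsub>resmod A gr\<^esub> res w" for u w by (simp only: resmod_add)
    show "res (a * u) = cl a \<odot>\<^bsub>resmod A gr\<^esub> res u" for a u by (simp only: resmod_smult)
    show "h (cvec (\<lambda>c. if c = b then 1 else 0)) = res (\<alpha> b)" if "b \<in> B" for b
      using unit[OF that] by (simp add: basis_vec_def)
  qed
  also have "(\<Sum>b | f b \<noteq> 0. f b * \<alpha> b) = lincomb (*) (\<lambda>c _. \<alpha> c) f 0"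
    by (simp add: lincomb_def mult.commute)
  finally show ?thesis .
qed

text \<open>
  If the quotient of cycles by boundaries is trivial, then the coset of a cycle is the set of boundaries; it
  contains the cycle because zero is a boundary.
\<close>

lemma cycle_is_boundary_if_trivial_tor:
  assumes triv: "trivial_group (tor A gr F i j)" and x: "x \<in> tor_cycles A gr F i j"
    and zero: "\<zero>\<^bsub>term_mod A F i\<^esub> \<in> tor_boundaries A gr F i j"
    and l_zero: "\<zero>\<^bsub>term_mod A F i\<^esub> \<oplus>\<^bsub>term_mod A F i\<^esub> x = x"
  shows "x \<in> tor_boundaries A gr F i j"
proof -
  let ?C = "add_monoid (term_mod A F i)\<lparr>carrier := tor_cycles A gr F i j\<rparr>"
  let ?H = "tor_boundaries A gr F i j"
  have "carrier (?C Mod ?H) = {\<one>\<^bsub>?C Mod ?H\<^esub>}"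
    using triv by (simp add: tor_def trivial_group_def)
  then have rc: "rcosets\<^bsub>?C\<^esub> ?H = {?H}" by (simp add: FactGroup_def)
  have "?H #>\<^bsub>?C\<^esub> x \<in> rcosets\<^bsub>?C\<^esub> ?H" using x by (auto simp: RCOSETS_def)
  then have "?H #>\<^bsub>?C\<^esub> x = ?H" using rc by blast
  moreover have "x \<in> ?H #>\<^bsub>?C\<^esub> x" using zero l_zero unfolding r_coset_def by force
  ultimately show ?thesis by blast
qed

text \<open>
  The matrices are obtained by lifting the values of the differentials on basis vectors to homogeneous vectors.
  Exactness over the quotient yields preimages that need not be homogeneous; their components of the right
  degree are preimages too. The vanishing of \<open>Tor(k, k)\<close> above the diagonal becomes the vanishing of \<open>Tor\<close> for \<open>G\<close>
  modulo the irrelevant ideal.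
\<close>

theorem koszul_imp_residue_resolution:
  assumes "koszul A gr"
  shows "\<exists>B e D \<alpha>. residue_resolution G pieces B e D \<alpha> \<and>
    (\<forall>i j. i < j \<longrightarrow> residue_resolution.tor_zero B e D (*) G irr i j)"
proof -
  obtain F where F: "graded_free_resolution A gr F" and T: "\<And>i j. i \<noteq> j \<Longrightarrow> trivial_group (tor A gr F i j)"
    using assms by (auto simp: koszul_def)
  define B where "B = basis F"
  define e where "e = bdeg F"
  note F' = F[unfolded graded_free_resolution_def, folded B_def e_def]
  have aug_hom: "aug F \<in> module_hom A (free_module A (B 0)) (resmod A gr)" using F' ..
  note F1 = conjunct2[OF F']
  have bd_hom: "bdry F i \<in> module_hom A (free_module A (B (Suc i))) (free_module A (B i))" for i
    using F1[THEN conjunct1] ..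
  note F2 = conjunct2[OF F1]
  have aug_deg: "\<And>j x. 0 < j \<Longrightarrow> x \<in> free_part A gr (B 0) (e 0) j \<Longrightarrow> aug F x = \<zero>\<^bsub>resmod A gr\<^esub>"
    using F2[THEN conjunct1] by simp
  note F3 = conjunct2[OF F2]
  have bd_deg: "bdry F i ` free_part A gr (B (Suc i)) (e (Suc i)) j \<subseteq> free_part A gr (B i) (e i) j" for i j
    using F3[THEN conjunct1] by (elim allE)
  note F4 = conjunct2[OF F3]
  have onto: "aug F ` carrier (free_module A (B 0)) = carrier (resmod A gr)" using F4 ..
  note F5 = conjunct2[OF F4]
  have ex0: "bdry F 0 ` carrier (free_module A (B 1)) = a_kernel (free_module A (B 0)) (resmod A gr) (aug F)"
    using F5 ..
  have exS: "bdry F (Suc i) ` carrier (free_module A (B (Suc (Suc i))))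
          = a_kernel (free_module A (B (Suc i))) (free_module A (B i)) (bdry F i)" for i
    using F5[THEN conjunct2] ..
  have "\<exists>N. N \<in> dsum (B i) (e i) G (e (Suc i) b) \<and> bdry F i (cvec (basis_vec b)) = cvec N" if "b \<in> B (Suc i)" for i b
  proof -
    have "cvec (basis_vec b) \<in> free_part A gr (B (Suc i)) (e (Suc i)) (e (Suc i) b)"
      unfolding free_part_eq using basis_vec_in[OF that] by blast
    then show ?thesis using bd_deg unfolding free_part_eq by blast
  qed
  then have "\<forall>i b. \<exists>N. b \<in> B (Suc i) \<longrightarrow> N \<in> dsum (B i) (e i) G (e (Suc i) b) \<and> bdry F i (cvec (basis_vec b)) = cvec N"
    by blast
  from choice[OF allI[OF choice[OF spec[OF this]]]] obtain D where
    D': "\<forall>i b. b \<in> B (Suc i) \<longrightarrow> D i b \<in> dsum (B i) (e i) G (e (Suc i) b) \<and> bdry F i (cvec (basis_vec b)) = cvec (D i b)" ..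
  then have D: "\<And>i b. b \<in> B (Suc i) \<Longrightarrow> D i b \<in> dsum (B i) (e i) G (e (Suc i) b)"
    and Du: "\<And>i b. b \<in> B (Suc i) \<Longrightarrow> bdry F i (cvec (basis_vec b)) = cvec (D i b)" by blast+
  have bd: "bdry F i (cvec f) = cvec (lincomb (*) (D i) f)" if "f \<in> finsupp (B (Suc i))" for i f
    by (rule hom_free[OF bd_hom Du that])
  have "\<exists>a. a \<in> G 0 \<and> (e 0 b \<noteq> 0 \<longrightarrow> a = 0) \<and> aug F (cvec (basis_vec b)) = res a" if b: "b \<in> B 0" for b
  proof (cases "e 0 b = 0")
    case True
    have "cvec (basis_vec b) \<in> carrier (free_module A (B 0))" by (rule cvec_in[OF dsum_finsupp[OF basis_vec_in[OF b]]])
    then have "aug F (cvec (basis_vec b)) \<in> range res"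
      using aug_hom by (auto simp: module_hom_def hom_def resmod_carrier)
    then obtain a where "aug F (cvec (basis_vec b)) = res a" by blast
    \<comment> \<open>The lift is replaced by its component of degree zero, which has the same value in \<open>k\<close>.\<close>
    moreover have "res a = res (comp 0 a)" by (simp add: res_eq pos_def comp_diff comp_hom[OF comp_in])
    ultimately show ?thesis using True by (intro exI[of _ "comp 0 a"]) (simp add: comp_in)
  next
    case False
    have "cvec (basis_vec b) \<in> free_part A gr (B 0) (e 0) (e 0 b)"
      unfolding free_part_eq using basis_vec_in[OF b] by blast
    then have "aug F (cvec (basis_vec b)) = res 0" using aug_deg False resmod_zero by simp
    then show ?thesis using graded_group_0[OF graded_group_G] by blast
  qed
  then obtain \<alpha> where al: "\<And>b. b \<in> B 0 \<Longrightarrow> \<alpha> b \<in> G 0" "\<And>b. b \<in> B 0 \<Longrightarrow> e 0 b \<noteq> 0 \<Longrightarrow> \<alpha> b = 0"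
    and alu: "\<And>b. b \<in> B 0 \<Longrightarrow> aug F (cvec (basis_vec b)) = res (\<alpha> b)" by metis
  have ag: "aug F (cvec f) = res (lincomb (*) (\<lambda>c _. \<alpha> c) f 0)" if "f \<in> finsupp (B 0)" for f
    by (rule hom_aug[OF aug_hom alu that])
  have ker: "x \<in> a_kernel P Q h \<longleftrightarrow> x \<in> carrier P \<and> h x = \<zero>\<^bsub>Q\<^esub>"
    for x h and P :: "('r set, nat \<Rightarrow> 'r set) module" and Q :: "('r set, 'y) module"
    by (simp add: a_kernel_def kernel_def)
  have lift: "\<exists>y\<in>dsum (B (Suc i)) (e (Suc i)) G j. x - lincomb (*) (D i) y \<in> dsum (B i) (e i) pieces j"
    if x: "x \<in> dsum (B i) (e i) G j" and im: "cvec x \<in> bdry F i ` carrier (free_module A (B (Suc i)))" for i j x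
  proof -
    obtain g where g: "g \<in> finsupp (B (Suc i))" "cvec x = cvec (lincomb (*) (D i) g)"
      using im bd unfolding fm_carrier by auto
    have y: "homog (e (Suc i)) j g \<in> dsum (B (Suc i)) (e (Suc i)) G j" by (rule homog_in[OF g(1)])
    have "lincomb (*) (D i) (homog (e (Suc i)) j g) \<in> dsum (B i) (e i) G (j + 0)"
      by (rule lincomb_dsum[OF module_mult graded_group_G mult_in_G y]) (use D in auto)
    then have d: "x - lincomb (*) (D i) (homog (e (Suc i)) j g) \<in> dsum (B i) (e i) G j"
      using graded_group_diff[OF graded_group_dsum[OF graded_group_G] x] by simp
    have "x - lincomb (*) (D i) (homog (e (Suc i)) j g) = homog (e i) j (x - lincomb (*) (D i) g)"
      by (simp only: homog_diff homog_id[OF x] homog_lincomb[OF g(1) D])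
    moreover have "(x - lincomb (*) (D i) g) b \<in> I" for b using g(2) by (simp add: cvec_eq)
    ultimately have "(x - lincomb (*) (D i) (homog (e (Suc i)) j g)) b \<in> I" for b using homog_I by presburger
    then show ?thesis using d y dsum_I by blast
  qed
  have cycle: "cvec x \<in> a_kernel (free_module A (B (Suc i))) (free_module A (B i)) (bdry F i)"
    if x: "x \<in> finsupp (B (Suc i))" and d: "\<And>b. lincomb (*) (D i) x b \<in> I" for i x
    unfolding ker using cvec_in[OF x] bd[OF x] d by (simp add: fm_zero cvec_eq)
  have RR: "residue_resolution G pieces B e D \<alpha>"
  proof
    show "gmodule (*) pieces" by (rule gmodule_pieces)
    show "pieces j \<subseteq> G j" for j by (simp add: pieces_def)
    show "D i b \<in> dsum (B i) (e i) G (e (Suc i) b)" if "b \<in> B (Suc i)" for b i using D[OF that] .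
    show "lincomb (*) (D i) (D (Suc i) b) \<in> dsum (B i) (e i) pieces (e (Suc (Suc i)) b)" if b: "b \<in> B (Suc (Suc i))" for b i
    proof -
      have Db: "D (Suc i) b \<in> dsum (B (Suc i)) (e (Suc i)) G (e (Suc (Suc i)) b)" using D[OF b] .
      have "lincomb (*) (D i) (D (Suc i) b) \<in> dsum (B i) (e i) G (e (Suc (Suc i)) b + 0)"
        by (rule lincomb_dsum[OF module_mult graded_group_G mult_in_G Db]) (use D in auto)
      moreover have "cvec (D (Suc i) b) \<in> a_kernel (free_module A (B (Suc i))) (free_module A (B i)) (bdry F i)"
        unfolding exS[symmetric] using Du[OF b] cvec_in[OF dsum_finsupp[OF basis_vec_in[OF b]]] by (metis imageI)
      then have "bdry F i (cvec (D (Suc i) b)) = cvec 0" unfolding ker fm_zero by blast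
      then have "cvec (lincomb (*) (D i) (D (Suc i) b)) = cvec 0" using bd[OF dsum_finsupp[OF Db]] by simp
      ultimately show ?thesis by (simp add: dsum_I cvec_eq)
    qed
    show "\<exists>y\<in>dsum (B 1) (e 1) G j. x - lincomb (*) (D 0) y \<in> dsum (B 0) (e 0) pieces j"
      if "0 < j" and x: "x \<in> dsum (B 0) (e 0) G j" for j x
    proof -
      have "cvec x \<in> free_part A gr (B 0) (e 0) j" unfolding free_part_eq using x by blast
      from aug_deg[OF \<open>0 < j\<close> this] have "cvec x \<in> a_kernel (free_module A (B 0)) (resmod A gr) (aug F)"
        unfolding ker using cvec_in[OF dsum_finsupp[OF x]] by blast
      then show ?thesis using lift[OF x] unfolding ex0[symmetric] by simp
    qed
    show "\<exists>y\<in>dsum (B (Suc (Suc i))) (e (Suc (Suc i))) G j.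
        x - lincomb (*) (D (Suc i)) y \<in> dsum (B (Suc i)) (e (Suc i)) pieces j"
      if x: "x \<in> dsum (B (Suc i)) (e (Suc i)) G j" and dx: "lincomb (*) (D i) x \<in> dsum (B i) (e i) pieces j" for i j x
      by (rule lift[OF x]) (unfold exS, rule cycle[OF dsum_finsupp[OF x]], use dx in \<open>simp add: dsum_I\<close>)
    show "\<alpha> b \<in> G 0" if "b \<in> B 0" for b by (rule al(1)[OF that])
    show "\<alpha> b = 0" if "b \<in> B 0" "e 0 b \<noteq> 0" for b by (rule al(2)[OF that])
    have al_in: "lincomb (*) (\<lambda>c _. \<alpha> c) x 0 \<in> G j" if x: "x \<in> dsum (B 0) (e 0) G j" for x j
      unfolding lincomb_def
    proof (rule graded_group_sum[OF graded_group_G])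
      fix b assume "b \<in> {b. x b \<noteq> 0}"
      then have b: "b \<in> B 0" "x b \<in> G (j - e 0 b)" using dsum_in'[OF x, of b] by auto
      show "\<alpha> b * x b \<in> G j"
        using al[OF b(1)] mult_in_G[of "\<alpha> b" 0 "x b" j] b(2) graded_group_0[OF graded_group_G]
        by (cases "e 0 b = 0") auto
    qed
    show "lincomb (*) (\<lambda>c _. \<alpha> c) (D 0 b) 0 \<in> irr (e 1 b)" if b: "b \<in> B 1" for b
    proof (rule pos_irr)
      have b': "b \<in> B (Suc 0)" using b by simp
      show "lincomb (*) (\<lambda>c _. \<alpha> c) (D 0 b) 0 \<in> G (e 1 b)" using al_in[OF D[OF b']] by simp
      have "cvec (D 0 b) \<in> a_kernel (free_module A (B 0)) (resmod A gr) (aug F)"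
        unfolding ex0[symmetric] using Du[OF b'] cvec_in[OF dsum_finsupp[OF basis_vec_in[OF b]]] by (metis imageI)
      then have "res (lincomb (*) (\<lambda>c _. \<alpha> c) (D 0 b) 0) = res 0"
        unfolding ker resmod_zero using ag[OF dsum_finsupp[OF D[OF b']]] by simp
      then show "lincomb (*) (\<lambda>c _. \<alpha> c) (D 0 b) 0 \<in> pos" by (simp add: res_eq)
    qed
    show "\<exists>u\<in>dsum (B 0) (e 0) G 0. lincomb (*) (\<lambda>c _. \<alpha> c) u 0 = 1"
    proof -
      have "res 1 \<in> carrier (resmod A gr)" by (simp add: resmod_carrier)
      then have "res 1 \<in> aug F ` carrier (free_module A (B 0))" by (simp only: onto)
      then obtain u where "u \<in> carrier (free_module A (B 0))" "res 1 = aug F u" by (rule imageE)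
      then obtain g where g: "g \<in> finsupp (B 0)" "res 1 = aug F (cvec g)" unfolding fm_carrier by blast
      then have g1: "1 - lincomb (*) (\<lambda>c _. \<alpha> c) g 0 \<in> pos" using ag by (simp add: res_eq)
      let ?u = "homog (e 0) 0 g"
      have "lincomb (*) (\<lambda>c _. \<alpha> c) ?u 0 = (\<Sum>b | g b \<noteq> 0. \<alpha> b * ?u b)"
        by (rule lincomb_superset[OF module_mult]) (use g(1) in \<open>auto simp: finsupp_def homog_def\<close>)
      also have "\<dots> = (\<Sum>b | g b \<noteq> 0. comp 0 (\<alpha> b * g b))"
      proof (rule sum.cong[OF refl])
        fix b assume "b \<in> {b. g b \<noteq> 0}"
        then have "b \<in> B 0" using g(1) by (auto simp: finsupp_def)
        then show "\<alpha> b * ?u b = comp 0 (\<alpha> b * g b)"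
          using al[of b] comp_mult[of "\<alpha> b" 0 0 "g b"] by (cases "e 0 b = 0") (auto simp: homog_def)
      qed
      also have "\<dots> = comp 0 (lincomb (*) (\<lambda>c _. \<alpha> c) g 0)" by (simp add: lincomb_def comp_sum')
      also have "\<dots> = 1" using g1 comp_hom[OF one_in_G, of 0] by (simp add: pos_def comp_diff)
      finally show ?thesis using homog_in[OF g(1)] by blast
    qed
  qed
  moreover have "residue_resolution.tor_zero B e D (*) G irr i j" if ij: "i < j" for i j
    unfolding residue_resolution.tor_zero_def[OF RR] residue_resolution.cycle_def[OF RR]
  proof (intro ballI impI)
    fix x assume x: "x \<in> dsum (B i) (e i) G j"
      and cx: "\<forall>l. i = Suc l \<longrightarrow> lincomb (*) (D l) x \<in> dsum (B l) (e l) irr j"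
    have irrM: "f \<in> irr q \<Longrightarrow> f \<in> pos" for f q using comp_hom[of f q 0] by (auto simp: irr_def pos_def split: if_splits)
    have "cvec x \<in> tor_cycles A gr F i j"
    proof -
      have "cvec x \<in> term_part A gr F i j" unfolding free_part_eq B_def[symmetric] e_def[symmetric] using x by blast
      moreover have "bdry F l (cvec x) \<in> irrel_part A gr (basis F l)" if l: "i = Suc l" for l
      proof -
        have d: "lincomb (*) (D l) x \<in> dsum (B l) (e l) irr j" using cx l by blast
        have xl: "x \<in> finsupp (B (Suc l))" using dsum_finsupp[OF x] l by simp
        have "lincomb (*) (D l) x b \<in> pos" for b
          using dsum_in'[OF d, of b] irrM by (cases "lincomb (*) (D l) x b = 0") (auto simp: pos_def)
        then show ?thesis unfolding bd[OF xl] B_def[symmetric] using irrel_part_iff[OF dsum_finsupp[OF d]] by blast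
      qed
      ultimately show ?thesis by (cases i) (auto simp: tor_cycles_def)
    qed
    moreover have "\<zero>\<^bsub>term_mod A F i\<^esub> \<in> tor_boundaries A gr F i j"
    proof -
      have z: "(0 :: nat \<Rightarrow> 'r) \<in> dsum (B k) (e k) G j" for k
        by (rule graded_group_0[OF graded_group_dsum[OF graded_group_G]])
      have "bdry F i (cvec 0) = cvec 0"
        using bd[OF dsum_finsupp[OF z]] lincomb_0(1)[OF module_mult, of "D i"] by simp
      then have "\<zero>\<^bsub>term_mod A F i\<^esub> = bdry F i (cvec 0) \<oplus>\<^bsub>term_mod A F i\<^esub> cvec 0"
        by (simp add: fm_zero fm_add)
      moreover have "cvec 0 \<in> term_part A gr F k j" for k
        unfolding free_part_eq B_def[symmetric] e_def[symmetric] using z by blast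
      moreover have "cvec 0 \<in> irrel_part A gr (basis F i)"
        unfolding B_def[symmetric] using irrel_part_iff[OF dsum_finsupp[OF z]] by (simp add: pos_def)
      ultimately show ?thesis unfolding tor_boundaries_def by blast
    qed
    ultimately have "cvec x \<in> tor_boundaries A gr F i j"
      using cycle_is_boundary_if_trivial_tor[OF T, of i j "cvec x"] ij by (simp add: fm_zero fm_add)
    then obtain Y Z where YZ: "cvec x = bdry F i Y \<oplus>\<^bsub>term_mod A F i\<^esub> Z" "Y \<in> term_part A gr F (Suc i) j"
      "Z \<in> term_part A gr F i j" "Z \<in> irrel_part A gr (basis F i)"
      unfolding tor_boundaries_def by blast
    from YZ(2) obtain y where y: "y \<in> dsum (B (Suc i)) (e (Suc i)) G j" "Y = cvec y"
      unfolding free_part_eq B_def[symmetric] e_def[symmetric] by blast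
    from YZ(3) obtain z where z: "z \<in> dsum (B i) (e i) G j" "Z = cvec z"
      unfolding free_part_eq B_def[symmetric] e_def[symmetric] by blast
    have zM: "z b \<in> pos" for b using YZ(4) irrel_part_iff[OF dsum_finsupp[OF z(1)]] z(2) unfolding B_def by blast
    have "cvec x = cvec (lincomb (*) (D i) y + z)"
      using YZ(1) bd[OF dsum_finsupp[OF y(1)]] unfolding y(2) z(2) by (simp add: fm_add)
    then have "x b - (lincomb (*) (D i) y + z) b \<in> I" for b by (simp add: cvec_eq)
    then have m: "x b - (lincomb (*) (D i) y + z) b + z b \<in> pos" for b
      using I_pos[of "x b - (lincomb (*) (D i) y + z) b"] zM[of b]
      unfolding pos_def mem_Collect_eq comp_add by simp
    have "lincomb (*) (D i) y \<in> dsum (B i) (e i) G (j + 0)"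
      by (rule lincomb_dsum[OF module_mult graded_group_G mult_in_G y(1)]) (use D in auto)
    then have d: "x - lincomb (*) (D i) y \<in> dsum (B i) (e i) G j"
      using graded_group_diff[OF graded_group_dsum[OF graded_group_G] x] by simp
    have "(x - lincomb (*) (D i) y) b \<in> pos" for b using m[of b] by simp
    then have "x - lincomb (*) (D i) y \<in> dsum (B i) (e i) irr j"
      using d pos_irr by (auto simp: dsum_def shift_def pos_irr)
    then show "\<exists>y\<in>dsum (B (Suc i)) (e (Suc i)) G j. x - lincomb (*) (D i) y \<in> dsum (B i) (e i) irr j"
      using y(1) by blast
  qed
  ultimately show ?thesis by blast
qed

lemma homogeneous_decomposition:
  assumes f: "f \<in> finsupp B"
  obtains K where "finite K" "f = (\<Sum>j\<in>K. homog e j f)"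
proof
  let ?S = "{b. f b \<noteq> 0}"
  let ?K = "\<Union>b\<in>?S. (\<lambda>d. e b + d) ` {d. comp d (f b) \<noteq> 0}"
  show K: "finite ?K" using finsupp_finite[OF f] comp_fin by blast
  show "f = (\<Sum>j\<in>?K. homog e j f)"
  proof
    fix b
    have "(\<Sum>j\<in>?K. homog e j f) b = (\<Sum>j\<in>?K. homog e j f b)"
      by (induction rule: infinite_finite_induct) auto
    also have "\<dots> = (\<Sum>j\<in>(\<lambda>d. e b + d) ` {d. comp d (f b) \<noteq> 0}. homog e j f b)"
    proof (rule sum.mono_neutral_right[OF K])
      show "(\<lambda>d. e b + d) ` {d. comp d (f b) \<noteq> 0} \<subseteq> ?K" by (cases "f b = 0") auto
      show "\<forall>j\<in>?K - (\<lambda>d. e b + d) ` {d. comp d (f b) \<noteq> 0}. homog e j f b = 0"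
      proof
        fix j assume "j \<in> ?K - (\<lambda>d. e b + d) ` {d. comp d (f b) \<noteq> 0}"
        then have n: "j \<notin> (\<lambda>d. e b + d) ` {d. comp d (f b) \<noteq> 0}" by blast
        show "homog e j f b = 0"
        proof (cases "e b \<le> j")
          case True
          then have "j = e b + (j - e b)" by simp
          then have "comp (j - e b) (f b) = 0" using n by blast
          then show ?thesis by (simp add: homog_def)
        qed (simp add: homog_def)
      qed
    qed
    also have "\<dots> = (\<Sum>d | comp d (f b) \<noteq> 0. comp d (f b))"
      by (subst sum.reindex) (auto simp: homog_def)
    also have "\<dots> = f b" by (rule comp_sum)
    finally show "f b = (\<Sum>j\<in>?K. homog e j f) b" by simp
  qed
qed

lemma finsupp_add: "f \<in> finsupp B \<Longrightarrow> g \<in> finsupp B \<Longrightarrow> f + g \<in> finsupp B"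
proof -
  assume f: "f \<in> finsupp B" and g: "g \<in> finsupp B"
  have "finite {b. (f + g) b \<noteq> 0}"
    by (rule finite_subset[of _ "{b. f b \<noteq> 0} \<union> {b. g b \<noteq> 0}"]) (use f g in \<open>auto simp: finsupp_def\<close>)
  then show ?thesis using f g by (auto simp: finsupp_def)
qed

text \<open>
  Exactness for homogeneous elements gives exactness for all elements, one component at a time.
\<close>

lemma lift_nonhomogeneous:
  assumes N: "\<And>b. b \<in> B \<Longrightarrow> N b \<in> dsum B' e' G (e b)" and f: "f \<in> finsupp B'"
    and lift: "\<And>j. \<exists>y\<in>dsum B e G j. homog e' j f - lincomb (*) N y \<in> dsum B' e' pieces j"
  shows "\<exists>y\<in>finsupp B. cvec f = cvec (lincomb (*) N y)"
proof -
  obtain K where K: "finite K" "f = (\<Sum>j\<in>K. homog e' j f)" using homogeneous_decomposition[OF f] .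
  obtain y where y: "\<And>j. y j \<in> dsum B e G j" "\<And>j. homog e' j f - lincomb (*) N (y j) \<in> dsum B' e' pieces j"
    using lift by metis
  have "sum y L \<in> finsupp B \<and> (\<forall>b. ((\<Sum>j\<in>L. homog e' j f) - lincomb (*) N (sum y L)) b \<in> I)" if "finite L" for L
    using that
  proof (induction L rule: finite_induct)
    case empty
    then show ?case using lincomb_0[OF module_mult, of N] I_zero by (simp add: finsupp_def)
  next
    case (insert j L)
    have yj: "y j \<in> finsupp B" by (rule dsum_finsupp[OF y(1)])
    have ad: "lincomb (*) N (y j + sum y L) = lincomb (*) N (y j) + lincomb (*) N (sum y L)"
      by (rule lincomb_add[OF module_mult]) (use yj insert in \<open>auto simp: finsupp_def\<close>)
    have "(homog e' j f - lincomb (*) N (y j)) b \<in> I" for b using y(2)[of j] by (simp add: dsum_I)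
    then have "(homog e' j f - lincomb (*) N (y j)) b - (0 - ((\<Sum>j\<in>L. homog e' j f) - lincomb (*) N (sum y L)) b) \<in> I" for b
      using insert.IH I_diff I_zero by blast
    then have "((\<Sum>j\<in>insert j L. homog e' j f) - lincomb (*) N (sum y (insert j L))) b \<in> I" for b
      using insert.hyps by (simp add: ad algebra_simps)
    moreover have "sum y (insert j L) \<in> finsupp B" using insert finsupp_add[OF yj] by simp
    ultimately show ?case by blast
  qed
  from this[OF K(1)] K(2) have "sum y K \<in> finsupp B" "\<forall>b. (f - lincomb (*) N (sum y K)) b \<in> I" by auto
  then show ?thesis by (auto simp: cvec_eq)
qed

lemma trivial_quotient:
  assumes "group H" shows "trivial_group (H Mod carrier H)"
proof -
  interpret group H by (rule assms)
  have sub: "subgroup (carrier H) H" by (rule subgroup_self)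
  have n: "carrier H \<lhd> H"
    by (rule normal_invI[OF sub]) simp
  have "rcosets\<^bsub>H\<^esub> (carrier H) = {carrier H}"
    using coset_join2[OF _ sub] one_closed by (auto simp: RCOSETS_def)
  then show ?thesis
    using normal.factorgroup_is_group[OF n] by (simp add: trivial_group_def FactGroup_def)
qed

text \<open>
  In a linear resolution the \<open>i\<close>-th free module is generated in degree \<open>i\<close>. So for \<open>i \<noteq> j\<close> all its elements of degree \<open>j\<close> have
  coordinates in the irrelevant ideal, which makes them boundaries in the quotient that defines \<open>Tor\<close>.
\<close>

theorem linear_resolution_imp_koszul:
  assumes lr: "linear_resolution pieces n E"
  shows "koszul A gr"
proof -
  let ?F = "\<lambda>i. free_module A {..<n i}"
  have n0: "n 0 = 1" using lr by (simp add: linear_resolution_def)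
  note L1 = conjunct2[OF lr[unfolded linear_resolution_def One_nat_def]]
  have E: "E i b \<in> free_mod (n i) i G (Suc i)" if "b < n (Suc i)" for i b
    using L1[THEN conjunct1] that by simp
  note L2 = conjunct2[OF L1]
  have EE: "lincomb (*) (E i) (E (Suc i) b) \<in> free_mod (n i) i pieces (Suc (Suc i))" if "b < n (Suc (Suc i))" for i b
    using L2[THEN conjunct1] that by simp
  note L3 = conjunct2[OF L2]
  have ex0: "\<And>j x. 0 < j \<Longrightarrow> x \<in> free_mod (n 0) 0 G j \<Longrightarrow>
      \<exists>y\<in>free_mod (n (Suc 0)) (Suc 0) G j. x - lincomb (*) (E 0) y \<in> free_mod (n 0) 0 pieces j"
    using L3[THEN conjunct1] by (simp only: simp_thms)
  have exS: "\<And>i j x. x \<in> free_mod (n (Suc i)) (Suc i) G j \<Longrightarrow> lincomb (*) (E i) x \<in> free_mod (n i) i pieces j \<Longrightarrow>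
      \<exists>y\<in>free_mod (n (Suc (Suc i))) (Suc (Suc i)) G j.
        x - lincomb (*) (E (Suc i)) y \<in> free_mod (n (Suc i)) (Suc i) pieces j"
    using L3[THEN conjunct2] by (simp only: simp_thms)
  have Efs: "b \<in> {..<n (Suc i)} \<Longrightarrow> E i b \<in> finsupp {..<n i}" for i b using dsum_finsupp[OF E] by simp
  \<comment> \<open>The differentials act on representatives; on vectors over the quotient the choice does not matter.\<close>
  define bd where "bd i x = (if x \<in> carrier (?F (Suc i))
      then cvec (lincomb (*) (E i) (\<lambda>b. repr (x b))) else undefined)" for i x
  define ag where "ag x = res (repr (x 0))" for x :: "nat \<Rightarrow> 'r set"
  define F where "F = \<lparr>basis = \<lambda>i. {..<n i}, bdeg = \<lambda>i b. i, bdry = bd, aug = ag\<rparr>"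
  have F_sel: "basis F i = {..<n i}" "bdeg F i = (\<lambda>_. i)" "bdry F = bd" "aug F = ag" for i
    by (simp_all add: F_def fun_eq_iff)
  have bd: "bd i (cvec f) = cvec (lincomb (*) (E i) f)" if f: "f \<in> finsupp {..<n (Suc i)}" for i f
  proof -
    let ?g = "\<lambda>b. repr (cvec f b)"
    have c: "cvec f \<in> carrier (?F (Suc i))" by (rule cvec_in[OF f])
    have g: "?g \<in> finsupp {..<n (Suc i)}" by (rule finsupp_repr[OF c])
    have "cvec ?g = cvec f" by (rule cvec_repr[OF c])
    then have d: "?g b - f b \<in> I" for b by (simp add: cvec_eq)
    have "lincomb (*) (E i) ?g - lincomb (*) (E i) f = lincomb (*) (E i) (?g - f)"
      by (rule lincomb_diff[OF module_mult finsupp_finite[OF g] finsupp_finite[OF f], symmetric])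
    moreover have "lincomb (*) (E i) (?g - f) b \<in> I" for b
      unfolding lincomb_def by (rule I_sum) (use d I_mult in simp)
    ultimately have "(lincomb (*) (E i) ?g - lincomb (*) (E i) f) b \<in> I" for b by simp
    then have "cvec (lincomb (*) (E i) ?g) = cvec (lincomb (*) (E i) f)" by (simp add: cvec_eq)
    then show ?thesis using c by (simp add: bd_def)
  qed
  have ag: "ag (cvec f) = res (f 0)" for f
  proof -
    have "cl (repr (cl (f 0))) = cl (f 0)" by (rule class_repr) (simp add: A_carrier)
    then show ?thesis using I_pos by (simp add: ag_def cvec_def res_eq class_eq)
  qed
  have lincomb_in: "lincomb (*) (E i) f \<in> finsupp {..<n i}" if "f \<in> finsupp {..<n (Suc i)}" for f i
    by (rule lincomb_finsupp[OF that Efs])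
  have lincomb_deg: "lincomb (*) (E i) f \<in> free_mod (n i) i G j" if "f \<in> free_mod (n (Suc i)) (Suc i) G j" for f i j
  proof -
    have "lincomb (*) (E i) f \<in> free_mod (n i) i G (j + 0)"
      by (rule lincomb_dsum[OF module_mult graded_group_G mult_in_G that]) (use E in auto)
    then show ?thesis by simp
  qed
  have lincomb_M: "lincomb (*) (E i) f c \<in> pos" if f: "f \<in> finsupp {..<n (Suc i)}" for f i c
  proof -
    have "comp 0 (lincomb (*) (E i) f c) = (\<Sum>b | f b \<noteq> 0. comp 0 (E i b c * f b))"
      by (simp add: lincomb_def comp_sum')
    also have "\<dots> = 0"
    proof (rule sum.neutral, rule ballI)
      fix b assume "b \<in> {b. f b \<noteq> 0}"
      then have b: "b < n (Suc i)" using f by (auto simp: finsupp_def)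
      show "comp 0 (E i b c * f b) = 0"
        using dsum_in'[OF E[OF b], of c] comp_mult[of "E i b c" 1 0 "f b"] by (cases "E i b c = 0") auto
    qed
    finally show ?thesis by (simp add: pos_def)
  qed
  have ker: "x \<in> a_kernel P Q h \<longleftrightarrow> x \<in> carrier P \<and> h x = \<zero>\<^bsub>Q\<^esub>"
    for x h and P :: "('r set, nat \<Rightarrow> 'r set) module" and Q :: "('r set, 'y) module"
    by (simp add: a_kernel_def kernel_def)
  have finsupp_scale: "(\<lambda>b. a * f b) \<in> finsupp B" if "f \<in> finsupp B" for a f B
  proof -
    have "finite {b. a * f b \<noteq> 0}" by (rule finite_subset[OF _ finsupp_finite[OF that]]) auto
    then show ?thesis using that by (auto simp: finsupp_def)
  qed
  have "graded_free_resolution A gr F"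
    unfolding graded_free_resolution_def F_sel
  proof (intro conjI allI impI ballI)
    show "ag \<in> module_hom A (?F 0) (resmod A gr)"
      unfolding module_hom_def hom_def
      by (auto simp: fm_carrier A_carrier resmod_carrier fm_add fm_smult resmod_add resmod_smult ag)
    show "bd i \<in> module_hom A (?F (Suc i)) (?F i)" for i
    proof -
      have "bd i x \<in> carrier (?F i)" if "x \<in> carrier (?F (Suc i))" for x
        using that bd lincomb_in unfolding fm_carrier by auto
      moreover have "bd i (x \<oplus>\<^bsub>?F (Suc i)\<^esub> y) = bd i x \<oplus>\<^bsub>?F i\<^esub> bd i y"
        if xy: "x \<in> carrier (?F (Suc i))" "y \<in> carrier (?F (Suc i))" for x y
      proof -
        obtain f g where f: "f \<in> finsupp {..<n (Suc i)}" "x = cvec f" and g: "g \<in> finsupp {..<n (Suc i)}" "y = cvec g"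
          using xy unfolding fm_carrier by blast
        have "lincomb (*) (E i) (f + g) = lincomb (*) (E i) f + lincomb (*) (E i) g"
          by (rule lincomb_add[OF module_mult finsupp_finite[OF f(1)] finsupp_finite[OF g(1)]])
        then show ?thesis by (simp only: f(2) g(2) fm_add bd[OF finsupp_add[OF f(1) g(1)]] bd[OF f(1)] bd[OF g(1)])
      qed
      moreover have "bd i (a \<odot>\<^bsub>?F (Suc i)\<^esub> x) = a \<odot>\<^bsub>?F i\<^esub> bd i x"
        if ax: "a \<in> carrier A" "x \<in> carrier (?F (Suc i))" for a x
      proof -
        obtain f c where f: "f \<in> finsupp {..<n (Suc i)}" "x = cvec f" and c: "a = cl c"
          using ax unfolding fm_carrier A_carrier by blast
        have "lincomb (*) (E i) (\<lambda>b. c * f b) = (\<lambda>b. c * lincomb (*) (E i) f b)"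
          by (rule lincomb_scale[OF module_mult finsupp_finite[OF f(1)]])
        then show ?thesis by (simp only: f(2) c fm_smult bd[OF finsupp_scale[OF f(1)]] bd[OF f(1)])
      qed
      ultimately show ?thesis by (auto simp: module_hom_def hom_def)
    qed
    show "ag x = \<zero>\<^bsub>resmod A gr\<^esub>" if j: "0 < j" and x: "x \<in> free_part A gr {..<n 0} (\<lambda>_. 0) j" for j x
    proof -
      obtain f where f: "f \<in> free_mod (n 0) 0 G j" "x = cvec f" using x unfolding free_part_eq by blast
      have "f 0 \<in> pos" using dsum_in'[OF f(1), of 0] comp_hom[of "f 0" j 0] \<open>0 < j\<close>
        by (cases "f 0 = 0") (auto simp: pos_def)
      then show ?thesis unfolding f(2) ag resmod_zero res_eq by simp
    qed
    show "bd i ` free_part A gr {..<n (Suc i)} (\<lambda>_. Suc i) j \<subseteq> free_part A gr {..<n i} (\<lambda>_. i) j" for i j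
      unfolding free_part_eq using lincomb_deg bd[OF dsum_finsupp] by (auto simp: image_iff)
    show "ag ` carrier (?F 0) = carrier (resmod A gr)"
    proof
      show "ag ` carrier (?F 0) \<subseteq> carrier (resmod A gr)"
        by (auto simp: fm_carrier resmod_carrier ag)
      show "carrier (resmod A gr) \<subseteq> ag ` carrier (?F 0)"
      proof
        fix u assume "u \<in> carrier (resmod A gr)"
        then obtain f where "u = res f" by (auto simp: resmod_carrier)
        then have "u = ag (cvec (\<lambda>b. if b = 0 then f else 0))" by (simp add: ag)
        moreover have "(\<lambda>b. if b = 0 then f else 0) \<in> finsupp {..<n 0}" using n0 by (auto simp: finsupp_def)
        ultimately show "u \<in> ag ` carrier (?F 0)" unfolding fm_carrier by blast
      qed
    qed
    show "bd 0 ` carrier (?F 1) = a_kernel (?F 0) (resmod A gr) ag"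
    proof
      show "bd 0 ` carrier (?F 1) \<subseteq> a_kernel (?F 0) (resmod A gr) ag"
      proof
        fix u assume "u \<in> bd 0 ` carrier (?F 1)"
        then obtain f where f: "f \<in> finsupp {..<n (Suc 0)}" "u = cvec (lincomb (*) (E 0) f)"
          using bd unfolding fm_carrier by auto
        show "u \<in> a_kernel (?F 0) (resmod A gr) ag"
          unfolding ker f(2) ag resmod_zero res_eq using cvec_in[OF lincomb_in[OF f(1)]] lincomb_M[OF f(1)] by simp
      qed
      show "a_kernel (?F 0) (resmod A gr) ag \<subseteq> bd 0 ` carrier (?F 1)"
      proof
        fix u assume "u \<in> a_kernel (?F 0) (resmod A gr) ag"
        then obtain f where f: "f \<in> finsupp {..<n 0}" "u = cvec f" "res (f 0) = res 0"
          unfolding ker fm_carrier resmod_zero using ag by auto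
        then have f0: "comp 0 (f 0) = 0" by (simp add: res_eq pos_def)
        have "\<exists>y\<in>free_mod (n (Suc 0)) (Suc 0) G j. homog (\<lambda>_. 0) j f - lincomb (*) (E 0) y \<in> free_mod (n 0) 0 pieces j" for j
        proof (cases "j = 0")
          case True
          have "homog (\<lambda>_. 0) j f b = 0" for b
            using f0 f(1) n0 True by (cases "b = 0") (auto simp: homog_def finsupp_def)
          then have "homog (\<lambda>_. 0) j f = 0" by auto
          then show ?thesis
            using graded_group_0[OF graded_group_dsum[OF graded_group_G]] lincomb_0(1)[OF module_mult, of "E 0"]
              graded_group_0[OF graded_group_dsum[OF gmodule_group[OF gmodule_pieces]]]
            by (intro bexI[of _ 0]) simp_all
        next
          case False
          then show ?thesis using ex0 homog_in[OF f(1)] by simp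
        qed
        then obtain y where y: "y \<in> finsupp {..<n (Suc 0)}" "cvec f = cvec (lincomb (*) (E 0) y)"
          using lift_nonhomogeneous[of "{..<n (Suc 0)}" "E 0" "{..<n 0}" "\<lambda>_. 0" "\<lambda>_. Suc 0", OF _ f(1)] E by auto
        then show "u \<in> bd 0 ` carrier (?F 1)"
          using imageI[OF cvec_in[OF y(1)], of "bd 0"] f(2) bd[OF y(1)] by simp
      qed
    qed
    show "bd (Suc i) ` carrier (?F (Suc (Suc i)))
        = a_kernel (?F (Suc i)) (?F i) (bd i)" for i
    proof
      show "bd (Suc i) ` carrier (?F (Suc (Suc i)))
        \<subseteq> a_kernel (?F (Suc i)) (?F i) (bd i)"
      proof
        fix u assume "u \<in> bd (Suc i) ` carrier (?F (Suc (Suc i)))"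
        then obtain f where f: "f \<in> finsupp {..<n (Suc (Suc i))}" "u = cvec (lincomb (*) (E (Suc i)) f)"
          using bd unfolding fm_carrier by auto
        have "lincomb (*) (E i) (lincomb (*) (E (Suc i)) f) = lincomb (*) (\<lambda>b. lincomb (*) (E i) (E (Suc i) b)) f"
          by (rule lincomb_lincomb[OF module_mult finsupp_finite[OF f(1)]]) (use finsupp_finite[OF Efs] f(1) in \<open>auto simp: finsupp_def\<close>)
        moreover have "lincomb (*) (\<lambda>b. lincomb (*) (E i) (E (Suc i) b)) f c \<in> I" for c
          unfolding lincomb_def[of _ "\<lambda>b. lincomb (*) (E i) (E (Suc i) b)"]
        proof (rule I_sum)
          fix b assume "b \<in> {b. f b \<noteq> 0}"
          then have "b < n (Suc (Suc i))" using f(1) by (auto simp: finsupp_def)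
          then have "lincomb (*) (E i) (E (Suc i) b) c \<in> I" using EE by (simp add: dsum_I)
          then show "lincomb (*) (E i) (E (Suc i) b) c * f b \<in> I"
            using I_mult[of "lincomb (*) (E i) (E (Suc i) b) c" "f b"] by (simp add: mult.commute)
        qed
        ultimately show "u \<in> a_kernel (?F (Suc i)) (?F i) (bd i)"
          unfolding ker f(2) bd[OF lincomb_in[OF f(1)]] fm_zero cvec_eq using cvec_in[OF lincomb_in[OF f(1)]] by simp
      qed
      show "a_kernel (?F (Suc i)) (?F i) (bd i)
        \<subseteq> bd (Suc i) ` carrier (?F (Suc (Suc i)))"
      proof
        fix u assume "u \<in> a_kernel (?F (Suc i)) (?F i) (bd i)"
        then obtain f where f: "f \<in> finsupp {..<n (Suc i)}" "u = cvec f" "cvec (lincomb (*) (E i) f) = cvec 0"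
          unfolding ker fm_carrier fm_zero using bd by auto
        have I: "lincomb (*) (E i) f b \<in> I" for b using f(3) by (simp add: cvec_eq)
        have "\<exists>y\<in>free_mod (n (Suc (Suc i))) (Suc (Suc i)) G j.
            homog (\<lambda>_. Suc i) j f - lincomb (*) (E (Suc i)) y \<in> free_mod (n (Suc i)) (Suc i) pieces j" for j
        proof (rule exS[OF homog_in[OF f(1)]])
          have "lincomb (*) (E i) (homog (\<lambda>_. Suc i) j f) = homog (\<lambda>_. i) j (lincomb (*) (E i) f)"
            by (rule homog_lincomb[OF f(1), symmetric]) (use E in auto)
          then show "lincomb (*) (E i) (homog (\<lambda>_. Suc i) j f) \<in> free_mod (n i) i pieces j"
            using homog_in[OF lincomb_in[OF f(1)]] homog_I I by (simp add: dsum_I)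
        qed
        then obtain y where y: "y \<in> finsupp {..<n (Suc (Suc i))}" "cvec f = cvec (lincomb (*) (E (Suc i)) y)"
          using lift_nonhomogeneous[of "{..<n (Suc (Suc i))}" "E (Suc i)" "{..<n (Suc i)}" "\<lambda>_. Suc i" "\<lambda>_. Suc (Suc i)", OF _ f(1)] E
          by auto
        then show "u \<in> bd (Suc i) ` carrier (?F (Suc (Suc i)))"
          using imageI[OF cvec_in[OF y(1)], of "bd (Suc i)"] f(2) bd[OF y(1)] by simp
      qed
    qed
  qed
  moreover have "trivial_group (tor A gr F i j)" if ij: "i \<noteq> j" for i j
  proof -
    define C where "C = cvec ` free_mod (n i) i G j"
    have tp: "term_part A gr F k j = cvec ` free_mod (n k) k G j" for k
      by (simp add: F_sel free_part_eq)
    have xM: "x b \<in> pos" if x: "x \<in> free_mod (n i) i G j" for x b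
      using dsum_in'[OF x, of b] comp_hom[of "x b" "j - i" 0] ij by (cases "x b = 0") (auto simp: pos_def)
    have sub: "graded_group (free_mod (n i) i G)" by (rule graded_group_dsum[OF graded_group_G])
    have cyc: "tor_cycles A gr F i j = C"
    proof
      show "tor_cycles A gr F i j \<subseteq> C" by (auto simp: tor_cycles_def tp C_def)
      show "C \<subseteq> tor_cycles A gr F i j"
      proof
        fix u assume "u \<in> C"
        then obtain x where x: "x \<in> free_mod (n i) i G j" "u = cvec x" by (auto simp: C_def)
        have "bdry F l u \<in> irrel_part A gr (basis F l)" if l: "i = Suc l" for l
        proof -
          have xl: "x \<in> finsupp {..<n (Suc l)}" using dsum_finsupp[OF x(1)] l by simp
          show ?thesis unfolding F_sel x(2) bd[OF xl] irrel_part_iff[OF lincomb_in[OF xl]] using lincomb_M[OF xl] by blast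
        qed
        then show "u \<in> tor_cycles A gr F i j"
          using x tp by (cases i) (auto simp: tor_cycles_def)
      qed
    qed
    have bnd: "tor_boundaries A gr F i j = C"
    proof
      show "tor_boundaries A gr F i j \<subseteq> C"
      proof
        fix u assume "u \<in> tor_boundaries A gr F i j"
        then obtain Y Z where u: "u = bd i Y \<oplus>\<^bsub>?F i\<^esub> Z"
          and Y: "Y \<in> term_part A gr F (Suc i) j" and Z: "Z \<in> term_part A gr F i j"
          unfolding tor_boundaries_def F_sel by blast
        obtain y where y: "y \<in> free_mod (n (Suc i)) (Suc i) G j" "Y = cvec y" using Y unfolding tp by blast
        obtain z where z: "z \<in> free_mod (n i) i G j" "Z = cvec z" using Z unfolding tp by blast
        have "u = cvec (lincomb (*) (E i) y + z)" unfolding u y(2) z(2) bd[OF dsum_finsupp[OF y(1)]] fm_add ..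
        moreover have "lincomb (*) (E i) y + z \<in> free_mod (n i) i G j"
          by (rule graded_group_add[OF sub lincomb_deg[OF y(1)] z(1)])
        ultimately show "u \<in> C" by (simp add: C_def)
      qed
      show "C \<subseteq> tor_boundaries A gr F i j"
      proof
        fix u assume "u \<in> C"
        then obtain x where x: "x \<in> free_mod (n i) i G j" "u = cvec x" by (auto simp: C_def)
        have z: "(0 :: nat \<Rightarrow> 'r) \<in> free_mod (n (Suc i)) (Suc i) G j"
          by (rule graded_group_0[OF graded_group_dsum[OF graded_group_G]])
        have "bd i (cvec 0) = cvec 0"
          unfolding bd[OF dsum_finsupp[OF z]] lincomb_0(1)[OF module_mult] ..
        then have "u = bdry F i (cvec 0) \<oplus>\<^bsub>term_mod A F i\<^esub> cvec x" unfolding F_sel x(2) by (simp add: fm_add)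
        moreover have "cvec 0 \<in> term_part A gr F (Suc i) j" unfolding tp using z by blast
        moreover have "cvec x \<in> term_part A gr F i j \<inter> irrel_part A gr (basis F i)"
          unfolding F_sel free_part_eq using x(1) irrel_part_iff[OF dsum_finsupp[OF x(1)]] xM[OF x(1)] by blast
        ultimately show "u \<in> tor_boundaries A gr F i j" unfolding tor_boundaries_def by blast
      qed
    qed
    let ?H = "add_monoid (?F i)\<lparr>carrier := C\<rparr>"
    have "group ?H"
    proof (rule groupI)
      fix u v w assume "u \<in> carrier ?H" "v \<in> carrier ?H" "w \<in> carrier ?H"
      then obtain x y z where x: "x \<in> free_mod (n i) i G j" "u = cvec x"
        and y: "y \<in> free_mod (n i) i G j" "v = cvec y" and z: "w = cvec z" by (auto simp: C_def)
      show "u \<otimes>\<^bsub>?H\<^esub> v \<in> carrier ?H"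
        using graded_group_add[OF sub x(1) y(1)] by (simp add: x(2) y(2) fm_add C_def)
      show "u \<otimes>\<^bsub>?H\<^esub> v \<otimes>\<^bsub>?H\<^esub> w = u \<otimes>\<^bsub>?H\<^esub> (v \<otimes>\<^bsub>?H\<^esub> w)"
        by (simp add: x(2) y(2) z fm_add add.assoc)
    next
      show "\<one>\<^bsub>?H\<^esub> \<in> carrier ?H" using graded_group_0[OF sub] by (simp add: fm_zero C_def)
    next
      fix u assume "u \<in> carrier ?H"
      then obtain x where x: "x \<in> free_mod (n i) i G j" "u = cvec x" by (auto simp: C_def)
      show "\<one>\<^bsub>?H\<^esub> \<otimes>\<^bsub>?H\<^esub> u = u" by (simp add: x(2) fm_zero fm_add)
      have "cvec (- x) \<in> carrier ?H" using graded_group_minus[OF sub x(1)] by (simp add: C_def)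
      moreover have "cvec (- x) \<otimes>\<^bsub>?H\<^esub> u = \<one>\<^bsub>?H\<^esub>" by (simp add: x(2) fm_zero fm_add)
      ultimately show "\<exists>y\<in>carrier ?H. y \<otimes>\<^bsub>?H\<^esub> u = \<one>\<^bsub>?H\<^esub>" by blast
    qed
    from trivial_quotient[OF this] show ?thesis unfolding tor_def cyc bnd F_sel by simp
  qed
  ultimately show ?thesis unfolding koszul_def by blast
qed

end

section \<open>Polynomials and points\<close>

lemma Quotient_proj_space: "Quotient3 proj_rel (abs_proj_space :: ('n \<Rightarrow> 'k::field) \<Rightarrow> _) rep_proj_space"
  by (rule Quotient3_proj_space)

abbreviation "lookup \<equiv> Poly_Mapping.lookup"
abbreviation "single \<equiv> Poly_Mapping.single"
abbreviation "keys \<equiv> Poly_Mapping.keys"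

definition total_degree :: "('n::finite \<Rightarrow>\<^sub>0 nat) \<Rightarrow> nat" where
  "total_degree t = (\<Sum>i\<in>UNIV. lookup t i)"

lemma forms_iff: "f \<in> forms d \<longleftrightarrow> (\<forall>t. lookup f t \<noteq> 0 \<longrightarrow> total_degree t = d)"
  by (auto simp: forms_def total_degree_def in_keys_iff)

lemma poly_mapping_sum_single: "f = (\<Sum>t\<in>keys f. single t (lookup f t))"
proof (rule poly_mapping_eqI)
  fix s
  have "lookup (\<Sum>t\<in>keys f. single t (lookup f t)) s
      = (\<Sum>t\<in>keys f. if t = s then lookup f t else 0)"
    unfolding lookup_sum by (rule sum.cong) (auto simp: lookup_single when_def)
  also have "\<dots> = lookup f s" by (simp add: sum.delta in_keys_iff)
  finally show "lookup f s
      = lookup (\<Sum>t\<in>keys f. single t (lookup f t)) s" by simp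
qed

definition component :: "nat \<Rightarrow> ('k::field, 'n::finite) mpolynomial \<Rightarrow> ('k, 'n) mpolynomial" where
  "component d f = Poly_Mapping.mapp (\<lambda>t c. if total_degree t = d then c else 0) f"

lemma lookup_component:
  "lookup (component d f) t = (if total_degree t = d then lookup f t else 0)"
  by (auto simp: component_def lookup_mapp when_def in_keys_iff)

lemma single_in_forms: "total_degree t = d \<Longrightarrow> single t c \<in> forms d"
  by (auto simp: forms_iff lookup_single when_def)

interpretation forms: graded_components "forms :: nat \<Rightarrow> ('k::field, 'n::finite) mpolynomial set" component
proof
  show "graded_group (forms :: nat \<Rightarrow> ('k, 'n) mpolynomial set)"
    unfolding graded_group_def
  proof (intro allI conjI ballI)
    fix j and x y :: "('k, 'n) mpolynomial" assume "x \<in> forms j" "y \<in> forms j"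
    then show "x - y \<in> forms j" unfolding forms_iff lookup_minus by (metis diff_0_right diff_self)
  qed (simp add: forms_def)
  show "(1 :: ('k, 'n) mpolynomial) \<in> forms 0"
    by (simp add: forms_def)
  show "a * b \<in> forms (i + j)" if "a \<in> forms i" "b \<in> forms j" for a b :: "('k, 'n) mpolynomial" and i j
    unfolding forms_def
  proof (intro CollectI ballI)
    fix t assume "t \<in> keys (a * b)"
    then obtain r s where "t = r + s" "r \<in> keys a" "s \<in> keys b"
      using keys_mult[of a b] by blast
    then show "(\<Sum>i\<in>UNIV. lookup t i) = i + j"
      using that by (simp add: forms_def lookup_add sum.distrib)
  qed
  show "component d f \<in> forms d" for d and f :: "('k, 'n) mpolynomial"
    by (simp add: forms_iff lookup_component)
  show "component d' f = (if d' = d then f else 0)" if "f \<in> forms d" for d d' and f :: "('k, 'n) mpolynomial"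
    using that by (intro poly_mapping_eqI) (auto simp: forms_iff lookup_component)
  show "component d (f + g) = component d f + component d g" for d and f g :: "('k, 'n) mpolynomial"
    by (intro poly_mapping_eqI) (auto simp: lookup_component lookup_add)
  show fin: "finite {d. component d f \<noteq> 0}" for f :: "('k, 'n) mpolynomial"
  proof (rule finite_subset)
    show "{d. component d f \<noteq> 0} \<subseteq> total_degree ` keys f"
    proof
      fix d assume "d \<in> {d. component d f \<noteq> 0}"
      then obtain t where "lookup (component d f) t \<noteq> 0"
        by (metis (mono_tags) lookup_zero mem_Collect_eq poly_mapping_eqI)
      then show "d \<in> total_degree ` keys f"
        by (auto simp: lookup_component in_keys_iff split: if_splits)
    qed
  qed simp
  show "(\<Sum>d | component d f \<noteq> 0. component d f) = f" for f :: "('k, 'n) mpolynomial"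
  proof (rule poly_mapping_eqI)
    fix t
    have "lookup (\<Sum>d | component d f \<noteq> 0. component d f) t
        = (\<Sum>d | component d f \<noteq> 0. if d = total_degree t then lookup f t else 0)"
      unfolding lookup_sum by (rule sum.cong) (auto simp: lookup_component)
    also have "\<dots> = (if component (total_degree t) f \<noteq> 0 then lookup f t else 0)"
      using fin by simp
    also have "\<dots> = lookup f t"
      using lookup_component[of "total_degree t" f t] by auto
    finally show "lookup (\<Sum>d | component d f \<noteq> 0. component d f) t = lookup f t" .
  qed
qed

definition eval_monom :: "('n::finite \<Rightarrow>\<^sub>0 nat) \<Rightarrow> ('n \<Rightarrow> 'k::field) \<Rightarrow> 'k" where
  "eval_monom t v = (\<Prod>i\<in>UNIV. v i ^ lookup t i)"

lemma eval_poly_superset: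
  "finite K \<Longrightarrow> keys f \<subseteq> K \<Longrightarrow> eval_poly f v = (\<Sum>t\<in>K. lookup f t * eval_monom t v)"
  unfolding eval_poly_def eval_monom_def by (rule sum.mono_neutral_left) (auto simp: in_keys_iff)

lemma eval_poly_0 [simp]: "eval_poly 0 v = 0"
  by (simp add: eval_poly_def)

lemma eval_poly_diff: "eval_poly (f - g) v = eval_poly f v - eval_poly g v"
proof -
  let ?K = "keys f \<union> keys g"
  have "keys (f - g) \<subseteq> ?K" by (auto simp: in_keys_iff lookup_minus)
  then show ?thesis
    by (subst (1 2 3) eval_poly_superset[of ?K]) (auto simp: lookup_minus left_diff_distrib sum_subtractf)
qed

lemma eval_poly_add: "eval_poly (f + g) v = eval_poly f v + eval_poly g v"
  using eval_poly_diff[of "f + g" g v] by simp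

lemma eval_poly_sum: "eval_poly (sum f K) v = (\<Sum>k\<in>K. eval_poly (f k) v)"
  by (induction K rule: infinite_finite_induct) (auto simp: eval_poly_add)

lemma eval_poly_single: "eval_poly (single t c) v = c * eval_monom t v"
  by (subst eval_poly_superset[of "{t}"]) auto

lemma eval_poly_mult: "eval_poly (f * g) v = eval_poly f v * eval_poly g v"
proof -
  let ?s = "\<lambda>f t. single t (lookup f t)"
  have "f * g = (\<Sum>s\<in>keys f. \<Sum>t\<in>keys g. ?s f s * ?s g t)"
    by (subst (1) poly_mapping_sum_single[of f], subst (1) poly_mapping_sum_single[of g]) (rule sum_product)
  then have "eval_poly (f * g) v = (\<Sum>s\<in>keys f. \<Sum>t\<in>keys g.
      (lookup f s * eval_monom s v) * (lookup g t * eval_monom t v))"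
    by (simp add: eval_poly_sum mult_single eval_poly_single eval_monom_def lookup_add power_add prod.distrib ac_simps)
  also have "\<dots> = eval_poly f v * eval_poly g v"
    by (simp add: sum_product[symmetric] eval_poly_def eval_monom_def)
  finally show ?thesis .
qed

lemma eval_poly_power: "eval_poly (f ^ m) v = eval_poly f v ^ m"
proof (induction m)
  case 0
  have "eval_poly (single 0 1) v = 1 * eval_monom 0 v" by (rule eval_poly_single)
  then show ?case by (simp add: eval_monom_def)
qed (simp add: eval_poly_mult)

lemma eval_poly_scale:
  assumes "f \<in> forms d" shows "eval_poly f (\<lambda>i. c * v i) = c ^ d * eval_poly f v"
proof -
  have "eval_monom t (\<lambda>i. c * v i) = c ^ d * eval_monom t v" if "t \<in> keys f" for t
  proof -
    have "(\<Sum>i\<in>UNIV. lookup t i) = d" using assms that by (simp add: forms_def)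
    then show ?thesis by (auto simp: eval_monom_def power_mult_distrib prod.distrib power_sum[symmetric])
  qed
  then show ?thesis
    by (simp add: eval_poly_superset[of "keys f"] sum_distrib_left ac_simps)
qed

definition const_poly :: "'k::field \<Rightarrow> ('k, 'n::finite) mpolynomial" where "const_poly c = single 0 c"
definition coord :: "'n::finite \<Rightarrow> ('k::field, 'n) mpolynomial" where
  "coord i = single (single i 1) 1"

lemma const_poly_in: "const_poly c \<in> forms 0"
  unfolding const_poly_def by (rule single_in_forms) (simp add: total_degree_def)

lemma coord_in: "coord i \<in> forms 1"
  unfolding coord_def by (rule single_in_forms) (simp add: total_degree_def lookup_single when_def)

lemma eval_const: "eval_poly (const_poly c) v = c"
  unfolding const_poly_def eval_poly_single by (simp add: eval_monom_def)

lemma eval_coord: "eval_poly (coord i) v = v i"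
proof -
  have "eval_monom (single i 1) v = (\<Prod>j\<in>UNIV. if j = i then v j else 1)"
    unfolding eval_monom_def by (rule prod.cong) (auto simp: lookup_single when_def)
  then show ?thesis unfolding coord_def eval_poly_single by simp
qed

lemma coord_power_in:
  fixes c :: "'k::field" and i :: "'n::finite"
  shows "const_poly c * coord i ^ m \<in> forms m"
proof -
  have "coord i ^ m \<in> (forms m :: ('k, 'n) mpolynomial set)"
  proof (induction m)
    case (Suc m)
    then show ?case using forms.mult_in_G[OF coord_in[of i] Suc] by simp
  qed (simp add: forms.one_in_G)
  from forms.mult_in_G[OF const_poly_in this] show ?thesis by simp
qed

lemma forms_0:
  assumes "f \<in> forms 0" obtains c where "f = const_poly c"
proof -
  have "lookup f t = lookup (const_poly (lookup f 0)) t" for t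
  proof (cases "t = 0")
    case False
    then have "\<exists>i. lookup t i \<noteq> 0" by (metis lookup_zero poly_mapping_eqI)
    then have "total_degree t \<noteq> 0" by (auto simp: total_degree_def)
    then show ?thesis using assms False by (auto simp: forms_iff const_poly_def lookup_single when_def)
  qed (simp add: const_poly_def)
  then have "f = const_poly (lookup f 0)" by (rule poly_mapping_eqI)
  then show ?thesis by (rule that)
qed

lemma forms_field: "a \<in> forms 0 \<Longrightarrow> a \<noteq> 0 \<Longrightarrow> \<exists>b\<in>forms 0. b * a = (1 :: ('k::field, 'n::finite) mpolynomial)"
proof -
  assume "a \<in> forms 0" "a \<noteq> 0"
  then obtain c where c: "a = const_poly c" using forms_0 by blast
  then have "c \<noteq> 0" using \<open>a \<noteq> 0\<close> by (auto simp: const_poly_def)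
  then have "const_poly (inverse c) * a = 1" by (simp add: c const_poly_def mult_single)
  then show ?thesis using const_poly_in by blast
qed

lemma forms_1_span:
  fixes f :: "('k::field, 'n::finite) mpolynomial"
  assumes f: "f \<in> forms 1"
  shows "\<exists>c. (\<forall>x. c x \<in> forms 0) \<and> f = (\<Sum>x\<in>range (coord :: 'n \<Rightarrow> ('k, 'n) mpolynomial). c x * x)"
proof -
  have inj: "inj (coord :: 'n \<Rightarrow> ('k, 'n) mpolynomial)"
  proof (rule injI)
    fix i j :: 'n assume "coord i = (coord j :: ('k, 'n) mpolynomial)"
    then have "keys (coord i :: ('k, 'n) mpolynomial) = keys (coord j :: ('k, 'n) mpolynomial)" by simp
    then have "single i (1::nat) = single j 1" by (simp add: coord_def)
    then have "keys (single i (1::nat)) = keys (single j (1::nat))" by simp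
    then show "i = j" by simp
  qed
  let ?c = "\<lambda>x. const_poly (lookup f (single (inv_into UNIV coord x) 1))"
  have "(\<Sum>x\<in>range (coord :: 'n \<Rightarrow> ('k, 'n) mpolynomial). ?c x * x)
      = (\<Sum>i\<in>UNIV. const_poly (lookup f (single i 1)) * coord i)"
    by (subst sum.reindex[OF inj]) (simp add: inv_f_f[OF inj])
  also have "\<dots> = (\<Sum>i\<in>UNIV. single (single i 1) (lookup f (single i 1)))"
    by (simp add: const_poly_def coord_def mult_single)
  also have "\<dots> = f"
  proof (rule poly_mapping_eqI)
    fix t
    have "lookup (\<Sum>i\<in>UNIV. single (single i 1) (lookup f (single i 1))) t
        = (\<Sum>i\<in>UNIV. if single i 1 = t then lookup f t else 0)"
      unfolding lookup_sum by (rule sum.cong) (auto simp: lookup_single when_def)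
    also have "\<dots> = lookup f t"
    proof (cases "lookup f t = 0")
      case False
      then have "(\<Sum>i\<in>UNIV. lookup t i) = 1" using f by (simp add: forms_iff total_degree_def)
      then obtain j where j: "lookup t j = 1" "\<And>i. i \<noteq> j \<Longrightarrow> lookup t i = 0"
        unfolding sum_eq_1_iff[OF finite_UNIV] by (metis UNIV_I)
      have "(single i 1 = t) = (i = j)" for i
      proof
        assume "single i 1 = t"
        then have "lookup t i = 1" by auto
        then show "i = j" using j(2)[of i] by auto
      next
        assume "i = j"
        then show "single i 1 = t"
          by (intro poly_mapping_eqI) (use j in \<open>auto simp: lookup_single when_def\<close>)
      qed
      then show ?thesis by simp
    next
      case True
      then show ?thesis by (simp add: sum.neutral)
    qed
    finally show "lookup (\<Sum>i\<in>UNIV. single (single i 1) (lookup f (single i 1))) t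
        = lookup f t" .
  qed
  finally have "f = (\<Sum>x\<in>range (coord :: 'n \<Rightarrow> ('k, 'n) mpolynomial). ?c x * x)" by simp
  then show ?thesis by (intro exI[of _ ?c] conjI allI const_poly_in)
qed

text \<open>
  The vanishing ideal, described through homogeneous components. For nonempty \<open>S\<close> the condition on the component of
  degree zero follows from the others; for empty \<open>S\<close> it is the only condition and gives the irrelevant ideal,
  in accordance with the convention for the empty set.
\<close>

definition vanishing :: "('k::field, 'n::finite) proj_space set \<Rightarrow> ('k, 'n) mpolynomial set" where
  "vanishing S = {f. component 0 f = 0 \<and> (\<forall>d. \<forall>v\<in>cone S. eval_poly (component d f) v = 0)}"

lemma vanishing_mult:
  assumes f: "f \<in> vanishing S" shows "a * f \<in> vanishing S"
proof -
  have "component 0 (a * f) = 0" using forms.pos_mult[of f a] f by (simp add: forms.pos_def vanishing_def)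
  moreover have "eval_poly (component d (a * f)) v = 0" if v: "v \<in> cone S" for d v
  proof -
    let ?K = "{q. component q a \<noteq> 0}"
    have "component d (a * f) = component d (\<Sum>q\<in>?K. component q a * f)"
      by (subst (1) forms.comp_sum[of a, symmetric]) (simp add: sum_distrib_right)
    also have "\<dots> = (\<Sum>q\<in>?K. if q \<le> d then component q a * component (d - q) f else 0)"
      by (simp add: forms.comp_sum' forms.comp_mult[OF forms.comp_in])
    finally show ?thesis using f v by (auto simp: eval_poly_sum vanishing_def eval_poly_mult intro!: sum.neutral)
  qed
  ultimately show ?thesis by (simp add: vanishing_def)
qed

interpretation vanishing: graded_quotient forms component "vanishing S"
  for S :: "('k::field, 'n::finite) proj_space set"
proof
  show "f - g \<in> vanishing S" if "f \<in> vanishing S" "g \<in> vanishing S" for f g :: "('k, 'n) mpolynomial"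
    using that by (simp add: vanishing_def forms.comp_diff eval_poly_diff)
  show "component d f \<in> vanishing S" if "f \<in> vanishing S" for d and f :: "('k, 'n) mpolynomial"
    using that by (auto simp: vanishing_def forms.comp_hom[OF forms.comp_in])
qed (use vanishing_mult in \<open>auto simp: vanishing_def\<close>)

text \<open>
  An ideal is generated by any of its subsets that contains the homogeneous components of all its elements.
\<close>

lemma Idl_homogeneous:
  fixes J H :: "('k::field, 'n::finite) mpolynomial set"
  assumes J: "ideal J poly_ring" and H: "H \<subseteq> J" and comp: "\<And>f d. f \<in> J \<Longrightarrow> component d f \<in> H"
  shows "Idl\<^bsub>poly_ring\<^esub> H = J"
proof
  show "Idl\<^bsub>poly_ring\<^esub> H \<subseteq> J" by (rule ring.genideal_minimal[OF ring_from_type_algebra J H])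
  show "J \<subseteq> Idl\<^bsub>poly_ring\<^esub> H"
  proof
    fix f assume f: "f \<in> J"
    have "f \<in> L" if L: "ideal L poly_ring" "H \<subseteq> L" for L
    proof -
      interpret L: ideal L poly_ring by (rule L(1))
      have z: "0 \<in> L" using additive_subgroup.zero_closed[OF ideal.axioms(1)[OF L(1)]] by (simp add: type_ring_simps)
      have "(\<Sum>d\<in>K. component d f) \<in> L" for K
      proof (induction K rule: infinite_finite_induct)
        case (insert d K)
        have "component d f \<in> L" using comp[OF f] L(2) by blast
        then show ?case
          using insert additive_subgroup.a_closed[OF ideal.axioms(1)[OF L(1)]] by (simp add: type_ring_simps)
      qed (use z in simp_all)
      then show ?thesis using forms.comp_sum by metis
    qed
    then show "f \<in> Idl\<^bsub>poly_ring\<^esub> H" unfolding genideal_def by blast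
  qed
qed

lemma vanishing_ideal_eq: "vanishing_ideal S = vanishing S"
proof (cases "S = {}")
  case True
  have e: "vanishing S = forms.pos" using True by (simp add: vanishing_def forms.pos_def cone_def)
  have "Idl\<^bsub>poly_ring\<^esub> (\<Union>m\<in>{0<..}. forms m) = forms.pos"
  proof (rule Idl_homogeneous[OF forms.ideal_pos])
    show "(\<Union>m\<in>{0<..}. forms m) \<subseteq> forms.pos" using forms.comp_hom by (force simp: forms.pos_def)
    show "component d f \<in> (\<Union>m\<in>{0<..}. forms m)" if "f \<in> forms.pos" for d f
    proof (cases "d = 0")
      case True
      then have "component d f \<in> forms 1" using that graded_group_0[OF forms.graded_group_G] by (simp add: forms.pos_def)
      then show ?thesis by force
    next
      case False
      then show ?thesis using forms.comp_in by blast
    qed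
  qed
  then show ?thesis using True e by (simp add: vanishing_ideal_def irrel_def)
next
  case False
  then obtain p where p: "p \<in> S" by blast
  define v where "v = rep_proj_space p"
  have "proj_rel v v" unfolding v_def by (rule Quotient3_rep_reflp[OF Quotient_proj_space])
  then have v: "v \<in> cone S"
    using p Quotient3_abs_rep[OF Quotient_proj_space, of p] by (simp add: cone_def proj_rel_def v_def)
  have "Idl\<^bsub>poly_ring\<^esub> {f. (\<exists>d. f \<in> forms d) \<and> (\<forall>v\<in>cone S. eval_poly f v = 0)} = vanishing S"
  proof (rule Idl_homogeneous[OF vanishing.ideal_I])
    show "{f. (\<exists>d. f \<in> forms d) \<and> (\<forall>v\<in>cone S. eval_poly f v = 0)} \<subseteq> vanishing S"
    proof
      fix f assume "f \<in> {f. (\<exists>d. f \<in> forms d) \<and> (\<forall>v\<in>cone S. eval_poly f v = 0)}"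
      then obtain d where f: "f \<in> forms d" "\<forall>v\<in>cone S. eval_poly f v = 0" by blast
      have "component 0 f = 0"
      proof (cases "d = 0")
        case True
        then obtain c where c: "f = const_poly c" using f(1) forms_0 by blast
        then have "c = 0" using f(2) v eval_const by metis
        then show ?thesis using c by (simp add: const_poly_def)
      next
        case False
        then show ?thesis using forms.comp_hom[OF f(1)] by simp
      qed
      then show "f \<in> vanishing S" using f forms.comp_hom[OF f(1)] by (simp add: vanishing_def)
    qed
    show "component d f \<in> {f. (\<exists>d. f \<in> forms d) \<and> (\<forall>v\<in>cone S. eval_poly f v = 0)}" if "f \<in> vanishing S" for d f
      using that forms.comp_in by (auto simp: vanishing_def)
  qed
  then show ?thesis using False by (simp add: vanishing_ideal_def)
qed

lemma koszul_set_iff: "koszul_set S \<longleftrightarrow> koszul (poly_ring Quot vanishing S) (\<lambda>d. (\<lambda>f. vanishing S +>\<^bsub>poly_ring\<^esub> f) ` forms d)"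
  by (simp add: koszul_set_def coord_ring_def coord_grading_def[abs_def] vanishing_ideal_eq)

lemma vanishing_form_iff:
  assumes "f \<in> forms d"
  shows "f \<in> vanishing S \<longleftrightarrow> (d = 0 \<longrightarrow> f = 0) \<and> (\<forall>v\<in>cone S. eval_poly f v = 0)"
  using assms by (auto simp: vanishing_def forms.comp_hom[OF assms])

lemma cone_insert:
  fixes v w :: "'n \<Rightarrow> 'k::field"
  assumes v: "v \<noteq> (\<lambda>_. 0)"
  shows "w \<in> cone (insert (abs_proj_space v) T) \<longleftrightarrow> w \<in> cone T \<or> (\<exists>c. c \<noteq> 0 \<and> w = (\<lambda>i. c * v i))"
proof -
  have refl: "proj_rel u u" if "u \<noteq> (\<lambda>_. 0)" for u :: "'n \<Rightarrow> 'k"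
    using that by (auto simp: proj_rel_def intro!: exI[of _ 1])
  have eq: "abs_proj_space v = abs_proj_space w \<longleftrightarrow> proj_rel v w" if "w \<noteq> (\<lambda>_. 0)" for w
    using Quotient3_rel[OF Quotient_proj_space, of v w] refl[OF v] refl[OF that] by simp
  have nz: "(\<lambda>i. c * v i) \<noteq> (\<lambda>_. 0)" if "c \<noteq> 0" for c using v that by (auto simp: fun_eq_iff)
  show ?thesis
  proof (cases "w = (\<lambda>_. 0)")
    case True
    then show ?thesis using nz by (simp add: cone_def) metis
  next
    case False
    then show ?thesis using eq[OF False] v by (auto simp: cone_def proj_rel_def)
  qed
qed

section \<open>Removing points\<close>

text \<open>
  The case of a single point \<open>p\<close>, given by the coordinate vector \<open>v\<close>. All geometric input of the homological results
  is checked by evaluating forms at \<open>v\<close> and on \<open>T\<close>.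
\<close>

lemma koszul_set_remove_point:
  fixes T :: "('k::field, 'n::finite) proj_space set"
  assumes kos: "koszul_set (insert (abs_proj_space v) T)" and v: "v \<noteq> (\<lambda>_. 0)"
    and quadric: "q \<in> forms 2" "\<And>w. w \<in> cone T \<Longrightarrow> eval_poly q w = 0" "eval_poly q v \<noteq> 0"
  shows "koszul_set T"
proof -
  define S where "S = insert (abs_proj_space v) T"
  have cone: "w \<in> cone S \<longleftrightarrow> w \<in> cone T \<or> (\<exists>c. c \<noteq> 0 \<and> w = (\<lambda>i. c * v i))" for w
    unfolding S_def by (rule cone_insert[OF v])
  have vS: "v \<in> cone S" unfolding cone by (rule disjI2) (rule exI[of _ 1], simp)
  have S_iff: "(\<forall>w\<in>cone S. eval_poly f w = 0) \<longleftrightarrow> (\<forall>w\<in>cone T. eval_poly f w = 0) \<and> eval_poly f v = 0"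
    if f: "f \<in> forms d" for f d
  proof (intro iffI conjI ballI)
    fix w assume "\<forall>w\<in>cone S. eval_poly f w = 0" "w \<in> cone T"
    then show "eval_poly f w = 0" using cone by blast
  next
    assume "\<forall>w\<in>cone S. eval_poly f w = 0"
    then show "eval_poly f v = 0" using vS by blast
  next
    fix w assume "(\<forall>w\<in>cone T. eval_poly f w = 0) \<and> eval_poly f v = 0" "w \<in> cone S"
    then show "eval_poly f w = 0" using eval_poly_scale[OF f, of _ v] unfolding cone by auto
  qed
  obtain i where i: "v i \<noteq> 0" using v by auto
  \<comment> \<open>The form \<open>h\<close> is linear if possible. Otherwise every linear form that vanishes on \<open>T\<close> vanishes at \<open>v\<close> as well.\<close>
  obtain d h where h: "h \<in> forms d" "\<And>w. w \<in> cone T \<Longrightarrow> eval_poly h w = 0" "eval_poly h v \<noteq> 0"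
    and d: "d = 1 \<or> d = 2 \<and> (\<forall>f\<in>forms 1. (\<forall>w\<in>cone T. eval_poly f w = 0) \<longrightarrow> eval_poly f v = 0)"
  proof (cases "\<exists>f\<in>forms 1. (\<forall>w\<in>cone T. eval_poly f w = 0) \<and> eval_poly f v \<noteq> 0")
    case True
    then show ?thesis using that[of _ 1] by blast
  next
    case False
    then show ?thesis using that[OF quadric] by blast
  qed
  define P where "P j = {f \<in> forms j. eval_poly f v = 0}" for j
  have gmodule_P: "forms.gmodule (*) P"
    unfolding forms.gmodule_def graded_group_def
    using graded_group_0[OF forms.graded_group_G] graded_group_diff[OF forms.graded_group_G] forms.mult_in_G
    by (auto simp: P_def module_mult eval_poly_diff eval_poly_mult)
  \<comment> \<open>A power of a coordinate that is nonzero at \<open>v\<close> gives a multiple of \<open>u\<close> with the same value at \<open>v\<close> as \<open>f\<close>.\<close>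
  have subtract: "\<exists>g\<in>shift m forms j. f - u * g \<in> forms j \<and> eval_poly (f - u * g) v = 0 \<and> (eval_poly f v = 0 \<longrightarrow> g = 0)"
    if f: "f \<in> forms j" and u: "u \<in> forms m" "eval_poly u v \<noteq> 0" and m: "eval_poly f v = 0 \<or> m \<le> j" for f u m j
  proof (cases "eval_poly f v = 0")
    case True
    then show ?thesis using f graded_group_0[OF graded_group_shift[OF forms.graded_group_G]]
      by (intro bexI[of _ 0]) auto
  next
    case False
    let ?g = "const_poly (eval_poly f v / (eval_poly u v * v i ^ (j - m))) * coord i ^ (j - m)"
    have g: "?g \<in> forms (j - m)" by (rule coord_power_in)
    have "u * ?g \<in> forms j" using forms.mult_in_G[OF u(1) g] m False by simp
    then have "f - u * ?g \<in> forms j" by (rule graded_group_diff[OF forms.graded_group_G f])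
    moreover have "eval_poly (f - u * ?g) v = 0"
      using u(2) i by (simp add: eval_poly_diff eval_poly_mult eval_poly_power eval_const eval_coord)
    ultimately show ?thesis using g m False by (intro bexI[of _ ?g]) (simp_all add: shift_def)
  qed
  have hI: "h \<in> vanishing T" using vanishing_form_iff[OF h(1)] h(2) d by auto
  obtain B e D \<alpha> where RR: "residue_resolution forms (vanishing.pieces S) B e D \<alpha>"
    and lin: "\<And>i j. i < j \<Longrightarrow> residue_resolution.tor_zero B e D (*) forms forms.irr i j"
    using vanishing.koszul_imp_residue_resolution[of S] kos unfolding koszul_set_iff S_def by blast
  interpret F: residue_resolution forms "vanishing.pieces S" B e D \<alpha> by (rule RR)
  have IP: "vanishing.pieces S j \<subseteq> P j" for j
    using vanishing_form_iff vS by (auto simp: vanishing.pieces_def P_def)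
  have PG: "P j \<subseteq> forms j" for j by (auto simp: P_def)
  have vanP: "F.tor_zero (*) forms P q j" if "q < j" for q j
  proof (rule F.tor_zero_point_module[OF gmodule_P IP _ coord_in[of i]])
    show "P j \<subseteq> forms.irr j" for j
    proof
      fix f assume f: "f \<in> P j"
      show "f \<in> forms.irr j"
      proof (cases "j = 0")
        case True
        then obtain c where c: "f = const_poly c" using f forms_0 by (auto simp: P_def)
        then have "c = 0" using f by (simp add: P_def eval_const)
        then show ?thesis using c True by (simp add: forms.irr_def const_poly_def)
      next
        case False
        then show ?thesis using f by (simp add: P_def forms.irr_def)
      qed
    qed
    show "f \<in> P j" if "f \<in> forms j" "coord i * f \<in> P (j + 1)" for f j
      using that i by (simp add: P_def eval_poly_mult eval_coord)
    show "\<exists>g\<in>shift 1 forms j. f - coord i * g \<in> P j" if "f \<in> forms.irr j" for f j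
    proof -
      have f: "f \<in> forms j" using that forms.irr_sub by blast
      have "eval_poly f v = 0 \<or> 1 \<le> j" using that by (auto simp: forms.irr_def split: if_splits)
      then show ?thesis using subtract[OF f coord_in[of i]] i by (auto simp: eval_coord P_def)
    qed
  qed (use lin that in auto)
  have II': "vanishing.pieces S j \<subseteq> vanishing.pieces T j" for j
  proof
    fix f assume "f \<in> vanishing.pieces S j"
    then have f: "f \<in> forms j" "f \<in> vanishing S" by (auto simp: vanishing.pieces_def)
    then have "f \<in> vanishing T" using vanishing_form_iff[OF f(1)] S_iff[OF f(1)] by blast
    then show "f \<in> vanishing.pieces T j" using f(1) by (simp add: vanishing.pieces_def)
  qed
  have "\<exists>n E. forms.linear_resolution (vanishing.pieces T) n E"
  proof (rule F.linear_resolution_exists[OF vanishing.gmodule_pieces II' vanishing.pieces_irr])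
    show "F.tor_zero (*) forms (vanishing.pieces T) q j" if "q + 1 < j" for q j
    proof (rule F.tor_zero_quotient_by_form[where h = h and d = d and P = P])
      show "forms.gmodule (*) (vanishing.pieces T)" by (rule vanishing.gmodule_pieces)
      show "vanishing.pieces S j \<subseteq> vanishing.pieces T j" for j by (rule II')
      show "vanishing.pieces T j \<subseteq> forms j" for j by (simp add: vanishing.pieces_def)
      show "h \<in> forms d" "h \<in> vanishing.pieces T d" using h(1) hI by (auto simp: vanishing.pieces_def)
      show "d \<le> 2" using d by auto
      show "\<exists>g\<in>shift d forms j. f - h * g \<in> vanishing.pieces S j" if f: "f \<in> vanishing.pieces T j" for f j
      proof -
        have fj: "f \<in> forms j" and fT: "\<forall>w\<in>cone T. eval_poly f w = 0" and f0: "j = 0 \<Longrightarrow> f = 0"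
          using f vanishing_form_iff[of f j T] by (auto simp: vanishing.pieces_def)
        have "eval_poly f v = 0 \<or> d \<le> j"
        proof (cases "j = 0")
          case True
          then show ?thesis using f0 by simp
        next
          case False
          then show ?thesis using d fj fT by (cases "j = 1") auto
        qed
        from subtract[OF fj h(1) h(3) this] obtain g where
          g: "g \<in> shift d forms j" "f - h * g \<in> forms j" "eval_poly (f - h * g) v = 0" "eval_poly f v = 0 \<longrightarrow> g = 0" by blast
        have "f - h * g = 0" if "j = 0" using g(4) f0[OF that] by simp
        moreover have "\<forall>w\<in>cone T. eval_poly (f - h * g) w = 0"
          using fT h(2) by (simp add: eval_poly_diff eval_poly_mult)
        ultimately have "f - h * g \<in> vanishing S"
          using vanishing_form_iff[OF g(2)] S_iff[OF g(2)] g(3) by blast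
        then show ?thesis using g(1,2) by (auto simp: vanishing.pieces_def)
      qed
      show "forms.gmodule (*) P" by (rule gmodule_P)
      show "vanishing.pieces S j \<subseteq> P j" for j by (rule IP)
      show "P j \<subseteq> forms j" for j by (rule PG)
      show "h * f \<in> vanishing.pieces S (d + j) \<longleftrightarrow> f \<in> P j" if f: "f \<in> forms j" for f j
      proof -
        have hf: "h * f \<in> forms (d + j)" by (rule forms.mult_in_G[OF h(1) f])
        have dj: "d + j \<noteq> 0" using d by auto
        have "\<forall>w\<in>cone T. eval_poly (h * f) w = 0" using h(2) by (simp add: eval_poly_mult)
        moreover have "eval_poly (h * f) v = 0 \<longleftrightarrow> eval_poly f v = 0" using h(3) by (simp add: eval_poly_mult)
        ultimately have "h * f \<in> vanishing S \<longleftrightarrow> eval_poly f v = 0"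
          using vanishing_form_iff[OF hf, of S] S_iff[OF hf] dj by blast
        then show ?thesis using hf f by (simp add: vanishing.pieces_def P_def)
      qed
      show "F.tor_zero (*) forms P i j" if "i < j" for i j by (rule vanP[OF that])
      show "q + 1 < j" by (rule that)
    qed
    show "F.tor_zero (*) forms forms.irr q j" if "q < j" for q j by (rule lin[OF that])
    show "\<exists>b\<in>forms 0. b * a = 1" if "a \<in> forms 0" "a \<noteq> 0" for a :: "('k, 'n) mpolynomial"
      by (rule forms_field[OF that])
    show "finite (range (coord :: 'n \<Rightarrow> ('k, 'n) mpolynomial))" by simp
    show "\<exists>c. (\<forall>x. c x \<in> forms 0) \<and> f = (\<Sum>x\<in>range (coord :: 'n \<Rightarrow> ('k, 'n) mpolynomial). c x * x)"
      if "f \<in> forms 1" for f by (rule forms_1_span[OF that])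
  qed
  then obtain n E where "forms.linear_resolution (vanishing.pieces T) n E" by blast
  then show ?thesis unfolding koszul_set_iff by (rule vanishing.linear_resolution_imp_koszul)
qed

text \<open>
  The section of \<open>\<O>(2)\<close> that is supported at the point of \<open>v\<close> is the restriction of a quadric. On the coordinate vectors of that point
  it is the square of a coordinate that does not vanish there.
\<close>

lemma separating_quadric:
  assumes ind: "independent_conditions_on_quadrics S" and v: "v \<in> cone S"
  obtains q where "q \<in> forms 2" "eval_poly q v \<noteq> 0"
    "\<And>w. w \<in> cone S \<Longrightarrow> abs_proj_space w \<noteq> abs_proj_space v \<Longrightarrow> eval_poly q w = 0"
proof -
  obtain i where i: "v i \<noteq> 0" using v by (auto simp: cone_def)
  define \<phi> where "\<phi> = restrict (\<lambda>w. if abs_proj_space w = abs_proj_space v then (w i)\<^sup>2 else 0) (cone S)"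
  have scale: "(\<lambda>i. c * w i) \<in> cone S \<and> abs_proj_space (\<lambda>i. c * w i) = abs_proj_space w"
    if w: "w \<in> cone S" and c: "c \<noteq> 0" for w c
  proof -
    have nz: "w \<noteq> (\<lambda>_. 0)" using w by (simp add: cone_def)
    then have nz': "(\<lambda>i. c * w i) \<noteq> (\<lambda>_. 0)" using c by (auto simp: fun_eq_iff)
    have "proj_rel w (\<lambda>i. c * w i)" using nz nz' c by (auto simp: proj_rel_def)
    then have "abs_proj_space w = abs_proj_space (\<lambda>i. c * w i)"
      by (rule Quotient3_rel_abs[OF Quotient_proj_space])
    then show ?thesis using w nz' by (simp add: cone_def)
  qed
  have "\<phi> \<in> twist_sections 2 S"
    using scale by (auto simp: twist_sections_def \<phi>_def power_mult_distrib)
  then have "\<phi> \<in> evaluation_map S ` forms 2"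
    using ind by (simp add: independent_conditions_on_quadrics_def)
  then obtain q where q: "q \<in> forms 2" "\<phi> = restrict (eval_poly q) (cone S)"
    by (auto simp: evaluation_map_def)
  have e: "eval_poly q w = \<phi> w" if "w \<in> cone S" for w using q(2) that by simp
  show ?thesis
  proof (rule that[OF q(1)])
    show "eval_poly q v \<noteq> 0" using e[OF v] v i by (simp add: \<phi>_def)
    show "eval_poly q w = 0" if "w \<in> cone S" "abs_proj_space w \<noteq> abs_proj_space v" for w
      using e[OF that(1)] that by (simp add: \<phi>_def)
  qed
qed

theorem corollary0p4:
  fixes S T :: "('k::field, 'n::finite) proj_space set"
  assumes "finite S"
    and "koszul_set S"
    and "independent_conditions_on_quadrics S"
    and "T \<subseteq> S"
  shows "koszul_set T"
proof -
  have "koszul_set (S - U)" if "finite U" "U \<subseteq> S" for U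
    using that
  proof (induction U rule: finite_induct)
    case empty
    then show ?case using assms(2) by simp
  next
    case (insert p U)
    define v where "v = rep_proj_space p"
    have vp: "abs_proj_space v = p"
      unfolding v_def by (rule Quotient3_abs_rep[OF Quotient_proj_space])
    have "proj_rel v v" unfolding v_def by (rule Quotient3_rep_reflp[OF Quotient_proj_space])
    then have v: "v \<noteq> (\<lambda>_. 0)" by (simp add: proj_rel_def)
    then have vS: "v \<in> cone S" using vp insert.prems by (simp add: cone_def)
    obtain q where q: "q \<in> forms 2" "eval_poly q v \<noteq> 0"
      "\<And>w. w \<in> cone S \<Longrightarrow> abs_proj_space w \<noteq> p \<Longrightarrow> eval_poly q w = 0"
      using separating_quadric[OF assms(3) vS] vp by blast
    show ?case
    proof (rule koszul_set_remove_point[OF _ v q(1) _ q(2)])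
      have "insert (abs_proj_space v) (S - insert p U) = S - U"
        using vp insert by blast
      then show "koszul_set (insert (abs_proj_space v) (S - insert p U))" using insert by simp
      show "eval_poly q w = 0" if "w \<in> cone (S - insert p U)" for w
        using q(3) that by (auto simp: cone_def)
    qed
  qed
  from this[of "S - T"] assms(1,4) show ?thesis by (simp add: double_diff)
qed

end
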